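(* Let $n=2$ and let $f_1,\ldots,f_m$ be real-analytic vector fields on $\mathbb{R}^2$ satisfying Hörmander's bracket generating condition $\mathrm{Lie}_{\{f_1,\ldots,f_m\}}(x)=\mathbb{R}^2$ for every $x\in\mathbb{R}^2$. Let $\mathcal{K}\subset\mathbb{R}^2$ be a nonempty closed set. Then the minimum time function $\mathcal{T}_{\mathcal{K}}$ is locally Lipschitz continuous on $\mathbb{R}^2\setminus\mathcal{K}$.
   Context: Control system: $y'(t)=f(y(t))u(t)=\sum_{i=1}^m u_i(t)f_i(y(t))$ for a.e. $t\ge 0$, where the controls are the Lebesgue measurable maps $u:[0,+\infty[\to\bar B^m_1(0)$ and $\bar B_1^m(0)$ is the closed unit ball of $\mathbb{R}^m$ (Euclidean norm). The vector fields are not assumed to be linearly independent nor to have sublinear growth ($m\ge 1$ is arbitrary). For $x\in\mathbb{R}^n$ and a control $u$, $y_{x,u}$ denotes the solution (on its interval of existence) with $y_{x,u}(0)=x$. The minimum time function with target $\mathcal{K}$ is $\mathcal{T}_{\mathcal{K}}(x)=\inf\{t\ge 0 : y_{x,u}(t)\in\mathcal{K}\text{ for some control }u\}$; under Hörmander's condition it is finite everywhere. Commutators: $[f,g](x)=Dg(x)(f(x))-Df(x)(g(x))$. $\mathrm{Lie}_{\{f_1,\ldots,f_m\}}$ is the Lie algebra generated by $f_1,\dots,f_m$ and all their iterated commutators, and $\mathrm{Lie}_{\{f_1,\ldots,f_m\}}(x)=\{g(x): g\in \mathrm{Lie}_{\{f_1,\ldots,f_m\}}\}$. *)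

theory Defs
  imports "HOL-Analysis.Analysis"
begin

text \<open>
  Real analyticity in several variables: near every point the function is the sum of its
  power series, indexed by multi-indices \<open>\<alpha> :: 'n \<Rightarrow> nat\<close>. The sum is unordered, that is
  (in a finite-dimensional space) absolute.
\<close>

definition real_analytic :: "(real ^ 'n \<Rightarrow> real ^ 'k) \<Rightarrow> bool" where
  "real_analytic g \<longleftrightarrow>
     (\<forall>x. \<exists>r>0. \<exists>c :: ('n \<Rightarrow> nat) \<Rightarrow> real ^ 'k. \<forall>h. (\<forall>i. \<bar>h $ i\<bar> < r) \<longrightarrow>
        ((\<lambda>\<alpha>. (\<Prod>i\<in>UNIV. (h $ i) ^ \<alpha> i) *\<^sub>R c \<alpha>) has_sum g (x + h)) UNIV)"

definition lie_bracket ::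
    "('a::real_normed_vector \<Rightarrow> 'a) \<Rightarrow> ('a \<Rightarrow> 'a) \<Rightarrow> 'a \<Rightarrow> 'a" where
  "lie_bracket f g = (\<lambda>x. frechet_derivative g (at x) (f x) - frechet_derivative f (at x) (g x))"

text \<open>
  The set below is only meaningful when \<open>F\<close> consists of smooth fields; then all its elements are
  smooth, so that the total function \<^const>\<open>frechet_derivative\<close> is the actual derivative.
\<close>

inductive_set lie_algebra_generated ::
    "('a::real_normed_vector \<Rightarrow> 'a) set \<Rightarrow> ('a \<Rightarrow> 'a) set"
  for F :: "('a \<Rightarrow> 'a) set" where
  gen: "f \<in> F \<Longrightarrow> f \<in> lie_algebra_generated F"
| zero: "(\<lambda>x. 0) \<in> lie_algebra_generated F"
| add: "\<lbrakk>f \<in> lie_algebra_generated F; g \<in> lie_algebra_generated F\<rbrakk>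
    \<Longrightarrow> (\<lambda>x. f x + g x) \<in> lie_algebra_generated F"
| scale: "f \<in> lie_algebra_generated F \<Longrightarrow> (\<lambda>x. a *\<^sub>R f x) \<in> lie_algebra_generated F"
| bracket: "\<lbrakk>f \<in> lie_algebra_generated F; g \<in> lie_algebra_generated F\<rbrakk>
    \<Longrightarrow> lie_bracket f g \<in> lie_algebra_generated F"

definition hoermander :: "('m \<Rightarrow> 'a::real_normed_vector \<Rightarrow> 'a) \<Rightarrow> bool" where
  "hoermander f \<longleftrightarrow> (\<forall>x. {g x | g. g \<in> lie_algebra_generated (range f)} = UNIV)"

text \<open>
  Absolute continuity on \<open>[a, b]\<close>. The finite families of non-overlapping compact subintervals
  are the library's divisions; \<open>Inf k\<close> and \<open>Sup k\<close> are the endpoints of the interval \<open>k\<close>.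
\<close>

definition abs_continuous_on :: "real \<Rightarrow> real \<Rightarrow> (real \<Rightarrow> 'a::real_normed_vector) \<Rightarrow> bool" where
  "abs_continuous_on a b y \<longleftrightarrow>
     (\<forall>\<epsilon>>0. \<exists>\<delta>>0. \<forall>D S. D division_of S \<and> S \<subseteq> {a..b} \<and> (\<Sum>k\<in>D. Sup k - Inf k) < \<delta>
        \<longrightarrow> (\<Sum>k\<in>D. norm (y (Sup k) - y (Inf k))) < \<epsilon>)"

definition is_control :: "(real \<Rightarrow> real ^ 'm) \<Rightarrow> bool" where
  "is_control u \<longleftrightarrow> u \<in> borel_measurable (lebesgue_on {0..}) \<and> (\<forall>t\<ge>0. u t \<in> cball 0 1)"

text \<open>
  Caratheodory solution of the control system on \<open>[0, T]\<close>. Only the values of \<open>y\<close> on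
  \<open>[0, T]\<close> matter.
\<close>

definition solution_on ::
    "('m::finite \<Rightarrow> 'a::real_normed_vector \<Rightarrow> 'a) \<Rightarrow> (real \<Rightarrow> real ^ 'm) \<Rightarrow> 'a \<Rightarrow> real
      \<Rightarrow> (real \<Rightarrow> 'a) \<Rightarrow> bool" where
  "solution_on f u x T y \<longleftrightarrow>
     y 0 = x \<and> abs_continuous_on 0 T y \<and>
     (AE t in lebesgue_on {0..T}.
        (y has_vector_derivative (\<Sum>i\<in>UNIV. u t $ i *\<^sub>R f i (y t))) (at t within {0..T}))"

text \<open>
  The time \<open>t\<close> lies in the interval of existence of the trajectory issuing from \<open>x\<close> iff there is
  a solution on \<open>[0, t]\<close>, so blow-up needs no separate treatment. The value is \<open>\<infinity>\<close> if the
  target cannot be reached.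
\<close>

definition min_time ::
    "('m::finite \<Rightarrow> 'a::real_normed_vector \<Rightarrow> 'a) \<Rightarrow> 'a set \<Rightarrow> 'a \<Rightarrow> ereal" where
  "min_time f K x =
     Inf {ereal t | t. t \<ge> 0 \<and> (\<exists>u y. is_control u \<and> solution_on f u x t y \<and> y t \<in> K)}"

definition locally_lipschitz_on ::
    "'a::metric_space set \<Rightarrow> ('a \<Rightarrow> 'b::metric_space) \<Rightarrow> bool" where
  "locally_lipschitz_on S g \<longleftrightarrow> (\<forall>x\<in>S. \<exists>r>0. \<exists>L. L-lipschitz_on (ball x r \<inter> S) g)"

end

theory Submission
  imports Defs
begin

text \<open>
  Let \<open>x\<^sub>0 \<notin> K\<close>. If a nearly optimal trajectory from a point \<open>x\<close> near \<open>x\<^sub>0\<close> soon visits a point \<open>q\<close>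
  where the fields span the plane (quantitatively), then from \<open>x'\<close> near \<open>x\<close> one uses almost the same
  control to arrive at distance \<open>O(|x - x'|)\<close> from \<open>q\<close>, moves to \<open>q\<close> along a segment in time
  \<open>O(|x - x'|)\<close>, and continues along the trajectory. This gives the Lipschitz estimate.

  Otherwise the trajectory stays where the fields are almost parallel to one of them, say \<open>X\<close>, and
  so, by Gronwall, near the integral curve of \<open>X\<close> through \<open>x\<^sub>0\<close>. If all fields were parallel to \<open>X\<close>
  along a piece of this curve, so would be all their brackets, contradicting Hoermander's
  condition. So arbitrarily close to \<open>x\<^sub>0\<close>, on either side, the curve carries points where the
  fields span the plane, and the trajectory cannot pass these. It therefore remains close to
  \<open>x\<^sub>0\<close> for a fixed time, although the small displacement could be made in much shorter time: reach a
  point of full rank along the curve, move freely there, and come back. So it is not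
  nearly optimal.
\<close>

section \<open>Power series in several variables\<close>

text \<open>Controls are merely measurable, so the comparison trajectory from \<open>x'\<close> is
  not obtained by solving the system again with the given control. That control is first replaced by
  a continuous one close to it in L1; Picard iteration then gives a C1 trajectory, which can also be
  run backwards because the control ball is symmetric. The price is an arbitrarily small extra error
  at the end point, and choosing it as \<open>dist x x'\<close> hides it in the Lipschitz constant.
  The fields may grow arbitrarily, so all estimates live in a ball that misses the target. A
  trajectory to the target has to leave this ball, and outside nothing is estimated: the old
  trajectory is reused as it is. The degenerate alternative gives no Lipschitz bound by itself. It
  saves a fixed time \<delta>, so it cannot occur for a trajectory whose time is within less than
  \<delta> of the infimum. Analyticity supplies smoothness, which makes every iterated bracket a
  combination of actual derivatives.\<close>

definition monomial :: "real ^ 'n \<Rightarrow> ('n \<Rightarrow> nat) \<Rightarrow> real" where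
  "monomial h \<alpha> = (\<Prod>i\<in>UNIV. (h $ i) ^ \<alpha> i)"

definition dmonomial :: "'n \<Rightarrow> real ^ 'n \<Rightarrow> ('n \<Rightarrow> nat) \<Rightarrow> real" where
  "dmonomial j h \<alpha> = real (\<alpha> j) * (h $ j) ^ (\<alpha> j - 1) * (\<Prod>i\<in>UNIV - {j}. (h $ i) ^ \<alpha> i)"

lemma has_derivative_monomial:
  fixes h :: "real ^ 'n"
  shows "((\<lambda>h. monomial h \<alpha>) has_derivative (\<lambda>v. \<Sum>j\<in>UNIV. v $ j * dmonomial j h \<alpha>)) (at h within S)"
  unfolding monomial_def
  by (rule has_derivative_eq_rhs, rule has_derivative_prod, rule has_derivative_power,
      rule bounded_linear_imp_has_derivative[OF bounded_linear_vec_nth])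
     (simp add: dmonomial_def algebra_simps fun_eq_iff)

lemma dmonomial_upd_Suc:
  "dmonomial j h (\<beta>(j := Suc (\<beta> j))) = real (Suc (\<beta> j)) * monomial h \<beta>"
proof -
  have "monomial h \<beta> = (h $ j) ^ \<beta> j * (\<Prod>i\<in>UNIV - {j}. (h $ i) ^ \<beta> i)"
    unfolding monomial_def by (rule prod.remove) auto
  moreover have "(\<Prod>i\<in>UNIV - {j}. (h $ i) ^ (\<beta>(j := Suc (\<beta> j))) i) = (\<Prod>i\<in>UNIV - {j}. (h $ i) ^ \<beta> i)"
    by (rule prod.cong) auto
  ultimately show ?thesis by (simp add: dmonomial_def)
qed

text \<open>The tangent estimate for \<open>b ^ n\<close> at \<open>a\<close>, with the term
  \<open>a ^ n\<close> dropped. It trades the factor \<open>n\<close> produced by differentiation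
  for the gap \<open>b - a\<close>, uniformly in the degree.\<close>

lemma power_diff_lower_bound:
  fixes a b :: real
  assumes "0 \<le> a" "a \<le> b"
  shows "real n * a ^ (n - 1) * (b - a) \<le> b ^ n"
proof (induction n)
  case (Suc n)
  show ?case
  proof (cases n)
    case 0
    then show ?thesis using assms by simp
  next
    case (Suc k)
    have "real (Suc n) * a ^ n * (b - a) = a * (real n * a ^ (n - 1) * (b - a)) + a ^ n * (b - a)"
      using Suc by (simp add: algebra_simps)
    also have "\<dots> \<le> a * b ^ n + b ^ n * (b - a)"
      using Suc.IH assms by (intro add_mono mult_left_mono mult_right_mono power_mono) auto
    also have "\<dots> = b ^ Suc n" by (simp add: algebra_simps)
    finally show ?thesis by simp
  qed
qed simp

text \<open>A real substitute for Cauchy's estimate: enlarging the radius from \<open>a\<close> to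
  \<open>b\<close> absorbs the factor \<open>\<alpha> j\<close>, so a differentiated series is
  dominated by the original one.\<close>

lemma abs_dmonomial_le:
  fixes h :: "real ^ 'n"
  assumes "\<And>i. \<bar>h $ i\<bar> \<le> a" "a < b"
  shows "\<bar>dmonomial j h \<alpha>\<bar> \<le> monomial (\<chi> i. b) \<alpha> / (b - a)"
proof -
  have a: "0 \<le> a" using assms(1)[of j] by linarith
  have "\<bar>dmonomial j h \<alpha>\<bar> = real (\<alpha> j) * \<bar>h $ j\<bar> ^ (\<alpha> j - 1) * (\<Prod>i\<in>UNIV - {j}. \<bar>h $ i\<bar> ^ \<alpha> i)"
    by (simp add: dmonomial_def abs_mult abs_prod power_abs)
  also have "\<dots> \<le> real (\<alpha> j) * a ^ (\<alpha> j - 1) * (\<Prod>i\<in>UNIV - {j}. b ^ \<alpha> i)"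
    using assms a by (intro mult_mono prod_mono power_mono conjI mult_left_mono prod_nonneg)
      (auto intro!: order_trans[OF assms(1)])
  also have "\<dots> \<le> (b ^ \<alpha> j / (b - a)) * (\<Prod>i\<in>UNIV - {j}. b ^ \<alpha> i)"
    using power_diff_lower_bound[of a b "\<alpha> j"] assms a
    by (intro mult_right_mono prod_nonneg) (auto simp: field_simps)
  also have "\<dots> = monomial (\<chi> i. b) \<alpha> / (b - a)"
    unfolding monomial_def by (subst prod.remove[of _ j]) auto
  finally show ?thesis .
qed

definition real_analytic_fun :: "(real ^ 'n \<Rightarrow> real) \<Rightarrow> bool" where
  "real_analytic_fun g \<longleftrightarrow>
     (\<forall>x. \<exists>r>0. \<exists>c. \<forall>h. (\<forall>i. \<bar>h $ i\<bar> < r) \<longrightarrow>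
        ((\<lambda>\<alpha>. monomial h \<alpha> * c \<alpha>) has_sum g (x + h)) UNIV)"

lemma real_analytic_component:
  assumes "real_analytic g"
  shows "real_analytic_fun (\<lambda>x. g x $ k)"
  unfolding real_analytic_fun_def
proof
  fix x
  obtain r c where r: "r > 0"
    "\<And>h. (\<forall>i. \<bar>h $ i\<bar> < r) \<Longrightarrow>
        ((\<lambda>\<alpha>. (\<Prod>i\<in>UNIV. (h $ i) ^ \<alpha> i) *\<^sub>R c \<alpha>) has_sum g (x + h)) UNIV"
    using assms unfolding real_analytic_def by meson
  show "\<exists>r>0. \<exists>c. \<forall>h. (\<forall>i. \<bar>h $ i\<bar> < r) \<longrightarrow>
        ((\<lambda>\<alpha>. monomial h \<alpha> * c \<alpha>) has_sum g (x + h) $ k) UNIV"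
    using r(1) has_sum_bounded_linear[OF bounded_linear_vec_nth r(2), of _ k]
    by (intro exI[of _ r] conjI exI[of _ "\<lambda>\<alpha>. c \<alpha> $ k"]) (auto simp: monomial_def)
qed

text \<open>Termwise differentiation. Absolute convergence at one corner point majorises all
  differentiated series on a smaller cube, and the resulting uniform convergence justifies the
  interchange.\<close>

lemma power_series_has_derivative:
  fixes c :: "('n::finite \<Rightarrow> nat) \<Rightarrow> real" and G :: "real ^ 'n \<Rightarrow> real"
  assumes G: "\<And>h. (\<forall>i. \<bar>h $ i\<bar> < r) \<Longrightarrow> ((\<lambda>\<alpha>. monomial h \<alpha> * c \<alpha>) has_sum G h) UNIV"
    and h: "\<forall>i. \<bar>h $ i\<bar> < r"
  shows "\<And>j. (\<lambda>\<alpha>. dmonomial j h \<alpha> * c \<alpha>) summable_on UNIV" (is "\<And>j. ?S j")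
    and "(G has_derivative (\<lambda>v. \<Sum>j\<in>UNIV. v $ j * (\<Sum>\<^sub>\<infinity>\<alpha>. dmonomial j h \<alpha> * c \<alpha>))) (at h)"
proof -
  \<comment> \<open>The radii satisfy \<open>m < a < b < r\<close>: \<open>h\<close> lies in the
    open cube \<open>S\<close> of radius \<open>a\<close>, and the point with all coordinates
    \<open>b\<close> is still in the domain of convergence.\<close>
  define m where "m = Max (range (\<lambda>i. \<bar>h $ i\<bar>))"
  have m: "\<bar>h $ i\<bar> \<le> m" for i unfolding m_def by (rule Max_ge) auto
  have mr: "m < r" unfolding m_def by (subst Max_less_iff) (use h in auto)
  have m0: "0 \<le> m" using m[of undefined] by linarith
  obtain a where a: "m < a" "a < r" using dense[OF mr] by blast
  obtain b where b: "a < b" "b < r" using dense[OF a(2)] by blast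
  define S where "S = {x :: real ^ 'n. \<forall>i. \<bar>x $ i\<bar> < a}"
  \<comment> \<open>The majorant, independent of the point of \<open>S\<close> and of the direction
    \<open>j\<close>.\<close>
  define B where "B \<alpha> = monomial (\<chi> i. b) \<alpha> / (b - a) * \<bar>c \<alpha>\<bar>" for \<alpha>
  have bb: "((\<lambda>\<alpha>. monomial (\<chi> i. b) \<alpha> * c \<alpha>) has_sum G (\<chi> i. b)) UNIV"
    using G[of "\<chi> i. b"] a b m0 by auto
  have B: "B summable_on UNIV"
  proof -
    have "(\<lambda>\<alpha>. norm (monomial (\<chi> i. b) \<alpha> * c \<alpha>)) summable_on UNIV"
      by (rule summable_on_iff_abs_summable_on_real[THEN iffD1, OF has_sum_imp_summable[OF bb]])
    then have "(\<lambda>\<alpha>. norm (monomial (\<chi> i. b) \<alpha> * c \<alpha>) * (1 / (b - a))) summable_on UNIV"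
      by (rule summable_on_cmult_left)
    moreover have "B \<alpha> = norm (monomial (\<chi> i. b) \<alpha> * c \<alpha>) * (1 / (b - a))" for \<alpha>
      using a b m0 by (auto simp: B_def abs_mult monomial_def prod_nonneg)
    ultimately show ?thesis by (simp cong: summable_on_cong)
  qed
  have dB: "norm (dmonomial j x \<alpha> * c \<alpha>) \<le> B \<alpha>" if "x \<in> S" for x j \<alpha>
  proof -
    have "\<bar>dmonomial j x \<alpha>\<bar> \<le> monomial (\<chi> i. b) \<alpha> / (b - a)"
      using that b unfolding S_def by (intro abs_dmonomial_le) (auto intro: less_imp_le)
    from mult_right_mono[OF this, of "\<bar>c \<alpha>\<bar>"] show ?thesis by (simp add: B_def abs_mult)
  qed
  have dsum: "(\<lambda>\<alpha>. dmonomial j x \<alpha> * c \<alpha>) summable_on UNIV" if "x \<in> S" for x j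
  proof -
    have "(\<lambda>\<alpha>. norm (dmonomial j x \<alpha> * c \<alpha>)) summable_on UNIV"
      using dB[OF that] by (intro summable_on_comparison_test[OF B]) auto
    then show ?thesis by (rule abs_summable_summable)
  qed
  have hS: "h \<in> S" using m a unfolding S_def by (auto intro: le_less_trans)
  show "?S j" for j using dsum[OF hS] .
  have inf: "infinite (UNIV :: ('n \<Rightarrow> nat) set)"
  proof
    assume "finite (UNIV :: ('n \<Rightarrow> nat) set)"
    moreover have "inj (\<lambda>k::nat. (\<lambda>_::'n. k))" by (auto simp: inj_def fun_eq_iff)
    ultimately show False using finite_imageD[of "\<lambda>k::nat. (\<lambda>_::'n. k)" UNIV]
        finite_subset[of "range (\<lambda>k::nat. (\<lambda>_::'n. k))" UNIV] by auto
  qed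
  \<comment> \<open>Enumerating the multi-indices turns unordered sums into ordinary series, to
    which the M-test and the theorem on differentiating series apply.\<close>
  define e where "e = from_nat_into (UNIV :: ('n \<Rightarrow> nat) set)"
  have e: "bij_betw e UNIV UNIV" unfolding e_def
    by (rule bij_betw_from_nat_into) (auto simp: inf)
  have sums: "(\<lambda>n. F (e n)) sums s" if "(F has_sum s) UNIV" for F :: "('n \<Rightarrow> nat) \<Rightarrow> real" and s
    using that has_sum_reindex_bij_betw[OF e, of F s] has_sum_imp_sums by blast
  define D where "D j x = (\<Sum>\<^sub>\<infinity>\<alpha>. dmonomial j x \<alpha> * c \<alpha>)" for j x
  have ul: "uniform_limit S (\<lambda>n x. \<Sum>i<n. dmonomial j x (e i) * c (e i)) (D j) sequentially" for j
  proof -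
    have s: "suminf (\<lambda>i. dmonomial j x (e i) * c (e i)) = D j x" if "x \<in> S" for x
      using sums[OF has_sum_infsum[OF dsum[OF that]]] unfolding D_def by (metis sums_unique)
    have "uniform_limit S (\<lambda>n x. \<Sum>i<n. dmonomial j x (e i) * c (e i)) (\<lambda>x. suminf (\<lambda>i. dmonomial j x (e i) * c (e i))) sequentially"
    proof (rule Weierstrass_m_test)
      show "summable (\<lambda>n. B (e n))" using sums[OF has_sum_infsum[OF B]] by (rule sums_summable)
    qed (use dB in auto)
    then show ?thesis using s by (simp cong: uniform_limit_cong')
  qed
  have "\<exists>g. \<forall>x\<in>S. (\<lambda>n. monomial x (e n) * c (e n)) sums (g x) \<and>
      (g has_derivative (\<lambda>v. \<Sum>j\<in>UNIV. v $ j * D j x)) (at x within S)"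
  proof (rule has_derivative_series[where f' = "\<lambda>n x v. (\<Sum>j\<in>UNIV. v $ j * dmonomial j x (e n)) * c (e n)"])
    show "convex S"
    proof -
      have "S = (\<Inter>i. {x. inner (axis i 1) x < a} \<inter> {x. inner (axis i 1) x > -a})"
        by (auto simp: S_def inner_axis' abs_less_iff) (metis add.inverse_inverse neg_less_iff_less)+
      then show ?thesis
        by (simp add: convex_INT convex_Int convex_halfspace_lt convex_halfspace_gt)
    qed
    show "(\<lambda>n. monomial h (e n) * c (e n)) sums G h" using G[OF h] by (rule sums)
    show "((\<lambda>x. monomial x (e n) * c (e n)) has_derivative
        (\<lambda>v. (\<Sum>j\<in>UNIV. v $ j * dmonomial j x (e n)) * c (e n))) (at x within S)" for n x
      by (intro has_derivative_mult_left has_derivative_monomial)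
    show "\<forall>\<^sub>F n in sequentially. \<forall>x\<in>S. \<forall>v.
        norm ((\<Sum>i<n. (\<Sum>j\<in>UNIV. v $ j * dmonomial j x (e i)) * c (e i)) - (\<Sum>j\<in>UNIV. v $ j * D j x))
          \<le> \<epsilon> * norm v" if "\<epsilon> > 0" for \<epsilon>
    proof -
      define \<delta> where "\<delta> = \<epsilon> / CARD('n)"
      have \<delta>: "\<delta> > 0" using that by (simp add: \<delta>_def)
      have "\<forall>\<^sub>F n in sequentially. \<forall>j. \<forall>x\<in>S. dist (\<Sum>i<n. dmonomial j x (e i) * c (e i)) (D j x) < \<delta>"
        by (intro eventually_all_finite uniform_limitD[OF ul \<delta>])
      then show ?thesis
      proof eventually_elim
        case (elim n)
        show ?case
        proof (intro ballI allI)
          fix x v assume x: "x \<in> S"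
          have "(\<Sum>i<n. (\<Sum>j\<in>UNIV. v $ j * dmonomial j x (e i)) * c (e i)) - (\<Sum>j\<in>UNIV. v $ j * D j x)
             = (\<Sum>j\<in>UNIV. v $ j * ((\<Sum>i<n. dmonomial j x (e i) * c (e i)) - D j x))"
            by (simp add: sum_distrib_right sum_distrib_left right_diff_distrib sum_subtractf mult.assoc)
               (rule sum.swap)
          also have "norm \<dots> \<le> (\<Sum>j\<in>(UNIV :: 'n set). norm v * \<delta>)"
          proof -
            have "\<bar>v $ j * ((\<Sum>i<n. dmonomial j x (e i) * c (e i)) - D j x)\<bar> \<le> norm v * \<delta>" for j
              unfolding abs_mult using elim x \<delta>
              by (intro mult_mono component_le_norm_cart) (auto simp: dist_real_def intro: less_imp_le)
            then show ?thesis
              unfolding real_norm_def by (intro order_trans[OF sum_abs] sum_mono)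
          qed
          also have "\<dots> = \<epsilon> * norm v" by (simp add: \<delta>_def)
          finally show "norm ((\<Sum>i<n. (\<Sum>j\<in>UNIV. v $ j * dmonomial j x (e i)) * c (e i)) - (\<Sum>j\<in>UNIV. v $ j * D j x)) \<le> \<epsilon> * norm v" .
        qed
      qed
    qed
  qed (use hS in auto)
  then obtain g where g: "\<And>x. x \<in> S \<Longrightarrow> (\<lambda>n. monomial x (e n) * c (e n)) sums (g x)"
      "\<And>x. x \<in> S \<Longrightarrow> (g has_derivative (\<lambda>v. \<Sum>j\<in>UNIV. v $ j * D j x)) (at x within S)" by blast
  have gG: "g x = G x" if "x \<in> S" for x
    using g(1)[OF that] sums[OF G[of x]] that a by (auto simp: S_def intro: sums_unique2 less_trans)
  have opn: "open S"
  proof -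
    have "S = (\<Inter>i. {x. \<bar>x $ i\<bar> < a})" by (auto simp: S_def)
    moreover have "open {x::real^'n. \<bar>x $ i\<bar> < a}" for i by (intro open_Collect_less continuous_intros)
    ultimately show ?thesis by (auto intro!: open_INT)
  qed
  have "(G has_derivative (\<lambda>v. \<Sum>j\<in>UNIV. v $ j * D j h)) (at h within S)"
    using has_derivative_transform[OF hS _ g(2)[OF hS]] gG by auto
  then show "(G has_derivative (\<lambda>v. \<Sum>j\<in>UNIV. v $ j * (\<Sum>\<^sub>\<infinity>\<alpha>. dmonomial j h \<alpha> * c \<alpha>))) (at h)"
    using at_within_open[OF hS opn] by (simp add: D_def)
qed

text \<open>Multi-indices with \<open>\<alpha> j = 0\<close> contribute nothing, and all others
  arise by raising some \<open>\<beta>\<close> by one at \<open>j\<close>. After this reindexing the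
  differentiated series is again a power series, so partial derivatives stay analytic.\<close>

lemma has_sum_dmonomial_shift:
  fixes c :: "('n::finite \<Rightarrow> nat) \<Rightarrow> real"
  assumes "(\<lambda>\<alpha>. dmonomial j h \<alpha> * c \<alpha>) summable_on UNIV"
  shows "((\<lambda>\<beta>. monomial h \<beta> * (real (Suc (\<beta> j)) * c (\<beta>(j := Suc (\<beta> j))))) has_sum
            (\<Sum>\<^sub>\<infinity>\<alpha>. dmonomial j h \<alpha> * c \<alpha>)) UNIV"
proof -
  let ?s = "\<lambda>\<beta> :: 'n \<Rightarrow> nat. \<beta>(j := Suc (\<beta> j))"
  let ?F = "\<lambda>\<alpha>. dmonomial j h \<alpha> * c \<alpha>"
  have inj: "inj ?s"
  proof (rule injI)
    fix \<beta> \<gamma> assume "?s \<beta> = ?s \<gamma>"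
    then show "\<beta> = \<gamma>" by (metis fun_upd_eqD fun_upd_triv fun_upd_upd nat.inject)
  qed
  have r: "\<alpha> \<in> range ?s" if "\<alpha> j \<noteq> 0" for \<alpha>
  proof -
    have "\<alpha> = ?s (\<alpha>(j := \<alpha> j - 1))" using that by auto
    then show ?thesis by blast
  qed
  have "(?F has_sum infsum ?F UNIV) UNIV" using assms by (rule has_sum_infsum)
  then have "(?F has_sum infsum ?F UNIV) (range ?s)"
    by (subst has_sum_cong_neutral[of UNIV "range ?s" ?F ?F])
       (use r in \<open>auto simp: dmonomial_def\<close>)
  then have "(?F \<circ> ?s has_sum infsum ?F UNIV) UNIV" using has_sum_reindex[OF inj] by blast
  then show ?thesis
    by (rule has_sum_cong[THEN iffD1, rotated]) (simp add: dmonomial_upd_Suc)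
qed

lemma real_analytic_fun_derivative:
  fixes g :: "real ^ 'n::finite \<Rightarrow> real"
  assumes "real_analytic_fun g"
  shows "g differentiable at x" "real_analytic_fun (\<lambda>x. frechet_derivative g (at x) (axis j 1))"
proof -
  have key: "\<exists>r>0. \<exists>c. \<forall>h. (\<forall>i. \<bar>h $ i\<bar> < r) \<longrightarrow> g differentiable at (x + h) \<and>
        ((\<lambda>\<alpha>. monomial h \<alpha> * c \<alpha>) has_sum frechet_derivative g (at (x + h)) (axis j 1)) UNIV" for x :: "real ^ 'n" and j
  proof -
    obtain r c where r: "r > 0"
      and c: "\<And>h. (\<forall>i. \<bar>h $ i\<bar> < r) \<Longrightarrow> ((\<lambda>\<alpha>. monomial h \<alpha> * c \<alpha>) has_sum g (x + h)) UNIV"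
      using assms unfolding real_analytic_fun_def by meson
    define D where "D j h = (\<Sum>\<^sub>\<infinity>\<alpha>. dmonomial j h \<alpha> * c \<alpha>)" for j h
    have "g differentiable at (x + h) \<and>
        ((\<lambda>\<beta>. monomial h \<beta> * (real (Suc (\<beta> j)) * c (\<beta>(j := Suc (\<beta> j))))) has_sum
            frechet_derivative g (at (x + h)) (axis j 1)) UNIV" if h: "\<forall>i. \<bar>h $ i\<bar> < r" for h
    proof -
      note ps = power_series_has_derivative[of r c "\<lambda>h. g (x + h)", OF c h]
      have "((\<lambda>h. g (x + h)) has_derivative (\<lambda>v. \<Sum>j\<in>UNIV. v $ j * D j h)) (at h)"
        using ps(2) unfolding D_def .
      then have "((\<lambda>y. g (x + (y - x))) has_derivative (\<lambda>v. \<Sum>j\<in>UNIV. v $ j * D j h)) (at (x + h))"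
        by (intro has_derivative_compose[of "\<lambda>y. y - x" "\<lambda>v. v", where g = "\<lambda>h. g (x + h)"])
           (auto intro!: derivative_eq_intros)
      then have d: "(g has_derivative (\<lambda>v. \<Sum>j\<in>UNIV. v $ j * D j h)) (at (x + h))" by simp
      then have "frechet_derivative g (at (x + h)) (axis j 1) = (\<Sum>i\<in>UNIV. (axis j 1 :: real^'n) $ i * D i h)"
        by (simp flip: frechet_derivative_at[OF d])
      also have "\<dots> = (\<Sum>i\<in>UNIV. if i = j then D i h else 0)"
        by (rule sum.cong) (auto simp: axis_def)
      also have "\<dots> = D j h" by simp
      finally have "frechet_derivative g (at (x + h)) (axis j 1) = D j h" .
      moreover have "g differentiable at (x + h)" using d unfolding differentiable_def by blast
      ultimately show ?thesis
        using has_sum_dmonomial_shift[OF ps(1), of j] unfolding D_def by (intro conjI) simp_all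
    qed
    then show ?thesis using r
      by (intro exI[of _ r] conjI exI[of _ "\<lambda>\<beta>. real (Suc (\<beta> j)) * c (\<beta>(j := Suc (\<beta> j)))"] allI impI)
        blast+
  qed
  show "g differentiable at x" 
  proof -
    obtain r where "r > 0" "\<And>h. (\<forall>i. \<bar>h $ i\<bar> < r) \<Longrightarrow> g differentiable at (x + h)"
      using key[of x undefined] by blast
    from this(2)[of 0] this(1) show ?thesis by simp
  qed
  show "real_analytic_fun (\<lambda>x. frechet_derivative g (at x) (axis j 1))"
    using key[of _ j] unfolding real_analytic_fun_def by meson
qed

section \<open>Smooth fields and brackets\<close>

text \<open>Formulated with scalar partial derivatives, so that the recursion stays within
  real-valued functions. For a smooth function, continuity of the partials comes from
  differentiability one level up.\<close>

primrec diff_upto :: "nat \<Rightarrow> (real ^ 'n::finite \<Rightarrow> real) \<Rightarrow> bool" where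
  "diff_upto 0 g = True"
| "diff_upto (Suc k) g = ((\<forall>x. g differentiable at x) \<and>
     (\<forall>j. diff_upto k (\<lambda>x. frechet_derivative g (at x) (axis j 1))))"

definition smooth_fun :: "(real ^ 'n::finite \<Rightarrow> real) \<Rightarrow> bool" where
  "smooth_fun g \<longleftrightarrow> (\<forall>k. diff_upto k g)"

lemma diff_upto_Suc_imp: "diff_upto (Suc k) g \<Longrightarrow> diff_upto k g"
  by (induction k arbitrary: g) auto

lemma diff_upto_const: "diff_upto k (\<lambda>x. c)"
proof (induction k arbitrary: c)
  case (Suc k)
  have "frechet_derivative (\<lambda>x. c) (at x) = (\<lambda>_. 0)" for x :: "real ^ 'n"
    by (metis frechet_derivative_at has_derivative_const)
  then show ?case using Suc by simp
qed simp

lemma frechet_derivative_add: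
  assumes "g differentiable at x" "h differentiable at x"
  shows "frechet_derivative (\<lambda>x. g x + h x) (at x) = (\<lambda>v. frechet_derivative g (at x) v + frechet_derivative h (at x) v)"
  by (rule frechet_derivative_at[symmetric])
     (intro has_derivative_add assms[unfolded frechet_derivative_works])

lemma diff_upto_add:
  assumes "diff_upto k g" "diff_upto k h"
  shows "diff_upto k (\<lambda>x. g x + h x)"
  using assms
proof (induction k arbitrary: g h)
  case (Suc k)
  then show ?case by (simp add: frechet_derivative_add)
qed simp

lemma diff_upto_mult:
  fixes g h :: "real ^ 'n::finite \<Rightarrow> real"
  assumes "diff_upto k g" "diff_upto k h"
  shows "diff_upto k (\<lambda>x. g x * h x)"
  using assms
proof (induction k arbitrary: g h)
  case (Suc k)
  have "frechet_derivative (\<lambda>x. g x * h x) (at x) = (\<lambda>v. g x * frechet_derivative h (at x) v + frechet_derivative g (at x) v * h x)" for x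
    by (rule frechet_derivative_at[symmetric])
       (intro has_derivative_mult, use Suc.prems in \<open>auto simp: frechet_derivative_works\<close>)
  moreover have "diff_upto k g" "diff_upto k h" using Suc.prems diff_upto_Suc_imp by blast+
  ultimately show ?case using Suc by (simp add: diff_upto_add)
qed simp

lemma smooth_fun_real_analytic:
  assumes "real_analytic_fun g"
  shows "smooth_fun g"
  unfolding smooth_fun_def
proof
  fix k show "diff_upto k g" using assms
    by (induction k arbitrary: g) (simp_all add: real_analytic_fun_derivative)
qed

lemma smooth_fun_const: "smooth_fun (\<lambda>x. c)"
  by (simp add: smooth_fun_def diff_upto_const)

lemma smooth_fun_add: "smooth_fun g \<Longrightarrow> smooth_fun h \<Longrightarrow> smooth_fun (\<lambda>x. g x + h x)"
  by (simp add: smooth_fun_def diff_upto_add)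

lemma smooth_fun_mult: "smooth_fun g \<Longrightarrow> smooth_fun h \<Longrightarrow> smooth_fun (\<lambda>x. g x * h x)"
  by (simp add: smooth_fun_def diff_upto_mult)

lemma smooth_fun_diff:
  assumes "smooth_fun g" "smooth_fun h" shows "smooth_fun (\<lambda>x. g x - h x)"
  using smooth_fun_add[OF assms(1) smooth_fun_mult[OF smooth_fun_const[of "-1"] assms(2)]] by simp

lemma smooth_fun_sum: "finite A \<Longrightarrow> (\<And>i. i \<in> A \<Longrightarrow> smooth_fun (g i)) \<Longrightarrow> smooth_fun (\<lambda>x. \<Sum>i\<in>A. g i x)"
  by (induction A rule: finite_induct) (auto simp: smooth_fun_const smooth_fun_add)

lemma smooth_fun_differentiable: "smooth_fun g \<Longrightarrow> g differentiable at x"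
  by (metis smooth_fun_def diff_upto.simps(2))

lemma smooth_fun_partial:
  "smooth_fun g \<Longrightarrow> smooth_fun (\<lambda>x. frechet_derivative g (at x) (axis j 1))"
  by (metis smooth_fun_def diff_upto.simps(2))

lemma smooth_fun_continuous: "smooth_fun g \<Longrightarrow> continuous_on S g"
  by (meson continuous_at_imp_continuous_on differentiable_imp_continuous_within smooth_fun_differentiable)

lemma vec_eq_sum_axis: "v = (\<Sum>j\<in>UNIV. v $ j *\<^sub>R axis j 1)" for v :: "real ^ 'n"
  by (simp add: vec_eq_iff axis_def if_distrib [of "\<lambda>x. _ * x"] cong: if_cong)

lemma linear_sum_axis:
  fixes L :: "real ^ 'n \<Rightarrow> 'b::real_normed_vector"
  assumes "linear L"
  shows "L v = (\<Sum>j\<in>UNIV. v $ j *\<^sub>R L (axis j 1))"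
  by (subst vec_eq_sum_axis[of v]) (simp add: linear_sum[OF assms] linear_scale[OF assms])

text \<open>On the compact ball the continuous partials are bounded; the mean value inequality on
  this convex set makes the sum of their bounds a Lipschitz constant.\<close>

lemma smooth_fun_lipschitz:
  fixes g :: "real ^ 'n::finite \<Rightarrow> real"
  assumes "smooth_fun g"
  shows "\<exists>L\<ge>0. L-lipschitz_on (cball x R) g"
proof -
  let ?d = "\<lambda>j y. frechet_derivative g (at y) (axis j 1)"
  have "\<exists>B. \<forall>y\<in>cball x R. \<bar>?d j y\<bar> \<le> B" for j
  proof -
    have "compact (?d j ` cball x R)"
      by (intro compact_continuous_image smooth_fun_continuous smooth_fun_partial assms compact_cball)
    from compact_imp_bounded[OF this] show ?thesis by (auto simp: bounded_iff)
  qed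
  then obtain B where B: "\<And>j y. y \<in> cball x R \<Longrightarrow> \<bar>?d j y\<bar> \<le> B j" by metis
  define L where "L = (\<Sum>j\<in>UNIV. \<bar>B j\<bar>)"
  have D: "(g has_derivative frechet_derivative g (at y)) (at y)" for y
    using smooth_fun_differentiable[OF assms] frechet_derivative_works by blast
  have "norm (g a - g b) \<le> L * norm (a - b)" if "a \<in> cball x R" "b \<in> cball x R" for a b
  proof (rule differentiable_bound[OF convex_cball _ _ that])
    fix y assume y: "y \<in> cball x R"
    show "(g has_derivative frechet_derivative g (at y)) (at y within cball x R)"
      using D has_derivative_at_withinI by blast
    show "onorm (frechet_derivative g (at y)) \<le> L"
    proof (rule onorm_le)
      fix v
      have "frechet_derivative g (at y) v = (\<Sum>j\<in>UNIV. v $ j *\<^sub>R ?d j y)"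
        by (rule linear_sum_axis) (use D has_derivative_linear in blast)
      also have "norm \<dots> \<le> (\<Sum>j\<in>UNIV. \<bar>B j\<bar> * norm v)"
        unfolding real_norm_def
      proof (intro order_trans[OF sum_abs] sum_mono)
        fix j
        have "\<bar>?d j y\<bar> \<le> \<bar>B j\<bar>" using B[OF y, of j] by linarith
        then show "\<bar>v $ j *\<^sub>R ?d j y\<bar> \<le> \<bar>B j\<bar> * norm v"
          using component_le_norm_cart[of v j] by (simp add: abs_mult mult.commute mult_mono)
      qed
      finally show "norm (frechet_derivative g (at y) v) \<le> L * norm v"
        by (simp add: L_def sum_distrib_right)
    qed
  qed
  then have "L-lipschitz_on (cball x R) g"
    by (intro lipschitz_onI) (auto simp: dist_norm L_def sum_nonneg)
  then show ?thesis using lipschitz_on_nonneg by blast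
qed

section \<open>Smooth vector fields and the Lie algebra they generate\<close>

definition smooth_field :: "(real ^ 'n::finite \<Rightarrow> real ^ 'n) \<Rightarrow> bool" where
  "smooth_field V \<longleftrightarrow> (\<forall>i. smooth_fun (\<lambda>x. V x $ i))"

lemma smooth_field_derivative:
  assumes "smooth_field V"
  shows "(V has_derivative frechet_derivative V (at x)) (at x)"
proof -
  have "V differentiable at x"
    using assms
    by (subst differentiable_componentwise_within)
       (auto simp: Basis_vec_def inner_axis smooth_field_def smooth_fun_differentiable)
  then show ?thesis using frechet_derivative_works by blast
qed

text \<open>Writes the components of a bracket as sums of products of components and partial
  derivatives, where the closure rules for \<open>smooth_fun\<close> apply.\<close>

lemma smooth_field_derivative_component:
  assumes "smooth_field V"
  shows "frechet_derivative V (at x) v $ i = (\<Sum>j\<in>UNIV. v $ j * frechet_derivative (\<lambda>x. V x $ i) (at x) (axis j 1))"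
proof -
  have "((\<lambda>x. V x $ i) has_derivative (\<lambda>v. frechet_derivative V (at x) v $ i)) (at x)"
    by (rule bounded_linear.has_derivative[OF bounded_linear_vec_nth smooth_field_derivative[OF assms]])
  then have "(\<lambda>v. frechet_derivative V (at x) v $ i) = frechet_derivative (\<lambda>x. V x $ i) (at x)"
    and "linear (\<lambda>v. frechet_derivative V (at x) v $ i)"
    by (rule frechet_derivative_at, rule has_derivative_linear)
  then show ?thesis using linear_sum_axis[of "\<lambda>v. frechet_derivative V (at x) v $ i" v]
    by (simp add: fun_eq_iff)
qed

lemma smooth_field_bracket:
  assumes "smooth_field V" "smooth_field W"
  shows "smooth_field (lie_bracket V W)"
  using assms unfolding smooth_field_def lie_bracket_def vector_minus_component
    smooth_field_derivative_component[OF assms(1)] smooth_field_derivative_component[OF assms(2)]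
  by (intro allI smooth_fun_diff smooth_fun_sum smooth_fun_mult smooth_fun_partial) auto

lemma smooth_field_lie_algebra:
  assumes "V \<in> lie_algebra_generated F" "\<And>V. V \<in> F \<Longrightarrow> smooth_field V"
  shows "smooth_field V"
  using assms
  by induction
     (auto simp: smooth_field_bracket, auto simp: smooth_field_def smooth_fun_const smooth_fun_add smooth_fun_mult)

text \<open>If \<open>g\<close> and \<open>h\<close> vanish at \<open>x\<close>, both terms of the
  bracket are linear maps applied to 0. Hence Hoermander's condition forces some generator to be
  nonzero at each point.\<close>

lemma lie_algebra_vanishing:
  assumes "V \<in> lie_algebra_generated F" "\<And>V. V \<in> F \<Longrightarrow> smooth_field V" "\<And>V. V \<in> F \<Longrightarrow> V x = 0"
  shows "V x = 0"
  using assms(1)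
proof induction
  case (bracket g h)
  have "linear (frechet_derivative g (at x))" "linear (frechet_derivative h (at x))"
    using smooth_field_derivative smooth_field_lie_algebra assms(2) bracket(1,2) has_derivative_linear by blast+
  then show ?case using bracket by (simp add: lie_bracket_def linear_0)
qed (auto simp: assms)

lemma has_vector_derivative_field_along_curve:
  assumes "smooth_field V" "(\<phi> has_vector_derivative T) (at w)"
  shows "((\<lambda>w. V (\<phi> w)) has_vector_derivative frechet_derivative V (at (\<phi> w)) T) (at w)"
  using has_derivative_compose[OF assms(2)[unfolded has_vector_derivative_def] smooth_field_derivative[OF assms(1)]]
    has_derivative_linear[OF smooth_field_derivative[OF assms(1)]]
  by (simp add: has_vector_derivative_def linear_scale)

text \<open>
  If the fields are parallel to the velocity \<open>T\<close> of a curve, then along the curve \<open>g = c T\<close> and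
  \<open>h = d T\<close> give \<open>[g, h] = c (d T)' - d (c T)' = (c d' - d c') T\<close>.
\<close>

lemma lie_algebra_parallel_along_curve:
  fixes \<phi> :: "real \<Rightarrow> real ^ 'n::finite"
  assumes V: "V \<in> lie_algebra_generated F" and F: "\<And>V. V \<in> F \<Longrightarrow> smooth_field V"
    and I: "open I"
    and \<phi>: "\<And>w. w \<in> I \<Longrightarrow> (\<phi> has_vector_derivative T w) (at w)"
    and T: "\<And>w. w \<in> I \<Longrightarrow> (T has_vector_derivative T' w) (at w)"
    and k: "\<And>w. w \<in> I \<Longrightarrow> T w $ k = 1"
    and par: "\<And>V w. V \<in> F \<Longrightarrow> w \<in> I \<Longrightarrow> V (\<phi> w) = V (\<phi> w) $ k *\<^sub>R T w"
  shows "\<forall>w\<in>I. V (\<phi> w) = V (\<phi> w) $ k *\<^sub>R T w"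
  using V
proof induction
  case (bracket g h)
  show ?case
  proof
    fix w assume w: "w \<in> I"
    have *: "\<exists>b. frechet_derivative u (at (\<phi> w)) (T w) = b *\<^sub>R T w + u (\<phi> w) $ k *\<^sub>R T' w"
      if u: "smooth_field u" and p: "\<forall>w\<in>I. u (\<phi> w) = u (\<phi> w) $ k *\<^sub>R T w" for u
    proof -
      let ?d = "frechet_derivative u (at (\<phi> w)) (T w)"
      have 1: "((\<lambda>w. u (\<phi> w)) has_vector_derivative ?d) (at w)"
        using has_vector_derivative_field_along_curve[OF u \<phi>[OF w]] .
      then have "((\<lambda>w. u (\<phi> w) $ k) has_vector_derivative ?d $ k) (at w)"
        by (rule bounded_linear.has_vector_derivative[OF bounded_linear_vec_nth])
      then have "((\<lambda>w. u (\<phi> w) $ k *\<^sub>R T w) has_vector_derivative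
          (u (\<phi> w) $ k *\<^sub>R T' w + ?d $ k *\<^sub>R T w)) (at w)"
        using has_vector_derivative_scaleR[OF _ T[OF w], of "\<lambda>w. u (\<phi> w) $ k" "?d $ k"]
        by (simp add: has_real_derivative_iff_has_vector_derivative)
      then have "((\<lambda>w. u (\<phi> w)) has_vector_derivative (u (\<phi> w) $ k *\<^sub>R T' w + ?d $ k *\<^sub>R T w)) (at w)"
        by (rule has_vector_derivative_transform_within_open[OF _ I w]) (use p in simp)
      \<comment> \<open>The derivative along the curve was computed by the chain rule and, on the
        open set \<open>I\<close>, from the parallel representation by the product rule; uniqueness
        equates the two.\<close>
      from vector_derivative_unique_at[OF 1 this] show ?thesis by (metis add.commute)
    qed
    have sm: "smooth_field g" "smooth_field h" using smooth_field_lie_algebra F bracket(1,2) by blast+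
    obtain b where b: "frechet_derivative g (at (\<phi> w)) (T w) = b *\<^sub>R T w + g (\<phi> w) $ k *\<^sub>R T' w"
      using *[OF sm(1) bracket(3)] by blast
    obtain d where d: "frechet_derivative h (at (\<phi> w)) (T w) = d *\<^sub>R T w + h (\<phi> w) $ k *\<^sub>R T' w"
      using *[OF sm(2) bracket(4)] by blast
    have lin: "linear (frechet_derivative g (at (\<phi> w)))" "linear (frechet_derivative h (at (\<phi> w)))"
      using has_derivative_linear smooth_field_derivative sm by blast+
    have "lie_bracket g h (\<phi> w) = g (\<phi> w) $ k *\<^sub>R frechet_derivative h (at (\<phi> w)) (T w)
        - h (\<phi> w) $ k *\<^sub>R frechet_derivative g (at (\<phi> w)) (T w)"
    proof -
      have "g (\<phi> w) = g (\<phi> w) $ k *\<^sub>R T w" "h (\<phi> w) = h (\<phi> w) $ k *\<^sub>R T w"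
        using bracket(3,4) w by blast+
      then show ?thesis using linear_scale[OF lin(1)] linear_scale[OF lin(2)]
        unfolding lie_bracket_def by metis
    qed
    also have "\<dots> = (g (\<phi> w) $ k * d - h (\<phi> w) $ k * b) *\<^sub>R T w"
      unfolding b d by (simp add: algebra_simps)
    finally show "lie_bracket g h (\<phi> w) = lie_bracket g h (\<phi> w) $ k *\<^sub>R T w"
      using k[OF w] by simp
  qed
next
  case (add g h)
  show ?case
  proof
    fix w assume "w \<in> I"
    then have "g (\<phi> w) = g (\<phi> w) $ k *\<^sub>R T w" "h (\<phi> w) = h (\<phi> w) $ k *\<^sub>R T w" using add by blast+
    then show "g (\<phi> w) + h (\<phi> w) = (g (\<phi> w) + h (\<phi> w)) $ k *\<^sub>R T w"
      unfolding vector_add_component scaleR_add_left by simp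
  qed
next
  case (scale g a)
  show ?case
  proof
    fix w assume "w \<in> I"
    then have "g (\<phi> w) = g (\<phi> w) $ k *\<^sub>R T w" using scale by blast
    then show "a *\<^sub>R g (\<phi> w) = (a *\<^sub>R g (\<phi> w)) $ k *\<^sub>R T w"
      by (metis scaleR_scaleR vector_scaleR_component real_scaleR_def)
  qed
next
  case (gen g)
  then show ?case using par by blast
qed simp

lemma hoermander_obtains:
  assumes "hoermander f"
  obtains g where "g \<in> lie_algebra_generated (range f)" "g x = v"
proof -
  have "v \<in> {g x | g. g \<in> lie_algebra_generated (range f)}"
    using assms by (simp add: hoermander_def)
  then show ?thesis using that by blast
qed

lemma hoermander_nonvanishing:
  fixes f :: "'m \<Rightarrow> real ^ 'n::finite \<Rightarrow> real ^ 'n"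
  assumes "hoermander f" "\<And>i. smooth_field (f i)"
  shows "\<exists>i k. f i x $ k \<noteq> 0"
proof (rule ccontr)
  assume "\<not> ?thesis"
  then have z: "f i x = 0" for i by (simp add: vec_eq_iff)
  have "g x = 0" if "g \<in> lie_algebra_generated (range f)" for g
    using lie_algebra_vanishing[OF that, of x] assms(2) z by auto
  moreover obtain g where "g \<in> lie_algebra_generated (range f)" "g x = 1"
    using hoermander_obtains[OF assms(1)] .
  ultimately show False by (metis zero_neq_one)
qed

text \<open>Otherwise the whole Lie algebra is parallel to \<open>T\<close> along the curve. An
  element with value \<open>axis l 1\<close> has \<open>k\<close> component 0, so it would be the
  zero multiple of \<open>T\<close>.\<close>

lemma hoermander_not_parallel_along_curve:
  fixes f :: "'m \<Rightarrow> real ^ 'n::finite \<Rightarrow> real ^ 'n" and \<phi> :: "real \<Rightarrow> real ^ 'n"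
  assumes h: "hoermander f" and f: "\<And>i. smooth_field (f i)"
    and I: "open I" "I \<noteq> {}" and kl: "k \<noteq> l"
    and \<phi>: "\<And>w. w \<in> I \<Longrightarrow> (\<phi> has_vector_derivative T w) (at w)"
    and T: "\<And>w. w \<in> I \<Longrightarrow> (T has_vector_derivative T' w) (at w)"
    and k: "\<And>w. w \<in> I \<Longrightarrow> T w $ k = 1"
  shows "\<exists>w\<in>I. \<exists>i. f i (\<phi> w) \<noteq> f i (\<phi> w) $ k *\<^sub>R T w"
proof (rule ccontr)
  assume *: "\<not> ?thesis"
  obtain w where w: "w \<in> I" using I by blast
  obtain g where g: "g \<in> lie_algebra_generated (range f)" "g (\<phi> w) = axis l 1"
    using hoermander_obtains[OF h] .
  have "\<forall>w\<in>I. g (\<phi> w) = g (\<phi> w) $ k *\<^sub>R T w"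
    by (rule lie_algebra_parallel_along_curve[OF g(1) _ I(1) \<phi> T k]) (use * f in auto)
  then have "axis l 1 = (axis l 1 :: real ^ 'n) $ k *\<^sub>R T w" using w g by metis
  then have "axis l (1::real) = (0 :: real ^ 'n)" using kl by (simp add: axis_def)
  then show False by (simp add: axis_eq_0_iff)
qed

section \<open>Absolutely continuous curves\<close>

text \<open>The Riemann sums of the indicator of \<open>N\<close> are exactly these total lengths,
  and the indicator has integral 0.\<close>

lemma tagged_division_tags_in_negligible:
  fixes a b :: real
  assumes "negligible N" "\<delta> > 0"
  obtains \<gamma> where "gauge \<gamma>"
    "\<And>p. p tagged_division_of {a..b} \<Longrightarrow> \<gamma> fine p \<Longrightarrow> (\<Sum>(x, K)\<in>{xK \<in> p. fst xK \<in> N}. measure lborel K) < \<delta>"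
proof -
  have "((indicator N :: real \<Rightarrow> real) has_integral 0) (cbox a b)"
    using assms(1) unfolding negligible_def by blast
  from this[unfolded has_integral, rule_format, OF assms(2)]
  obtain \<gamma> where \<gamma>: "gauge \<gamma>"
    "\<forall>p. p tagged_division_of cbox a b \<and> \<gamma> fine p \<longrightarrow>
      norm ((\<Sum>(x, K)\<in>p. measure lborel K *\<^sub>R (indicator N x :: real)) - 0) < \<delta>"
    by blast
  have "(\<Sum>(x, K)\<in>{xK \<in> p. fst xK \<in> N}. measure lborel K) < \<delta>"
    if p: "p tagged_division_of {a..b}" and f: "\<gamma> fine p" for p
  proof -
    have "finite p" using p by (rule tagged_division_of_finite)
    then have "(\<Sum>(x, K)\<in>{xK \<in> p. fst xK \<in> N}. measure lborel K) = (\<Sum>(x, K)\<in>p. measure lborel K *\<^sub>R (indicator N x :: real))"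
      by (intro sum.mono_neutral_cong_left) (auto simp: indicator_def split: if_splits)
    also have "\<dots> < \<delta>" using \<gamma>(2)[rule_format, of p] p f by simp
    finally show ?thesis .
  qed
  with \<gamma>(1) show ?thesis using that by blast
qed

text \<open>The fundamental theorem in gauge form. Intervals tagged outside \<open>N\<close> are
  controlled by the derivative at the tag; those tagged in \<open>N\<close> have small total length,
  so absolute continuity makes their total increment small.\<close>

theorem abs_continuous_has_integral:
  fixes y :: "real \<Rightarrow> 'a::banach"
  assumes ab: "a \<le> b" and ac: "abs_continuous_on a b y" and N: "negligible N"
    and deriv: "\<And>t. t \<in> {a..b} - N \<Longrightarrow> (y has_vector_derivative g t) (at t within {a..b})"
  shows "(g has_integral (y b - y a)) {a..b}"
proof -
  define g' where "g' t = (if t \<in> N then 0 else g t)" for t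
  \<comment> \<open>Setting the integrand to 0 on \<open>N\<close> removes the tags in
    \<open>N\<close> from the Riemann sum, leaving only the increments of \<open>y\<close>
    there.\<close>
  have "(g' has_integral (y b - y a)) (cbox a b)"
    unfolding has_integral
  proof (intro allI impI)
    fix e :: real assume e: "e > 0"
    obtain \<delta> where \<delta>: "\<delta> > 0"
      "\<And>D S. D division_of S \<Longrightarrow> S \<subseteq> {a..b} \<Longrightarrow> (\<Sum>k\<in>D. Sup k - Inf k) < \<delta>
        \<Longrightarrow> (\<Sum>k\<in>D. norm (y (Sup k) - y (Inf k))) < e / 2"
      using ac e unfolding abs_continuous_on_def by (meson half_gt_zero)
    obtain \<gamma> where \<gamma>: "gauge \<gamma>"
      "\<And>p. p tagged_division_of {a..b} \<Longrightarrow> \<gamma> fine p \<Longrightarrow> (\<Sum>(x, K)\<in>{xK \<in> p. fst xK \<in> N}. measure lborel K) < \<delta>"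
      using tagged_division_tags_in_negligible[OF N \<delta>(1)] by blast
    \<comment> \<open>The summand 1 keeps the denominator positive when
      \<open>a = b\<close>.\<close>
    define c where "c = e / (2 * (b - a + 1))"
    have c: "c > 0" "c * (b - a) \<le> e / 2" using e ab by (auto simp: c_def field_simps)
    have "\<forall>x. \<exists>d>0. x \<in> {a..b} - N \<longrightarrow>
         (\<forall>t\<in>{a..b}. norm (t-x) < d \<longrightarrow> norm (y t - y x - (t-x) *\<^sub>R g x) \<le> c * norm (t-x))"
      using deriv[unfolded has_vector_derivative_def has_derivative_within_alt] c(1) by (metis zero_less_one)
    then obtain d where d: "\<And>x. 0 < d x"
      "\<And>x t. \<lbrakk>x \<in> {a..b} - N; t \<in> {a..b}; norm (t-x) < d x\<rbrakk>
          \<Longrightarrow> norm (y t - y x - (t-x) *\<^sub>R g x) \<le> c * norm (t-x)"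
      by metis
    show "\<exists>\<gamma>. gauge \<gamma> \<and> (\<forall>p. p tagged_division_of cbox a b \<and> \<gamma> fine p \<longrightarrow>
        norm ((\<Sum>(x, K)\<in>p. measure lborel K *\<^sub>R g' x) - (y b - y a)) < e)"
    proof (intro exI conjI allI impI; (elim conjE)?)
      show "gauge (\<lambda>x. \<gamma> x \<inter> ball x (d x))"
        using \<gamma>(1) d(1) by (intro gauge_Int gauge_ball_dependent) auto
      fix p assume p: "p tagged_division_of cbox a b" and fine: "(\<lambda>x. \<gamma> x \<inter> ball x (d x)) fine p"
      define p1 where "p1 = {xK \<in> p. fst xK \<notin> N}"
      define p2 where "p2 = {xK \<in> p. fst xK \<in> N}"
      have fin: "finite p" using p by (rule tagged_division_of_finite)
      have split: "sum h p = sum h p1 + sum h p2" for h :: "real \<times> real set \<Rightarrow> 'b::comm_monoid_add"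
        unfolding p1_def p2_def using fin
        by (subst sum.union_disjoint[symmetric]) (auto intro!: sum.cong)
      have K: "\<exists>u v. K = {u..v} \<and> u \<le> x \<and> x \<le> v \<and> a \<le> u \<and> v \<le> b" if xK: "(x, K) \<in> p" for x K
      proof -
        obtain u v where uv: "K = cbox u v" using tagged_division_ofD(4)[OF p xK] by blast
        have "x \<in> K" "K \<subseteq> cbox a b" using tagged_division_ofD(2,3)[OF p xK] by auto
        then show ?thesis using uv by (intro exI[of _ u] exI[of _ v]) auto
      qed
      let ?r = "\<lambda>(x, K). measure lborel K *\<^sub>R g' x - (y (Sup K) - y (Inf K))"
      have "norm (sum ?r p1) \<le> (\<Sum>(x, K)\<in>p1. c * measure lborel K)"
      proof (rule sum_norm_le, safe)
        fix x K assume "(x, K) \<in> p1"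
        then have xK: "(x, K) \<in> p" "x \<notin> N" by (auto simp: p1_def)
        obtain u v where uv: "K = {u..v}" "u \<le> x" "x \<le> v" "a \<le> u" "v \<le> b" using K[OF xK(1)] by blast
        have "K \<subseteq> ball x (d x)" using fine xK(1) by (auto simp: fine_def)
        moreover have "u \<in> K" "v \<in> K" using uv by auto
        ultimately have "u \<in> ball x (d x)" "v \<in> ball x (d x)" by blast+
        then have uvd: "norm (u - x) < d x" "norm (v - x) < d x" by (auto simp: dist_real_def)
        \<comment> \<open>The straddle estimate: the pieces from the tag to either end are
          linearised separately, and their lengths add up to that of the interval.\<close>
        have "norm ((v - u) *\<^sub>R g x - (y v - y u)) = norm (y u - y x - (u - x) *\<^sub>R g x - (y v - y x - (v - x) *\<^sub>R g x))"
          by (auto simp: algebra_simps)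
        also have "\<dots> \<le> norm (y u - y x - (u - x) *\<^sub>R g x) + norm (y v - y x - (v - x) *\<^sub>R g x)"
          by (rule norm_triangle_ineq4)
        also have "\<dots> \<le> c * norm (u - x) + c * norm (v - x)"
          using uv xK(2) uvd by (intro add_mono d(2)) auto
        also have "\<dots> = c * (v - u)" using uv by (simp add: algebra_simps)
        finally show "norm (measure lborel K *\<^sub>R g' x - (y (Sup K) - y (Inf K))) \<le> c * measure lborel K"
          using uv xK(2) by (simp add: g'_def)
      qed
      also have "\<dots> \<le> (\<Sum>(x, K)\<in>p. c * measure lborel K)"
        using fin c(1) unfolding p1_def by (intro sum_mono2) (auto intro!: mult_nonneg_nonneg)
      also have "\<dots> = c * (b - a)"
        using additive_content_tagged_division[OF p] ab by (simp add: split_def sum_distrib_left[symmetric])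
      also have "\<dots> \<le> e / 2" by (rule c(2))
      finally have 1: "norm (sum ?r p1) \<le> e / 2" .
      have tp2: "p2 tagged_division_of \<Union>(snd ` p2)"
        using tagged_partial_division_subset[of p _ p2] p
        by (intro tagged_partial_division_of_Union_self) (auto simp: p2_def tagged_division_of_def)
      \<comment> \<open>Absolute continuity speaks of a set of intervals, a tagged division of
        tagged ones. Only an interval with empty interior can carry several tags, and there
        \<open>h\<close> vanishes.\<close>
      have over: "(\<Sum>(x, K)\<in>p2. h K) = sum h (snd ` p2)"
        if "\<And>u v. box u v = {} \<Longrightarrow> u \<le> v \<Longrightarrow> h (cbox u v) = 0" for h :: "real set \<Rightarrow> real"
      proof -
        let ?h = "\<lambda>K. if K = {} then 0 else h K"
        have ne: "K \<noteq> {}" if "K \<in> snd ` p2" for K using that K by (fastforce simp: p2_def)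
        have "(\<Sum>(x, K)\<in>p2. h K) = (\<Sum>(x, K)\<in>p2. ?h K)"
          by (rule sum.cong) (use ne in \<open>force simp: image_iff\<close>)+
        also have "\<dots> = sum ?h (snd ` p2)"
          by (rule sum.over_tagged_division_lemma[OF tp2]) (use that in auto)
        also have "\<dots> = sum h (snd ` p2)" using ne by (intro sum.cong) auto
        finally show ?thesis .
      qed
      have "(\<Sum>K\<in>snd ` p2. Sup K - Inf K) = (\<Sum>(x, K)\<in>p2. Sup K - Inf K)"
        by (rule over[symmetric]) auto
      also have "\<dots> = (\<Sum>(x, K)\<in>p2. measure lborel K)"
        by (rule sum.cong) (use K in \<open>fastforce simp: p2_def\<close>)+
      also have "\<dots> < \<delta>"
        unfolding p2_def using p fine by (intro \<gamma>(2)) (auto simp: fine_def)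
      finally have len: "(\<Sum>K\<in>snd ` p2. Sup K - Inf K) < \<delta>" .
      have "norm (sum ?r p2) \<le> (\<Sum>(x, K)\<in>p2. norm (y (Sup K) - y (Inf K)))"
        by (rule sum_norm_le) (auto simp: p2_def g'_def norm_minus_commute)
      also have "\<dots> = (\<Sum>K\<in>snd ` p2. norm (y (Sup K) - y (Inf K)))"
        by (rule over) auto
      also have "\<dots> < e / 2"
        using K by (intro \<delta>(2)[OF division_of_tagged_division[OF tp2] _ len]) (fastforce simp: p2_def)
      finally have 2: "norm (sum ?r p2) < e / 2" .
      have "(\<Sum>(x, K)\<in>p. measure lborel K *\<^sub>R g' x) - (y b - y a) = sum ?r p"
        using additive_tagged_division_1[OF ab p[unfolded box_real], of y]
        by (simp add: split_def sum_subtractf)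
      also have "norm \<dots> \<le> norm (sum ?r p1) + norm (sum ?r p2)"
        unfolding split by (rule norm_triangle_ineq)
      finally show "norm ((\<Sum>(x, K)\<in>p. measure lborel K *\<^sub>R g' x) - (y b - y a)) < e" using 1 2 by linarith
    qed
  qed
  then show ?thesis
    using has_integral_spike[OF N, of "{a..b}" g g'] by (auto simp: g'_def)
qed

lemma abs_continuous_on_subset:
  "abs_continuous_on a b y \<Longrightarrow> a \<le> c \<Longrightarrow> d \<le> b \<Longrightarrow> abs_continuous_on c d y"
  unfolding abs_continuous_on_def by (meson atLeastatMost_subset_iff dual_order.trans)

lemma abs_continuous_on_imp_continuous:
  assumes "abs_continuous_on a b y"
  shows "continuous_on {a..b} y"
  unfolding continuous_on_iff
proof (intro ballI allI impI)
  fix s e :: real assume s: "s \<in> {a..b}" and e: "e > 0"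
  obtain \<delta> where \<delta>: "\<delta> > 0"
    "\<And>D S. D division_of S \<Longrightarrow> S \<subseteq> {a..b} \<Longrightarrow> (\<Sum>k\<in>D. Sup k - Inf k) < \<delta>
        \<Longrightarrow> (\<Sum>k\<in>D. norm (y (Sup k) - y (Inf k))) < e"
    using assms e unfolding abs_continuous_on_def by meson
  have *: "norm (y v - y u) < e" if "u \<le> v" "u \<in> {a..b}" "v \<in> {a..b}" "v - u < \<delta>" for u v
    using \<delta>(2)[of "{{u..v}}" "{u..v}"] that
      division_of_self[of u v] by auto
  have "dist (y t) (y s) < e" if "t \<in> {a..b}" "dist t s < \<delta>" for t
    using *[of s t] *[of t s] that s by (cases "s \<le> t") (auto simp: dist_norm dist_real_def norm_minus_commute)
  then show "\<exists>d>0. \<forall>t\<in>{a..b}. dist t s < d \<longrightarrow> dist (y t) (y s) < e" using \<delta>(1) by blast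
qed

lemma lipschitz_imp_abs_continuous_on:
  assumes "B-lipschitz_on {a..b} y"
  shows "abs_continuous_on a b y"
  unfolding abs_continuous_on_def
proof (intro allI impI)
  fix e :: real assume e: "e > 0"
  have B: "B \<ge> 0" using assms by (rule lipschitz_on_nonneg)
  have "(\<Sum>k\<in>D. norm (y (Sup k) - y (Inf k))) < e"
    if D: "D division_of S" "S \<subseteq> {a..b}" "(\<Sum>k\<in>D. Sup k - Inf k) < e / (B + 1)" for D S
  proof -
    have "norm (y (Sup k) - y (Inf k)) \<le> B * (Sup k - Inf k)" if k: "k \<in> D" for k
    proof -
      obtain u v where "k = cbox u v" using division_ofD(4)[OF D(1) k] by blast
      moreover have "k \<noteq> {}" "k \<subseteq> {a..b}" using division_ofD(2,3)[OF D(1) k] D(2) by auto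
      ultimately have "u \<le> v" "k = {u..v}" "u \<in> {a..b}" "v \<in> {a..b}" by auto
      then show ?thesis using lipschitz_onD[OF assms, of v u] by (simp add: dist_norm)
    qed
    then have "(\<Sum>k\<in>D. norm (y (Sup k) - y (Inf k))) \<le> (\<Sum>k\<in>D. B * (Sup k - Inf k))"
      by (rule sum_mono)
    also have "\<dots> = B * (\<Sum>k\<in>D. Sup k - Inf k)" by (simp add: sum_distrib_left)
    also have "\<dots> \<le> B * (e / (B + 1))" using D(3) B by (intro mult_left_mono) auto
    also have "\<dots> < e" using e B by (simp add: field_simps)
    finally show ?thesis .
  qed
  then show "\<exists>\<delta>>0. \<forall>D S. D division_of S \<and> S \<subseteq> {a..b} \<and> (\<Sum>k\<in>D. Sup k - Inf k) < \<delta>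
        \<longrightarrow> (\<Sum>k\<in>D. norm (y (Sup k) - y (Inf k))) < e"
    using e B by (intro exI[of _ "e / (B + 1)"]) auto
qed

section \<open>Concatenation and reversal of trajectories\<close>

lemma onorm_scaleR_right_le:
  fixes v :: "'a::real_normed_vector"
  assumes "norm v \<le> B"
  shows "onorm (\<lambda>x::real. x *\<^sub>R v) \<le> B"
  using assms by (intro onorm_le) (auto simp: mult.commute[of B] intro!: mult_left_mono)

definition velocity :: "('m::finite \<Rightarrow> 'a::real_normed_vector \<Rightarrow> 'a) \<Rightarrow> real ^ 'm \<Rightarrow> 'a \<Rightarrow> 'a" where
  "velocity f v x = (\<Sum>i\<in>UNIV. v $ i *\<^sub>R f i x)"

lemma norm_velocity_le:
  fixes f :: "'m::finite \<Rightarrow> 'a::real_normed_vector \<Rightarrow> 'a"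
    and M :: real
  assumes "\<And>i. norm (f i x) \<le> M"
  shows "norm (velocity f v x) \<le> CARD('m) * M * norm v"
proof -
  have "norm (velocity f v x) \<le> (\<Sum>i\<in>(UNIV :: 'm set). norm v * M)"
    unfolding velocity_def
  proof (intro order_trans[OF norm_sum] sum_mono)
    fix i show "norm (v $ i *\<^sub>R f i x) \<le> norm v * M"
      using assms[of i] component_le_norm_cart[of v i]
      by (simp add: mult_mono)
  qed
  then show ?thesis by (simp add: mult_ac)
qed

lemma velocity_diff: "velocity f u x - velocity f v x = velocity f (u - v) x"
  by (simp add: velocity_def sum_subtractf[symmetric] scaleR_diff_left)

lemma velocity_minus: "velocity f (- v) x = - velocity f v x"
  by (simp add: velocity_def sum_negf)

lemma norm_velocity_diff_le:
  fixes f :: "'m::finite \<Rightarrow> 'a::real_normed_vector \<Rightarrow> 'a"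
    and M :: real
  assumes "\<And>i. norm (f i x - f i y) \<le> M"
  shows "norm (velocity f v x - velocity f v y) \<le> CARD('m) * M * norm v"
proof -
  have "velocity f v x - velocity f v y = velocity (\<lambda>i _. f i x - f i y) v x"
    by (simp add: velocity_def sum_subtractf[symmetric] scaleR_diff_right)
  then show ?thesis using norm_velocity_le[of "\<lambda>i _. f i x - f i y" x M v] assms by simp
qed

text \<open>Hides the control and the trajectory, so that trajectories compose as a relation with
  additive times; \<open>t\<close> is the exact travel time.\<close>

definition reach :: "('m::finite \<Rightarrow> 'a::real_normed_vector \<Rightarrow> 'a) \<Rightarrow> real \<Rightarrow> 'a \<Rightarrow> 'a \<Rightarrow> bool" where
  "reach f t x z \<longleftrightarrow> t \<ge> 0 \<and> (\<exists>u y. is_control u \<and> solution_on f u x t y \<and> y t = z)"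

lemma solution_on_iff_negligible:
  "solution_on f u x T y \<longleftrightarrow> y 0 = x \<and> abs_continuous_on 0 T y \<and>
     (\<exists>N. negligible N \<and>
        (\<forall>t\<in>{0..T} - N. (y has_vector_derivative velocity f (u t) (y t)) (at t within {0..T})))"
proof -
  have "(AE t in lebesgue_on {0..T}. P t) \<longleftrightarrow> (\<exists>N. negligible N \<and> (\<forall>t\<in>{0..T} - N. P t))" for P :: "real \<Rightarrow> bool"
  proof -
    have "(AE t in lebesgue_on {0..T}. P t) \<longleftrightarrow> (AE t in lebesgue. t \<in> {0..T} \<longrightarrow> P t)"
      by (rule AE_restrict_space_iff) auto
    also have "\<dots> \<longleftrightarrow> (\<exists>N. negligible N \<and> {t. \<not> (t \<in> {0..T} \<longrightarrow> P t)} \<subseteq> N)"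
      by (rule eventually_ae_filter_negligible)
    also have "\<dots> \<longleftrightarrow> (\<exists>N. negligible N \<and> (\<forall>t\<in>{0..T} - N. P t))"
      by (intro arg_cong[of _ _ Ex] ext conj_cong refl) blast
    finally show ?thesis .
  qed
  then show ?thesis unfolding solution_on_def velocity_def by simp
qed

lemma solution_on_has_integral:
  fixes f :: "'m::finite \<Rightarrow> 'a::banach \<Rightarrow> 'a"
  assumes "solution_on f u x T y" "0 \<le> s" "s \<le> t" "t \<le> T"
  shows "((\<lambda>r. velocity f (u r) (y r)) has_integral (y t - y s)) {s..t}"
proof -
  obtain N where N: "abs_continuous_on 0 T y" "negligible N"
    "\<And>t. t \<in> {0..T} - N \<Longrightarrow> (y has_vector_derivative velocity f (u t) (y t)) (at t within {0..T})"
    using assms(1) unfolding solution_on_iff_negligible by blast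
  show ?thesis
    by (rule abs_continuous_has_integral[OF assms(3) abs_continuous_on_subset[OF N(1)] N(2)])
       (use assms in \<open>auto intro!: has_vector_derivative_within_subset[OF N(3)]\<close>)
qed

lemma is_control_norm: "is_control u \<Longrightarrow> 0 \<le> t \<Longrightarrow> norm (u t) \<le> 1"
  by (auto simp: is_control_def)

text \<open>The trajectory has a compact image, on which the fields are bounded; integrating the
  velocity gives the estimate without any growth condition. Lipschitz continuity is easier than
  absolute continuity to carry through shifting and gluing.\<close>

lemma solution_on_lipschitz:
  fixes f :: "'m::finite \<Rightarrow> 'a::banach \<Rightarrow> 'a"
  assumes f: "\<And>i. continuous_on UNIV (f i)" and u: "is_control u" and y: "solution_on f u x T y"
  shows "\<exists>B. B-lipschitz_on {0..T} y"
proof -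
  have cy: "continuous_on {0..T} y"
    using y unfolding solution_on_def by (blast intro: abs_continuous_on_imp_continuous)
  have "\<exists>M. \<forall>t\<in>{0..T}. norm (f i (y t)) \<le> M" for i
  proof -
    have "compact ((\<lambda>t. f i (y t)) ` {0..T})"
      by (intro compact_continuous_image continuous_on_compose2[OF f cy]) auto
    from compact_imp_bounded[OF this] show ?thesis by (auto simp: bounded_iff)
  qed
  then obtain M where M: "\<And>i t. t \<in> {0..T} \<Longrightarrow> norm (f i (y t)) \<le> M i" by metis
  define B where "B = CARD('m) * (\<Sum>i\<in>UNIV. \<bar>M i\<bar>)"
  have B: "B \<ge> 0" by (simp add: B_def sum_nonneg)
  have v: "norm (velocity f (u t) (y t)) \<le> B" if "t \<in> {0..T}" for t
  proof -
    have "norm (f i (y t)) \<le> (\<Sum>i\<in>UNIV. \<bar>M i\<bar>)" for i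
      using M[OF that, of i] member_le_sum[of i UNIV "\<lambda>i. \<bar>M i\<bar>"] by auto
    then have "norm (velocity f (u t) (y t)) \<le> B * norm (u t)"
      unfolding B_def by (rule norm_velocity_le[of f "y t" "\<Sum>i\<in>UNIV. \<bar>M i\<bar>" "u t"])
    also have "\<dots> \<le> B * 1" using B is_control_norm[OF u] that by (intro mult_left_mono) auto
    finally show ?thesis by simp
  qed
  have *: "norm (y t - y s) \<le> B * (t - s)" if "0 \<le> s" "s \<le> t" "t \<le> T" for s t
  proof -
    have "((\<lambda>r. velocity f (u r) (y r)) has_integral (y t - y s)) (cbox s t)"
      using solution_on_has_integral[OF y that] by simp
    from has_integral_bound[OF B this] show ?thesis using v that by auto
  qed
  have "B-lipschitz_on {0..T} y"
  proof (rule lipschitz_onI[OF _ B])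
    fix s t assume "s \<in> {0..T}" "t \<in> {0..T}"
    then show "dist (y s) (y t) \<le> B * dist s t"
      using *[of s t] *[of t s] by (cases "s \<le> t") (auto simp: dist_norm norm_minus_commute)
  qed
  then show ?thesis by blast
qed

text \<open>The two end points join the null set, so two-sided derivatives at interior times
  suffice.\<close>

lemma solution_onI:
  assumes "y 0 = x" "B-lipschitz_on {0..T} y" "negligible N"
    "\<And>t. 0 < t \<Longrightarrow> t < T \<Longrightarrow> t \<notin> N \<Longrightarrow> (y has_vector_derivative velocity f (u t) (y t)) (at t)"
  shows "solution_on f u x T y"
  unfolding solution_on_iff_negligible
proof (intro conjI exI[of _ "N \<union> {0, T}"] ballI)
  show "negligible (N \<union> {0, T})" using assms(3) by (auto intro: negligible_Un)
  fix t assume t: "t \<in> {0..T} - (N \<union> {0, T})"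
  show "(y has_vector_derivative velocity f (u t) (y t)) (at t within {0..T})"
    by (rule has_vector_derivative_at_within, rule assms(4)) (use t in auto)
qed (rule assms(1), rule lipschitz_imp_abs_continuous_on[OF assms(2)])

lemma solution_onD:
  assumes "solution_on f u x T y"
  obtains N where "negligible N"
    "\<And>t. 0 < t \<Longrightarrow> t < T \<Longrightarrow> t \<notin> N \<Longrightarrow> (y has_vector_derivative velocity f (u t) (y t)) (at t)"
proof -
  obtain N where N: "negligible N"
    "\<forall>t\<in>{0..T} - N. (y has_vector_derivative velocity f (u t) (y t)) (at t within {0..T})"
    using assms unfolding solution_on_iff_negligible by blast
  have "(y has_vector_derivative velocity f (u t) (y t)) (at t)" if "0 < t" "t < T" "t \<notin> N" for t
    using N(2) that by (auto simp: at_within_Icc_at dest!: bspec[of _ _ t])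
  then show ?thesis using N(1) that by blast
qed

text \<open>Extension by 0 expresses measurability on the whole line, where shifts and case
  distinctions preserve it.\<close>

lemma is_control_iff:
  "is_control u \<longleftrightarrow> (\<lambda>t. if t \<in> {0..} then u t else 0) \<in> borel_measurable lebesgue \<and> (\<forall>t\<ge>0. norm (u t) \<le> 1)"
  unfolding is_control_def by (subst borel_measurable_if) auto

lemma measurable_shift_lebesgue: "(\<lambda>t::real. t + c) \<in> lebesgue \<rightarrow>\<^sub>M lebesgue"
  using lebesgue_affine_measurable[of "\<lambda>_. 1" c] by (simp add: add.commute)

lemma has_vector_derivative_shift_arg:
  fixes y :: "real \<Rightarrow> 'a::real_normed_vector"
  assumes "(y has_vector_derivative d) (at (t + c))"
  shows "((\<lambda>s. y (s + c)) has_vector_derivative d) (at t)"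
proof -
  have "((\<lambda>s. s + c) has_vector_derivative 1) (at t)" by (auto intro!: derivative_eq_intros)
  from vector_diff_chain_at[OF this assms] show ?thesis by (simp add: o_def)
qed

lemma lipschitz_on_shift:
  fixes y :: "real \<Rightarrow> 'a::real_normed_vector"
  assumes "B-lipschitz_on {a + c..b + c} y"
  shows "B-lipschitz_on {a..b} (\<lambda>r. y (r + c))"
proof (rule lipschitz_onI)
  fix r s assume "r \<in> {a..b}" "s \<in> {a..b}"
  then show "dist (y (r + c)) (y (s + c)) \<le> B * dist r s"
    using lipschitz_onD[OF assms, of "r + c" "s + c"] by simp
qed (rule lipschitz_on_nonneg[OF assms])

lemma negligible_shift: "negligible N \<Longrightarrow> negligible {t::real. t + c \<in> N}"
proof -
  assume "negligible N"
  moreover have "{t. t + c \<in> N} = (+) (-c) ` N"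
  proof (intro set_eqI iffI)
    fix t assume "t \<in> {t. t + c \<in> N}"
    then show "t \<in> (+) (-c) ` N" by (intro image_eqI[of _ _ "t + c"]) auto
  qed auto
  ultimately show ?thesis by (simp only: negligible_translation)
qed

lemma reach_refl: "reach f 0 x x"
proof -
  have "is_control (\<lambda>_. 0)" by (auto simp: is_control_def)
  moreover have "solution_on f (\<lambda>_. 0) x 0 (\<lambda>_. x)"
    by (rule solution_onI[of _ _ 0 _ "{}"]) (auto intro: lipschitz_onI)
  ultimately show ?thesis unfolding reach_def by auto
qed

context
  fixes f :: "'m::finite \<Rightarrow> 'a::banach \<Rightarrow> 'a"
  assumes f: "\<And>i. continuous_on UNIV (f i)"
begin

lemma reach_segment:
  assumes u: "is_control u" and y: "solution_on f u x T y" and st: "0 \<le> s" "s \<le> t" "t \<le> T"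
  shows "reach f (t - s) (y s) (y t)"
proof -
  obtain B where B: "B-lipschitz_on {0..T} y" using solution_on_lipschitz[OF f u y] by blast
  obtain N where N: "negligible N"
    "\<And>t. 0 < t \<Longrightarrow> t < T \<Longrightarrow> t \<notin> N \<Longrightarrow> (y has_vector_derivative velocity f (u t) (y t)) (at t)"
    using solution_onD[OF y] by blast
  have "is_control (\<lambda>r. u (r + s))"
    unfolding is_control_iff
  proof
    have "(\<lambda>r. if r + s \<in> {0..} then u (r + s) else 0) \<in> borel_measurable lebesgue"
      using measurable_compose[OF measurable_shift_lebesgue[of s]] u unfolding is_control_iff by blast
    then have "(\<lambda>r. if r \<in> {0..} then (if r + s \<in> {0..} then u (r + s) else 0) else 0) \<in> borel_measurable lebesgue"
      by (intro measurable_If_set) auto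
    then show "(\<lambda>r. if r \<in> {0..} then u (r + s) else 0) \<in> borel_measurable lebesgue"
      using st by (auto elim!: measurable_cong[THEN iffD1, rotated])
  qed (use u st in \<open>auto simp: is_control_iff\<close>)
  moreover have "solution_on f (\<lambda>r. u (r + s)) (y s) (t - s) (\<lambda>r. y (r + s))"
  proof (rule solution_onI[of _ _ B _ "{r. r + s \<in> N}"])
    show "B-lipschitz_on {0..t - s} (\<lambda>r. y (r + s))"
      using st by (intro lipschitz_on_shift lipschitz_on_subset[OF B]) auto
  qed (use st N in \<open>auto intro!: negligible_shift has_vector_derivative_shift_arg\<close>)
  ultimately show ?thesis unfolding reach_def using st by (auto intro!: exI[of _ "\<lambda>r. u (r + s)"] exI[of _ "\<lambda>r. y (r + s)"])
qed

lemma reach_trans: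
  assumes "reach f s x z" "reach f t z w"
  shows "reach f (s + t) x w"
proof -
  obtain u y where u: "is_control u" and y: "solution_on f u x s y" "y s = z" and s: "s \<ge> 0"
    using assms(1) unfolding reach_def by blast
  obtain u' y' where u': "is_control u'" and y': "solution_on f u' z t y'" "y' t = w" and t: "t \<ge> 0"
    using assms(2) unfolding reach_def by blast
  have y0: "y 0 = x" "y' 0 = z" using y y' by (auto simp: solution_on_def)
  obtain B where B: "B-lipschitz_on {0..s} y" using solution_on_lipschitz[OF f u y(1)] by blast
  obtain B' where B': "B'-lipschitz_on {0..t} y'" using solution_on_lipschitz[OF f u' y'(1)] by blast
  obtain N where N: "negligible N"
    "\<And>r. 0 < r \<Longrightarrow> r < s \<Longrightarrow> r \<notin> N \<Longrightarrow> (y has_vector_derivative velocity f (u r) (y r)) (at r)"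
    using solution_onD[OF y(1)] by blast
  obtain N' where N': "negligible N'"
    "\<And>r. 0 < r \<Longrightarrow> r < t \<Longrightarrow> r \<notin> N' \<Longrightarrow> (y' has_vector_derivative velocity f (u' r) (y' r)) (at r)"
    using solution_onD[OF y'(1)] by blast
  define v where "v r = (if r \<le> s then u r else u' (r + - s))" for r
  define q where "q r = (if r \<le> s then y r else y' (r + - s))" for r
  have "is_control v"
    unfolding is_control_iff
  proof
    have m: "(\<lambda>r. if r \<in> {0..} then u r else 0) \<in> borel_measurable lebesgue"
      "(\<lambda>r. if r + - s \<in> {0..} then u' (r + - s) else 0) \<in> borel_measurable lebesgue"
      using measurable_compose[OF measurable_shift_lebesgue[of "- s"]] u u' unfolding is_control_iff by blast+
    have "(\<lambda>r. if r \<in> {..s} then (if r \<in> {0..} then u r else 0) else (if r + - s \<in> {0..} then u' (r + - s) else 0)) \<in> borel_measurable lebesgue"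
      by (intro measurable_If_set m) auto
    then show "(\<lambda>r. if r \<in> {0..} then v r else 0) \<in> borel_measurable lebesgue"
      using s by (auto elim!: measurable_cong[THEN iffD1, rotated] simp: v_def)
    show "\<forall>r\<ge>0. norm (v r) \<le> 1" using u u' s by (auto simp: v_def is_control_iff)
  qed
  moreover have "solution_on f v x (s + t) q"
  proof (rule solution_onI[of _ _ "max B B'" _ "N \<union> {r. r + - s \<in> N'} \<union> {s}"])
    show "q 0 = x" using s y0 by (simp add: q_def)
    show "negligible (N \<union> {r. r + - s \<in> N'} \<union> {s})"
      using N(1) N'(1) by (intro negligible_Un negligible_shift) auto
    show "(max B B')-lipschitz_on {0..s + t} q"
    proof -
      have "B'-lipschitz_on {s..s + t} (\<lambda>r. y' (r + - s))"
        using B' by (intro lipschitz_on_shift) simp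
      from lipschitz_on_concat_max[OF B this] show ?thesis
        using y(2) y0(2) s t unfolding q_def by simp
    qed
    fix r assume r: "0 < r" "r < s + t" "r \<notin> N \<union> {r. r + - s \<in> N'} \<union> {s}"
    show "(q has_vector_derivative velocity f (v r) (q r)) (at r)"
    proof (cases "r < s")
      case True
      then have "(y has_vector_derivative velocity f (v r) (q r)) (at r)"
        using N(2)[of r] r by (simp add: v_def q_def)
      then show ?thesis
        by (rule has_vector_derivative_transform_within_open[of _ _ _ "{..<s}"]) (use True in \<open>auto simp: q_def\<close>)
    next
      case False
      then have "((\<lambda>r. y' (r + - s)) has_vector_derivative velocity f (v r) (q r)) (at r)"
        using N'(2)[of "r + - s"] r by (intro has_vector_derivative_shift_arg) (auto simp: v_def q_def)
      then show ?thesis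
        by (rule has_vector_derivative_transform_within_open[of _ _ _ "{s<..}"]) (use False r in \<open>auto simp: q_def\<close>)
    qed
  qed
  moreover have "q (s + t) = w" using y(2) y'(2) y0 t by (auto simp: q_def)
  ultimately show ?thesis unfolding reach_def using s t
    by (intro conjI exI[of _ v] exI[of _ q]) auto
qed

lemma reach_C1:
  assumes t: "0 \<le> t"
    and y: "\<And>s. s \<in> {0..t} \<Longrightarrow> (y has_vector_derivative velocity f (u s) (y s)) (at s within {0..t})"
    and u: "continuous_on {0..t} u" "\<And>s. s \<in> {0..t} \<Longrightarrow> norm (u s) \<le> 1"
  shows "reach f t (y 0) (y t)"
proof -
  have cy: "continuous_on {0..t} y"
    using y unfolding has_vector_derivative_def by (rule has_derivative_continuous_on)
  have "continuous_on {0..t} (\<lambda>s. velocity f (u s) (y s))"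
    unfolding velocity_def
    by (intro continuous_intros u(1) continuous_on_compose2[OF f cy]) auto
  then have "bounded ((\<lambda>s. velocity f (u s) (y s)) ` {0..t})"
    by (intro compact_imp_bounded compact_continuous_image) auto
  then obtain B where B: "B > 0" "\<And>s. s \<in> {0..t} \<Longrightarrow> norm (velocity f (u s) (y s)) \<le> B"
    unfolding bounded_pos by auto
  have "norm (y r - y s) \<le> B * norm (r - s)" if "r \<in> {0..t}" "s \<in> {0..t}" for r s
    by (rule differentiable_bound[OF convex_real_interval(5) y[unfolded has_vector_derivative_def] _ that])
       (use B in \<open>auto intro: onorm_scaleR_right_le\<close>)
  then have L: "B-lipschitz_on {0..t} y"
    using B by (intro lipschitz_onI) (auto simp: dist_norm)
  define v where "v s = (if s \<in> {0..t} then u s else 0)" for s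
  have "is_control v"
    unfolding is_control_iff
  proof
    have "v \<in> borel_measurable lebesgue"
      unfolding v_def
      by (subst borel_measurable_if) (auto intro!: continuous_imp_measurable_on_sets_lebesgue u)
    moreover have "(\<lambda>s. if s \<in> {0..} then v s else 0) = v" by (auto simp: v_def)
    ultimately show "(\<lambda>s. if s \<in> {0..} then v s else 0) \<in> borel_measurable lebesgue" by simp
  qed (use u in \<open>auto simp: v_def\<close>)
  moreover have "solution_on f v (y 0) t y"
  proof (rule solution_onI[OF refl L, of "{}"])
    fix s assume s: "0 < s" "s < t"
    then show "(y has_vector_derivative velocity f (v s) (y s)) (at s)"
      using y[of s] by (simp add: v_def at_within_Icc_at)
  qed simp
  ultimately show ?thesis unfolding reach_def using t by blast
qed

text \<open>The velocity is linear in the control and the unit ball is symmetric, so the reversed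
  curve is driven by \<open>- u (t - s)\<close>.\<close>

lemma reach_C1_reverse:
  assumes t: "0 \<le> t"
    and y: "\<And>s. s \<in> {0..t} \<Longrightarrow> (y has_vector_derivative velocity f (u s) (y s)) (at s within {0..t})"
    and u: "continuous_on {0..t} u" "\<And>s. s \<in> {0..t} \<Longrightarrow> norm (u s) \<le> 1"
  shows "reach f t (y t) (y 0)"
proof -
  have "reach f t (y (t - 0)) (y (t - t))"
  proof (rule reach_C1[where u = "\<lambda>s. - u (t - s)" and y = "\<lambda>s. y (t - s)", OF t])
    fix s assume s: "s \<in> {0..t}"
    have im: "(\<lambda>s. t - s) ` {0..t} = {0..t}"
      by (auto simp: image_iff intro!: bexI[of _ "t - _"])
    have "((\<lambda>s. t - s) has_vector_derivative - 1) (at s within {0..t})"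
      by (auto intro!: derivative_eq_intros)
    moreover have "(y has_vector_derivative velocity f (u (t - s)) (y (t - s))) (at (t - s) within (\<lambda>s. t - s) ` {0..t})"
      unfolding im using s by (intro y) auto
    ultimately show "((\<lambda>s. y (t - s)) has_vector_derivative velocity f (- u (t - s)) (y (t - s))) (at s within {0..t})"
      using vector_diff_chain_within by (fastforce simp: o_def velocity_minus)
  qed (use u in \<open>auto intro!: continuous_intros continuous_on_compose2[OF u(1)]\<close>)
  then show ?thesis by simp
qed

end

section \<open>Existence and stability of trajectories\<close>

lemma norm_integral_diff_le:
  fixes h k :: "real \<Rightarrow> 'a::euclidean_space"
  assumes "continuous_on {a..b} h" "continuous_on {a..b} k" "t \<in> {a..b}"
    and "\<And>s. s \<in> {a..b} \<Longrightarrow> norm (h s - k s) \<le> B" "0 \<le> B"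
  shows "norm (integral {a..t} h - integral {a..t} k) \<le> B * (b - a)"
proof -
  have c: "continuous_on {a..t} h" "continuous_on {a..t} k"
    using assms(1-3) by (auto elim!: continuous_on_subset)
  have "norm (integral {a..t} h - integral {a..t} k) = norm (integral {a..t} (\<lambda>s. h s - k s))"
    using c by (simp add: integral_diff integrable_continuous_real)
  also have "\<dots> \<le> B * (t - a)"
    using assms c by (intro integral_bound continuous_intros) auto
  also have "\<dots> \<le> B * (b - a)" using assms by (intro mult_left_mono) auto
  finally show ?thesis .
qed

text \<open>The initial time \<open>c\<close> may be anywhere in the interval, because the curve is
  also needed on both sides of \<open>x\<^sub>0\<close>. The factor 4 in the smallness condition
  makes the iteration a contraction with constant 1/2: two integrals occur, each costing
  \<open>L * (b - a)\<close>.\<close>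

lemma picard:
  fixes g :: "real \<Rightarrow> 'a::euclidean_space \<Rightarrow> 'a"
  assumes c: "a \<le> c" "c \<le> b"
    and cont: "continuous_on ({a..b} \<times> UNIV) (\<lambda>(t, y). g t y)"
    and lip: "\<And>t. t \<in> {a..b} \<Longrightarrow> L-lipschitz_on UNIV (g t)"
    and small: "4 * L * (b - a) \<le> 1"
  obtains y where "y c = x" "\<And>t. t \<in> {a..b} \<Longrightarrow> (y has_vector_derivative g t (y t)) (at t within {a..b})"
proof -
  have L: "L \<ge> 0" using lip[of a] c lipschitz_on_nonneg by auto
  define h where "h \<phi> s = g s (apply_bcontfun \<phi> s)" for \<phi> :: "real \<Rightarrow>\<^sub>C 'a" and s
  have ch: "continuous_on {a..b} (h \<phi>)" for \<phi>
  proof -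
    have "continuous_on {a..b} (\<lambda>s. (\<lambda>(t, y). g t y) (s, apply_bcontfun \<phi> s))"
      by (rule continuous_on_compose2[OF cont]) (auto intro!: continuous_intros)
    then show ?thesis unfolding h_def by simp
  qed
  define G where "G \<phi> t = integral {a..t} (h \<phi>)" for \<phi> t
  \<comment> \<open>Clamping the time to \<open>{a..b}\<close> extends the iterate by constants, so
    the iteration acts on the complete space of bounded continuous functions on the line.\<close>
  have "\<exists>\<psi> :: real \<Rightarrow>\<^sub>C 'a. \<forall>t. apply_bcontfun \<psi> t = x + G \<phi> (clamp a b t) - G \<phi> c" for \<phi>
  proof -
    have "continuous_on (cbox a b) (\<lambda>t. x + G \<phi> t - G \<phi> c)"
      unfolding G_def using ch
      by (auto intro!: continuous_intros indefinite_integral_continuous_1 integrable_continuous_real)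
    then show ?thesis by (rule continuous_on_cbox_bcontfunE) auto
  qed
  then obtain \<Phi> where \<Phi>: "\<And>\<phi> t. apply_bcontfun (\<Phi> \<phi>) t = x + G \<phi> (clamp a b t) - G \<phi> c" by metis
  have "\<exists>!\<phi>. \<Phi> \<phi> = \<phi>"
  proof (rule banach_fix_type[of "1 / 2"]; (intro allI)?)
    fix \<phi> \<psi> :: "real \<Rightarrow>\<^sub>C 'a"
    show "dist (\<Phi> \<phi>) (\<Phi> \<psi>) \<le> 1 / 2 * dist \<phi> \<psi>"
    proof (rule dist_bound)
      fix t
      have hh: "norm (h \<phi> s - h \<psi> s) \<le> L * dist \<phi> \<psi>" if "s \<in> {a..b}" for s
      proof -
        have "norm (h \<phi> s - h \<psi> s) \<le> L * dist (apply_bcontfun \<phi> s) (apply_bcontfun \<psi> s)"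
          using lipschitz_onD[OF lip[OF that]] by (simp add: h_def dist_norm)
        also have "\<dots> \<le> L * dist \<phi> \<psi>" using L dist_bounded by (intro mult_left_mono) auto
        finally show ?thesis .
      qed
      have G: "norm (G \<phi> s - G \<psi> s) \<le> L * dist \<phi> \<psi> * (b - a)" if "s \<in> {a..b}" for s
        unfolding G_def using L by (intro norm_integral_diff_le ch hh that) auto
      have "dist (apply_bcontfun (\<Phi> \<phi>) t) (apply_bcontfun (\<Phi> \<psi>) t)
          = norm ((G \<phi> (clamp a b t) - G \<psi> (clamp a b t)) - (G \<phi> c - G \<psi> c))"
        by (simp add: \<Phi> dist_norm algebra_simps)
      also have "\<dots> \<le> norm (G \<phi> (clamp a b t) - G \<psi> (clamp a b t)) + norm (G \<phi> c - G \<psi> c)"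
        by (rule norm_triangle_ineq4)
      also have "\<dots> \<le> L * dist \<phi> \<psi> * (b - a) + L * dist \<phi> \<psi> * (b - a)"
        using c clamp_in_interval[of a b t] by (intro add_mono G) auto
      also have "\<dots> = (4 * L * (b - a)) * (dist \<phi> \<psi> / 2)" by (simp add: field_simps)
      also have "\<dots> \<le> 1 * (dist \<phi> \<psi> / 2)" using small by (intro mult_right_mono) auto
      finally show "dist (apply_bcontfun (\<Phi> \<phi>) t) (apply_bcontfun (\<Phi> \<psi>) t) \<le> 1 / 2 * dist \<phi> \<psi>" by simp
    qed
  qed auto
  then obtain \<phi> where \<phi>: "\<Phi> \<phi> = \<phi>" by blast
  have y: "apply_bcontfun \<phi> t = x + G \<phi> t - G \<phi> c" if "t \<in> {a..b}" for t
    using \<Phi>[of \<phi> t] that unfolding \<phi> by simp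
  show ?thesis
  proof (rule that)
    show "apply_bcontfun \<phi> c = x" using y[of c] c by simp
    fix t assume t: "t \<in> {a..b}"
    have "((\<lambda>t. x + G \<phi> t - G \<phi> c) has_vector_derivative h \<phi> t) (at t within {a..b})"
      using integral_has_vector_derivative[OF ch t] unfolding G_def
      by (auto intro!: derivative_eq_intros)
    then show "(apply_bcontfun \<phi> has_vector_derivative g t (apply_bcontfun \<phi> t)) (at t within {a..b})"
      using has_vector_derivative_transform[OF t y] by (simp add: h_def)
  qed
qed

text \<open>A measurable function is almost everywhere a limit of continuous ones. Projecting these
  onto the unit ball keeps them admissible, and the common bound 2 on the differences permits
  dominated convergence.\<close>

lemma control_L1_approximation:
  fixes u :: "real \<Rightarrow> real ^ 'm"
  assumes u: "is_control u" and e: "e > 0"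
  obtains v where "continuous_on UNIV v" "\<And>t. norm (v t) \<le> 1"
    "(\<lambda>t. norm (u t - v t)) integrable_on {0..T}"
    "integral {0..T} (\<lambda>t. norm (u t - v t)) < e"
proof -
  define U where "U t = (if t \<in> {0..} then u t else 0)" for t
  have U: "U \<in> borel_measurable lebesgue" "norm (U t) \<le> 1" for t
    using u unfolding is_control_iff U_def by auto
  have "U measurable_on UNIV"
    using lebesgue_measurable_imp_measurable_on[of U UNIV] U(1) by simp
  then obtain N g where N: "negligible N" and g: "\<And>n. continuous_on UNIV (g n)"
    and lim: "\<And>t. t \<notin> N \<Longrightarrow> (\<lambda>n. g n t) \<longlonglongrightarrow> U t"
    unfolding measurable_on_def by auto
  \<comment> \<open>The nearest-point map is continuous and fixes the values of \<open>U\<close>, so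
    projecting preserves the limit.\<close>
  define p :: "real ^ 'm \<Rightarrow> real ^ 'm" where "p = closest_point (cball 0 1)"
  have p: "continuous_on UNIV p" "norm (p w) \<le> 1" for w
    unfolding p_def using closest_point_in_set[of "cball 0 1" w]
    by (auto intro!: continuous_on_closest_point simp del: closest_point_in_set)
  define v where "v n t = p (g n t)" for n t
  have cv: "continuous_on UNIV (v n)" for n
    unfolding v_def by (rule continuous_on_compose2[OF p(1) g]) auto
  have v1: "norm (v n t) \<le> 1" for n t by (simp add: v_def p)
  have vlim: "(\<lambda>n. v n t) \<longlonglongrightarrow> U t" if "t \<notin> N" for t
  proof -
    have "(\<lambda>n. v n t) \<longlonglongrightarrow> p (U t)"
      unfolding v_def using p(1) lim[OF that]
      by (auto intro: continuous_on_tendsto_compose)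
    moreover have "p (U t) = U t"
      unfolding p_def using U(2) by (intro closest_point_self) auto
    ultimately show ?thesis by simp
  qed
  define F where "F n t = norm (U t - v n t)" for n t
  have F2: "norm (F n t) \<le> 2" for n t
    using norm_triangle_ineq4[of "U t" "v n t"] U(2)[of t] v1[of n t] by (simp add: F_def)
  have Fm: "F n \<in> borel_measurable lebesgue" for n
  proof -
    have "v n \<in> borel_measurable lebesgue"
      using borel_measurable_continuous_onI[OF cv, of n] by (intro measurable_completion) simp
    then show ?thesis
      unfolding F_def using U(1) by measurable
  qed
  have int: "F n integrable_on {0..T}" for n
    by (rule measurable_bounded_by_integrable_imp_integrable[where g = "\<lambda>_. 2"])
       (use F2 Fm in \<open>auto intro: measurable_restrict_space1 integrable_const_ivl\<close>)
  have "(\<lambda>n. integral ({0..T} - N) (F n)) \<longlonglongrightarrow> integral ({0..T} - N) (\<lambda>_. 0)"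
  proof (rule dominated_convergence(2)[where h = "\<lambda>_. 2"])
    show "F n integrable_on {0..T} - N" for n
      using int by (rule integrable_spike_set) (use N in \<open>auto intro: negligible_subset\<close>)
    show "(\<lambda>_. 2::real) integrable_on {0..T} - N"
      by (rule integrable_spike_set[OF integrable_const_ivl]) (use N in \<open>auto intro: negligible_subset\<close>)
    show "norm (F n t) \<le> 2" for n t by (rule F2)
    show "(\<lambda>n. F n t) \<longlonglongrightarrow> 0" if "t \<in> {0..T} - N" for t
      unfolding F_def using tendsto_norm_zero[OF LIM_zero[OF vlim[of t]]] that
      by (simp add: norm_minus_commute)
  qed
  moreover have "integral ({0..T} - N) (F n) = integral {0..T} (F n)" for n
    using N by (intro integral_spike_set) (auto intro: negligible_subset)
  ultimately have "(\<lambda>n. integral {0..T} (F n)) \<longlonglongrightarrow> 0" by simp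
  from order_tendstoD(2)[OF this e] obtain n where n: "integral {0..T} (F n) < e"
    by (auto simp: eventually_sequentially)
  have FU: "F n t = norm (u t - v n t)" if "t \<in> {0..T}" for t using that by (simp add: F_def U_def)
  show ?thesis
  proof (rule that[OF cv v1])
    show "(\<lambda>t. norm (u t - v n t)) integrable_on {0..T}"
      using integrable_cong[of "{0..T}" "F n" "\<lambda>t. norm (u t - v n t)", OF FU] int[of n] by simp
    show "integral {0..T} (\<lambda>t. norm (u t - v n t)) < e"
      using integral_cong[of "{0..T}" "F n" "\<lambda>t. norm (u t - v n t)", OF FU] n by simp
  qed
qed

section \<open>Confinement to a ball and tracking of a trajectory\<close>

locale control_ball =
  fixes f :: "'m::finite \<Rightarrow> 'a::euclidean_space \<Rightarrow> 'a" and x\<^sub>0 :: 'a and R M L :: real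
  assumes f: "\<And>i. continuous_on UNIV (f i)"
    and R: "R > 0"
    and M: "\<And>i x. x \<in> cball x\<^sub>0 R \<Longrightarrow> norm (f i x) \<le> M"
    and L: "\<And>i. L-lipschitz_on (cball x\<^sub>0 R) (f i)"
begin

lemma M_nonneg: "M \<ge> 0"
  using M[of x\<^sub>0 undefined] R by (auto intro: order_trans[OF norm_ge_zero])

lemma L_nonneg: "L \<ge> 0"
  using L by (rule lipschitz_on_nonneg)

lemma norm_velocity_ball:
  assumes "x \<in> cball x\<^sub>0 R" "norm v \<le> 1"
  shows "norm (velocity f v x) \<le> CARD('m) * M"
proof -
  have "norm (velocity f v x) \<le> CARD('m) * M * norm v"
    using M assms by (intro norm_velocity_le) auto
  also have "\<dots> \<le> CARD('m) * M * 1" using assms M_nonneg by (intro mult_left_mono) auto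
  finally show ?thesis by simp
qed

text \<open>Until the first exit time the speed is at most \<open>CARD('m) * M\<close>, so the
  distance covered by then is too short to reach the sphere of radius \<rho>.\<close>

lemma solution_confined:
  assumes u: "is_control u" and y: "solution_on f u x T y"
    and \<rho>: "\<rho> \<le> R" and T: "CARD('m) * M * T < \<rho> - dist x x\<^sub>0" and t: "t \<in> {0..T}"
  shows "y t \<in> ball x\<^sub>0 \<rho>"
proof (rule ccontr)
  assume *: "y t \<notin> ball x\<^sub>0 \<rho>"
  have cy: "continuous_on {0..T} y" and y0: "y 0 = x"
    using y unfolding solution_on_def by (auto intro: abs_continuous_on_imp_continuous)
  define S where "S = {s \<in> {0..T}. \<rho> \<le> dist (y s) x\<^sub>0}"
  have "closed S"
  proof -
    have "S = {0..T} \<inter> (\<lambda>s. dist (y s) x\<^sub>0) -` {\<rho>..}" by (auto simp: S_def)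
    then show ?thesis
      by (simp only:) (intro continuous_closed_preimage continuous_intros cy closed_atLeast closed_real_atLeastAtMost)
  qed
  moreover have "t \<in> S" using * t by (auto simp: S_def dist_commute)
  moreover have bdd: "bdd_below S" unfolding S_def by (rule bdd_belowI[of _ 0]) auto
  ultimately have s: "Inf S \<in> S" by (intro closed_contains_Inf) auto
  define s where "s = Inf S"
  have sS: "s \<in> {0..T}" "\<rho> \<le> dist (y s) x\<^sub>0" using s by (auto simp: S_def s_def)
  have before: "y r \<in> cball x\<^sub>0 \<rho>" if "r \<in> {0..s} - {s}" for r
  proof -
    have "r \<notin> S" using that cInf_lower[OF _ bdd, of r] by (auto simp: s_def)
    then show ?thesis using that sS by (auto simp: S_def dist_commute)
  qed
  have "norm (y s - y 0) \<le> (CARD('m) * M) * measure lborel (cbox 0 s)"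
  proof (rule has_integral_bound_spike_finite[where S = "{s}"])
    show "((\<lambda>r. velocity f (u r) (y r)) has_integral y s - y 0) (cbox 0 s)"
      using solution_on_has_integral[OF y, of 0 s] sS by simp
    show "norm (velocity f (u r) (y r)) \<le> CARD('m) * M" if "r \<in> cbox 0 s - {s}" for r
      using that before[of r] is_control_norm[OF u] \<rho> by (intro norm_velocity_ball) auto
  qed (use M_nonneg in auto)
  also have "\<dots> = CARD('m) * M * s" using sS by simp
  also have "\<dots> \<le> CARD('m) * M * T" using sS M_nonneg by (intro mult_left_mono) auto
  finally have "dist (y s) x < \<rho> - dist x x\<^sub>0" using T y0 by (simp add: dist_norm)
  then show False using sS(2) dist_triangle[of "y s" x\<^sub>0 x] by linarith
qed

text \<open>Retracting onto the ball extends the fields to globally Lipschitz ones, as Picard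
  iteration requires. On the ball, where the relevant trajectories stay, nothing changes.\<close>

definition proj_field :: "'m \<Rightarrow> 'a \<Rightarrow> 'a" where
  "proj_field i x = f i (closest_point (cball x\<^sub>0 R) x)"

lemma proj_in: "closest_point (cball x\<^sub>0 R) x \<in> cball x\<^sub>0 R"
  using R by (intro closest_point_in_set) auto

lemma proj_field_eq: "x \<in> cball x\<^sub>0 R \<Longrightarrow> proj_field i x = f i x"
  unfolding proj_field_def by (simp add: closest_point_self)

lemma proj_lipschitz:
  assumes "K-lipschitz_on (cball x\<^sub>0 R) h"
  shows "K-lipschitz_on UNIV (\<lambda>x. h (closest_point (cball x\<^sub>0 R) x))"
proof (rule lipschitz_onI)
  fix x y
  have "dist (h (closest_point (cball x\<^sub>0 R) x)) (h (closest_point (cball x\<^sub>0 R) y))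
      \<le> K * dist (closest_point (cball x\<^sub>0 R) x) (closest_point (cball x\<^sub>0 R) y)"
    by (rule lipschitz_onD[OF assms proj_in proj_in])
  also have "\<dots> \<le> K * dist x y"
    using R by (intro mult_left_mono closest_point_lipschitz lipschitz_on_nonneg[OF assms]) auto
  finally show "dist (h (closest_point (cball x\<^sub>0 R) x)) (h (closest_point (cball x\<^sub>0 R) y)) \<le> K * dist x y" .
qed (rule lipschitz_on_nonneg[OF assms])

lemma proj_field_lipschitz: "L-lipschitz_on UNIV (proj_field i)"
  unfolding proj_field_def by (rule proj_lipschitz[OF L])

text \<open>The curve from \<open>x'\<close> uses a continuous control close to \<open>u\<close> in
  L1, which accounts for the extra error \<open>e\<close>. Being C1, it can be traversed in both
  directions; the way back is what later returns from a point of full rank.\<close>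

lemma tracking:
  assumes x: "x \<in> ball x\<^sub>0 (R / 2)" "x' \<in> ball x\<^sub>0 (R / 2)"
    and T: "T \<ge> 0" "4 * (CARD('m) * L) * T \<le> 1" "CARD('m) * M * T < R / 2"
    and u: "is_control u" and y: "solution_on f u x T y" and e: "e > 0"
  obtains z where "reach f T x' z" "reach f T z x'" "dist z (y T) \<le> 2 * dist x x' + e"
proof -
  let ?N = "real CARD('m)"
  \<comment> \<open>An L1 error \<epsilon> in the control displaces the end point by at most
    \<open>?N * M * \<epsilon>\<close>, which this makes at most \<open>e / 2\<close>; the 1 covers
    \<open>M = 0\<close>.\<close>
  define \<epsilon> where "\<epsilon> = e / (2 * (?N * M + 1))"
  have NM: "?N * M \<ge> 0" using M_nonneg by simp
  have \<epsilon>: "\<epsilon> > 0" "?N * M * \<epsilon> \<le> e / 2" using e NM by (auto simp: \<epsilon>_def field_simps)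
  obtain v where v: "continuous_on UNIV v" "\<And>t. norm (v t) \<le> 1"
    "(\<lambda>t. norm (u t - v t)) integrable_on {0..T}"
    "integral {0..T} (\<lambda>t. norm (u t - v t)) < \<epsilon>"
    by (rule control_L1_approximation[OF u \<epsilon>(1), where T = T]) blast
  have cp: "continuous_on UNIV (proj_field i)" for i
    using proj_field_lipschitz lipschitz_on_continuous_on by blast
  have vlip: "norm (velocity proj_field w a - velocity proj_field w b) \<le> ?N * L * dist a b" if "norm w \<le> 1" for w a b
  proof -
    have "norm (velocity proj_field w a - velocity proj_field w b) \<le> ?N * (L * dist a b) * norm w"
      using lipschitz_onD[OF proj_field_lipschitz, of a b] by (intro norm_velocity_diff_le) (auto simp: dist_norm)
    also have "\<dots> \<le> ?N * (L * dist a b) * 1"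
      using that L_nonneg by (intro mult_left_mono) auto
    finally show ?thesis by simp
  qed
  obtain z where z0: "z 0 = x'"
    and z: "\<And>t. t \<in> {0..T} \<Longrightarrow> (z has_vector_derivative velocity proj_field (v t) (z t)) (at t within {0..T})"
  proof (rule picard[of 0 0 T "\<lambda>t x. velocity proj_field (v t) x" "?N * L"])
    show "continuous_on ({0..T} \<times> UNIV) (\<lambda>(t, x). velocity proj_field (v t) x)"
      unfolding velocity_def split_beta
      by (intro continuous_intros continuous_on_compose2[OF v(1)] continuous_on_compose2[OF cp]) auto
    show "(?N * L)-lipschitz_on UNIV (velocity proj_field (v t))" for t
      using vlip[OF v(2)] L_nonneg by (intro lipschitz_onI) (auto simp: dist_norm)
  qed (use T in auto)
  have zint: "((\<lambda>r. velocity proj_field (v r) (z r)) has_integral (z t - x')) {0..t}" if t: "t \<in> {0..T}" for t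
  proof -
    have "((\<lambda>r. velocity proj_field (v r) (z r)) has_integral (z t - z 0)) {0..t}"
    proof (rule fundamental_theorem_of_calculus)
      fix r assume "r \<in> {0..t}"
      then show "(z has_vector_derivative velocity proj_field (v r) (z r)) (at r within {0..t})"
        using t by (intro has_vector_derivative_within_subset[OF z]) auto
    qed (use t in auto)
    then show ?thesis using z0 by simp
  qed
  have zC: "z t \<in> cball x\<^sub>0 R" if t: "t \<in> {0..T}" for t
  proof -
    have "norm (velocity proj_field w a) \<le> ?N * M" if "norm w \<le> 1" for w a
    proof -
      have "velocity proj_field w a = velocity f w (closest_point (cball x\<^sub>0 R) a)"
        by (simp add: velocity_def proj_field_def)
      then show ?thesis using norm_velocity_ball[OF proj_in that] by simp
    qed
    then have "norm (z t - x') \<le> ?N * M * measure lborel (cbox 0 t)"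
      using zint[OF t] v(2) NM by (intro has_integral_bound[where f = "\<lambda>r. velocity proj_field (v r) (z r)"]) auto
    also have "\<dots> = ?N * M * t" using t by simp
    also have "\<dots> \<le> ?N * M * T" using t NM by (intro mult_left_mono) auto
    finally have "dist x' (z t) < R / 2" using T by (simp add: dist_norm norm_minus_commute)
    then show ?thesis using x(2) dist_triangle[of x\<^sub>0 "z t" x'] by auto
  qed
  have veq: "velocity proj_field w a = velocity f w a" if "a \<in> cball x\<^sub>0 R" for w a
    using that by (simp add: velocity_def proj_field_eq)
  have zf: "(z has_vector_derivative velocity f (v t) (z t)) (at t within {0..T})" if "t \<in> {0..T}" for t
    using z[OF that] veq[OF zC[OF that]] by simp
  have yC: "y t \<in> cball x\<^sub>0 R" if "t \<in> {0..T}" for t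
    using solution_confined[OF u y order_refl _ that] x T by (auto simp: dist_commute)
  have cy: "continuous_on {0..T} y" and y0: "y 0 = x"
    using y unfolding solution_on_def by (auto intro: abs_continuous_on_imp_continuous)
  have cz: "continuous_on {0..T} z"
    using z unfolding has_vector_derivative_def by (rule has_derivative_continuous_on)
  \<comment> \<open>In place of Gronwall's lemma, the time \<open>s\<close> of greatest distance is
    considered: over this short interval the Lipschitz term is at most a quarter of that distance
    and can be absorbed.\<close>
  have "\<exists>s\<in>{0..T}. \<forall>t\<in>{0..T}. dist (y t) (z t) \<le> dist (y s) (z s)"
    using T by (intro continuous_attains_sup continuous_intros cy cz) auto
  then obtain s where s: "s \<in> {0..T}" and smax: "\<And>t. t \<in> {0..T} \<Longrightarrow> dist (y t) (z t) \<le> dist (y s) (z s)"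
    by blast
  define D where "D = dist (y s) (z s)"
  have D0: "D \<ge> 0" by (simp add: D_def)
  have uvint: "(\<lambda>r. norm (u r - v r)) integrable_on {0..s}"
    using v(3) by (rule integrable_on_subinterval) (use s in auto)
  have "((\<lambda>r. velocity f (u r) (y r) - velocity proj_field (v r) (z r)) has_integral ((y s - y 0) - (z s - x'))) {0..s}"
    using solution_on_has_integral[OF y, of 0 s] zint[OF s] s by (intro has_integral_diff) auto
  then have i1: "(\<lambda>r. velocity f (u r) (y r) - velocity proj_field (v r) (z r)) integrable_on {0..s}"
    and i2: "integral {0..s} (\<lambda>r. velocity f (u r) (y r) - velocity proj_field (v r) (z r)) = (y s - x) - (z s - x')"
    using y0 by (auto simp: has_integral_iff)
  have "norm ((y s - x) - (z s - x')) \<le> integral {0..s} (\<lambda>r. ?N * M * norm (u r - v r) + ?N * L * D)"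
    unfolding i2[symmetric]
  proof (rule integral_norm_bound_integral[OF i1])
    show "(\<lambda>r. ?N * M * norm (u r - v r) + ?N * L * D) integrable_on {0..s}"
      using uvint by (intro integrable_add integrable_on_mult_right integrable_const_ivl)
    fix r assume "r \<in> {0..s}"
    then have r: "r \<in> {0..T}" using s by auto
    \<comment> \<open>The error splits into a change of control at the same point and a change of
      point under the same control.\<close>
    have "velocity f (u r) (y r) - velocity proj_field (v r) (z r)
       = velocity f (u r - v r) (y r) + (velocity proj_field (v r) (y r) - velocity proj_field (v r) (z r))"
      unfolding velocity_diff[symmetric] veq[OF yC[OF r]] by simp
    also have "norm \<dots> \<le> ?N * M * norm (u r - v r) + ?N * L * dist (y r) (z r)"
      using M yC[OF r] v(2) by (intro norm_triangle_mono norm_velocity_le vlip) auto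
    also have "\<dots> \<le> ?N * M * norm (u r - v r) + ?N * L * D"
      using smax[OF r] L_nonneg by (auto simp: D_def intro!: mult_left_mono)
    finally show "norm (velocity f (u r) (y r) - velocity proj_field (v r) (z r)) \<le> ?N * M * norm (u r - v r) + ?N * L * D" .
  qed
  also have "\<dots> = ?N * M * integral {0..s} (\<lambda>r. norm (u r - v r)) + ?N * L * D * s"
    using uvint s by (subst integral_add) (auto intro: integrable_on_mult_right)
  also have "\<dots> \<le> ?N * M * \<epsilon> + ?N * L * D * T"
  proof (intro add_mono mult_left_mono)
    have "integral {0..s} (\<lambda>r. norm (u r - v r)) \<le> integral {0..T} (\<lambda>r. norm (u r - v r))"
      using s uvint v(3) by (intro integral_subset_le) auto
    then show "integral {0..s} (\<lambda>r. norm (u r - v r)) \<le> \<epsilon>" using v(4) by simp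
  qed (use s NM D0 L_nonneg in auto)
  also have "\<dots> \<le> e / 2 + D / 4"
    using \<epsilon>(2) mult_right_mono[OF T(2) D0] by (simp add: mult_ac)
  finally have "norm ((y s - x) - (z s - x')) \<le> e / 2 + D / 4" .
  moreover have "D \<le> norm ((y s - x) - (z s - x')) + dist x x'"
    using norm_triangle_ineq[of "(y s - x) - (z s - x')" "x - x'"] by (simp add: D_def dist_norm)
  \<comment> \<open>Three quarters of \<open>D\<close> are at most
    \<open>dist x x' + e / 2\<close>.\<close>
  ultimately have "D \<le> 2 * dist x x' + e" using e zero_le_dist[of x x'] by linarith
  then have "dist (z T) (y T) \<le> 2 * dist x x' + e"
    using smax[of T] T by (simp add: D_def dist_commute)
  moreover have "reach f T (z 0) (z T)" "reach f T (z T) (z 0)"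
    using reach_C1[OF f T(1) zf _ v(2)] reach_C1_reverse[OF f T(1) zf _ v(2)]
      continuous_on_subset[OF v(1)] by auto
  ultimately show ?thesis using that z0 by simp
qed

end

section \<open>Steering and integral curves in the plane\<close>

lemma velocity_add: "velocity f (u + v) x = velocity f u x + velocity f v x"
  by (simp add: velocity_def sum.distrib scaleR_add_left)

lemma velocity_axis: "velocity f (axis i c) x = c *\<^sub>R f i x"
  by (simp add: velocity_def axis_def if_distrib [of "\<lambda>c. c *\<^sub>R _"] cong: if_cong)

lemma norm_axis_real: "norm (axis i x :: real ^ 'n) = \<bar>x\<bar>"
proof -
  have "axis i x = x *\<^sub>R (axis i 1 :: real ^ 'n)" by (simp add: vec_eq_iff axis_def)
  then show ?thesis by (simp add: norm_axis_1)
qed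

lemma norm_le_abs_components:
  fixes x :: "real ^ 2" and k l :: 2
  assumes "k \<noteq> l"
  shows "norm x \<le> \<bar>x $ k\<bar> + \<bar>x $ l\<bar>"
proof -
  have "i = k \<or> i = l" for i using assms exhaust_2[of i] exhaust_2[of k] exhaust_2[of l] by metis
  then have U: "(UNIV :: 2 set) = {k, l}" by auto
  show ?thesis using norm_le_l1_cart[of x] assms unfolding U by simp
qed

lemma vec2_eqI:
  fixes x y :: "real ^ 2" and k l :: 2
  assumes "k \<noteq> l" "x $ k = y $ k" "x $ l = y $ l"
  shows "x = y"
  using norm_le_abs_components[OF assms(1), of "x - y"] assms by simp

text \<open>
  Near \<open>x\<^sub>0\<close> the field \<open>f i\<^sub>0\<close> is nowhere vertical with respect to the coordinates \<open>(k, l)\<close>. The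
  fields fail to span the plane exactly where all the functions \<open>defect j\<close> vanish.
\<close>

locale planar_control = control_ball f x\<^sub>0 R M L
  for f :: "'m::finite \<Rightarrow> real ^ 2 \<Rightarrow> real ^ 2" and x\<^sub>0 :: "real ^ 2" and R M L :: real +
  fixes i\<^sub>0 :: 'm and k l :: 2 and c Ls :: real
  assumes kl: "k \<noteq> l"
    and smooth: "\<And>i. smooth_field (f i)"
    and hoermander: "hoermander f"
    and c: "c > 0" "\<And>x. x \<in> cball x\<^sub>0 R \<Longrightarrow> c \<le> \<bar>f i\<^sub>0 x $ k\<bar>"
    and slope_lipschitz': "Ls-lipschitz_on (cball x\<^sub>0 R) (\<lambda>x. f i\<^sub>0 x $ l / f i\<^sub>0 x $ k)"
begin

definition slope :: "real ^ 2 \<Rightarrow> real" where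
  "slope x = f i\<^sub>0 x $ l / f i\<^sub>0 x $ k"

text \<open>This is the determinant of \<open>f i\<^sub>0 x\<close> and \<open>f j x\<close> in the
  coordinates \<open>(k, l)\<close>, divided by \<open>f i\<^sub>0 x $ k\<close>.\<close>

definition defect :: "'m \<Rightarrow> real ^ 2 \<Rightarrow> real" where
  "defect j x = f j x $ l - slope x * f j x $ k"

definition pt :: "real \<Rightarrow> real \<Rightarrow> real ^ 2" where
  "pt w z = axis k w + axis l z"

lemma pt_nth [simp]: "pt w z $ k = w" "pt w z $ l = z"
  using kl by (auto simp: pt_def axis_def)

lemma slope_lipschitz: "Ls-lipschitz_on (cball x\<^sub>0 R) slope"
  using slope_lipschitz' unfolding slope_def .

lemma slope_bound:
  assumes "x \<in> cball x\<^sub>0 R"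
  shows "\<bar>slope x\<bar> \<le> M / c"
proof -
  have "\<bar>f i\<^sub>0 x $ l\<bar> \<le> M" using M[OF assms, of i\<^sub>0] component_le_norm_cart order_trans by blast
  then show ?thesis unfolding slope_def abs_divide
    using c(1) c(2)[OF assms] M_nonneg by (intro frac_le) auto
qed

lemma Mc_nonneg: "0 \<le> M / c"
  using M_nonneg c by simp

lemma continuous_defect: "continuous_on (cball x\<^sub>0 R) (defect j)"
  unfolding defect_def
  by (intro continuous_intros lipschitz_on_continuous_on[OF slope_lipschitz] continuous_on_subset[OF f]) auto

text \<open>The sum of the bounds for the two coefficients that realise a velocity of norm at most
  1: \<open>(1 + M / c) / \<epsilon>\<close> for \<open>f j\<close>, and the second summand for
  \<open>f i\<^sub>0\<close>, which must also compensate the \<open>k\<close> component of the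
  \<open>f j\<close> term.\<close>

definition steer_const :: "real \<Rightarrow> real" where
  "steer_const \<epsilon> = (1 + M / c) / \<epsilon> + (1 + (1 + M / c) / \<epsilon> * M) / c"

lemma steer_const_pos: "\<epsilon> > 0 \<Longrightarrow> steer_const \<epsilon> > 0"
  unfolding steer_const_def using c M_nonneg
  by (intro add_pos_nonneg divide_pos_pos divide_nonneg_pos mult_nonneg_nonneg add_nonneg_nonneg) auto

text \<open>Where \<open>f i\<^sub>0\<close> and \<open>f j\<close> are independent, Cramer's rule
  writes the constant velocity along the segment as a combination of them, with continuous
  coefficients. Moving at speed \<open>1 / steer_const \<epsilon>\<close> keeps the control in the
  unit ball.\<close>

lemma steering:
  assumes \<epsilon>: "\<epsilon> > 0"
    and seg: "closed_segment p q \<subseteq> cball x\<^sub>0 R"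
    and defect: "\<And>z. z \<in> closed_segment p q \<Longrightarrow> \<epsilon> \<le> \<bar>defect j z\<bar>"
  shows "reach f (steer_const \<epsilon> * dist p q) p q"
proof (cases "p = q")
  case True
  then show ?thesis by (simp add: reach_refl)
next
  case False
  let ?Q = "steer_const \<epsilon>"
  have Q: "?Q > 0" using steer_const_pos[OF \<epsilon>] .
  define T where "T = ?Q * dist p q"
  have T: "T > 0" using Q False by (simp add: T_def)
  define w where "w = (1 / T) *\<^sub>R (q - p)"
  define y where "y s = p + s *\<^sub>R w" for s
  have y0: "y 0 = p" "y T = q" using T by (auto simp: y_def w_def)
  have yseg: "y s \<in> closed_segment p q" if "s \<in> {0..T}" for s
  proof -
    have "y s = (1 - s / T) *\<^sub>R p + (s / T) *\<^sub>R q"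
      by (simp add: y_def w_def algebra_simps)
    moreover have "0 \<le> s / T" "s / T \<le> 1" using that T by auto
    ultimately show ?thesis unfolding in_segment by blast
  qed
  have nw: "norm w = 1 / ?Q"
    using T False by (simp add: w_def T_def dist_norm norm_minus_commute)
  \<comment> \<open>Eliminating the \<open>f i\<^sub>0\<close> part with the slope leaves one
    equation for \<open>b\<close> with coefficient \<open>defect j\<close>; then \<open>a\<close> is
    read off from the \<open>k\<close> component.\<close>
  define b where "b s = (w $ l - slope (y s) * w $ k) / defect j (y s)" for s
  define a where "a s = (w $ k - b s * f j (y s) $ k) / f i\<^sub>0 (y s) $ k" for s
  define u where "u s = a s *\<^sub>R axis i\<^sub>0 (1::real) + b s *\<^sub>R axis j 1" for s
  have uax: "u s = axis i\<^sub>0 (a s) + axis j (b s)" for s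
    by (simp add: u_def vec_eq_iff axis_def)
  have vel: "velocity f (u s) (y s) = w" if s: "s \<in> {0..T}" for s
  proof (rule vec2_eqI[OF kl])
    have "f i\<^sub>0 (y s) $ k \<noteq> 0" using c(1) c(2)[of "y s"] yseg[OF s] seg by force
    moreover have "defect j (y s) \<noteq> 0" using defect[OF yseg[OF s]] \<epsilon> by auto
    ultimately have k: "a s * f i\<^sub>0 (y s) $ k = w $ k - b s * f j (y s) $ k"
      and l: "b s * defect j (y s) = w $ l - slope (y s) * w $ k"
      and sl: "f i\<^sub>0 (y s) $ l = slope (y s) * f i\<^sub>0 (y s) $ k"
      by (auto simp: a_def b_def slope_def)
    show "velocity f (u s) (y s) $ k = w $ k"
      using k by (simp add: uax velocity_add velocity_axis)
    have "a s * f i\<^sub>0 (y s) $ l + b s * f j (y s) $ l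
        = slope (y s) * (a s * f i\<^sub>0 (y s) $ k) + b s * f j (y s) $ l"
      by (simp add: sl)
    also have "\<dots> = slope (y s) * w $ k + b s * defect j (y s)"
      unfolding k by (simp add: defect_def algebra_simps)
    also have "\<dots> = w $ l" using l by simp
    finally show "velocity f (u s) (y s) $ l = w $ l"
      by (simp add: uax velocity_add velocity_axis)
  qed
  have un: "norm (u s) \<le> 1" if s: "s \<in> {0..T}" for s
  proof -
    have ys: "y s \<in> cball x\<^sub>0 R" using yseg[OF s] seg by blast
    have wk: "\<bar>w $ k\<bar> \<le> 1 / ?Q" "\<bar>w $ l\<bar> \<le> 1 / ?Q"
      using component_le_norm_cart[of w] nw by auto
    have "\<bar>slope (y s) * w $ k\<bar> \<le> M / c * (1 / ?Q)"
      unfolding abs_mult using Mc_nonneg wk slope_bound[OF ys] by (intro mult_mono) auto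
    then have "\<bar>w $ l - slope (y s) * w $ k\<bar> \<le> 1 / ?Q + M / c * (1 / ?Q)"
      using wk abs_triangle_ineq4[of "w $ l" "slope (y s) * w $ k"] by linarith
    also have "\<dots> = (1 + M / c) * (1 / ?Q)" by (simp only: distrib_right mult_1_left)
    finally have "\<bar>w $ l - slope (y s) * w $ k\<bar> \<le> (1 + M / c) * (1 / ?Q)" .
    then have "\<bar>b s\<bar> \<le> (1 + M / c) * (1 / ?Q) / \<epsilon>"
      unfolding b_def abs_divide using defect[OF yseg[OF s]] \<epsilon> Mc_nonneg Q
      by (intro frac_le) auto
    then have b: "\<bar>b s\<bar> \<le> (1 + M / c) / \<epsilon> * (1 / ?Q)" by (simp only: times_divide_eq_left times_divide_eq_right divide_divide_eq_left mult.commute[of \<epsilon>])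
    have "\<bar>f j (y s) $ k\<bar> \<le> M" using M[OF ys, of j] component_le_norm_cart order_trans by blast
    then have "\<bar>b s * f j (y s) $ k\<bar> \<le> (1 + M / c) / \<epsilon> * (1 / ?Q) * M"
      unfolding abs_mult using b by (intro mult_mono order_trans[OF abs_ge_zero b]) auto
    then have "\<bar>w $ k - b s * f j (y s) $ k\<bar> \<le> 1 / ?Q + (1 + M / c) / \<epsilon> * (1 / ?Q) * M"
      using wk abs_triangle_ineq4[of "w $ k" "b s * f j (y s) $ k"] by linarith
    also have "\<dots> = (1 + (1 + M / c) / \<epsilon> * M) * (1 / ?Q)"
      by (simp only: distrib_right mult_1_left mult.assoc mult.commute[of M])
    finally have "\<bar>w $ k - b s * f j (y s) $ k\<bar> \<le> (1 + (1 + M / c) / \<epsilon> * M) * (1 / ?Q)" .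
    then have "\<bar>a s\<bar> \<le> (1 + (1 + M / c) / \<epsilon> * M) * (1 / ?Q) / c"
      unfolding a_def abs_divide using c(1) c(2)[OF ys]
      by (intro frac_le order_trans[OF abs_ge_zero]) auto
    then have a: "\<bar>a s\<bar> \<le> (1 + (1 + M / c) / \<epsilon> * M) / c * (1 / ?Q)" by (simp only: times_divide_eq_left times_divide_eq_right divide_divide_eq_left mult.commute[of c])
    have "norm (u s) \<le> \<bar>a s\<bar> + \<bar>b s\<bar>"
      unfolding uax by (rule order_trans[OF norm_triangle_ineq]) (simp add: norm_axis_real)
    also have "\<dots> \<le> ?Q * (1 / ?Q)"
      unfolding steer_const_def[of \<epsilon>] distrib_right using a b by (simp add: steer_const_def)
    finally show ?thesis using Q by simp
  qed
  have cy: "continuous_on {0..T} y" unfolding y_def by (intro continuous_intros)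
  have ycb: "y ` {0..T} \<subseteq> cball x\<^sub>0 R" using yseg seg by blast
  have comp: "continuous_on {0..T} (\<lambda>s. h (y s))" if "continuous_on (cball x\<^sub>0 R) h" for h :: "real ^ 2 \<Rightarrow> real"
    by (rule continuous_on_compose2[OF that cy ycb])
  have cu: "continuous_on {0..T} u"
  proof -
    have nz: "\<forall>s\<in>{0..T}. defect j (y s) \<noteq> 0" using defect yseg \<epsilon> by fastforce
    have nz': "\<forall>s\<in>{0..T}. f i\<^sub>0 (y s) $ k \<noteq> 0" using c ycb by fastforce
    have fc: "continuous_on {0..T} (\<lambda>s. f i (y s) $ r)" for i r
      by (rule comp) (intro continuous_intros continuous_on_subset[OF f], auto)
    have "continuous_on {0..T} b" unfolding b_def
      using nz by (intro continuous_intros comp continuous_defect lipschitz_on_continuous_on[OF slope_lipschitz]) auto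
    moreover from this have "continuous_on {0..T} a" unfolding a_def
      using nz' by (intro continuous_intros fc) auto
    ultimately show ?thesis unfolding u_def by (intro continuous_intros)
  qed
  have "reach f T (y 0) (y T)"
  proof (rule reach_C1[OF f _ _ cu un])
    fix s assume s: "s \<in> {0..T}"
    have "(y has_vector_derivative w) (at s within {0..T})"
      unfolding y_def by (auto intro!: derivative_eq_intros)
    then show "(y has_vector_derivative velocity f (u s) (y s)) (at s within {0..T})"
      unfolding vel[OF s] .
  qed (use T in auto)
  then show ?thesis using y0 by (simp add: T_def)
qed

text \<open>The integral curve of \<open>f i\<^sub>0\<close> through \<open>x\<^sub>0\<close>, written as a graph over the coordinate \<open>k\<close>.\<close>

lemma integral_curve:
  obtains \<eta> \<gamma> where "\<eta> > 0"
    "\<And>w. w \<in> {x\<^sub>0 $ k - \<eta>..x\<^sub>0 $ k + \<eta>} \<Longrightarrow>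
      (\<gamma> has_vector_derivative slope (pt w (\<gamma> w))) (at w within {x\<^sub>0 $ k - \<eta>..x\<^sub>0 $ k + \<eta>})"
    "\<And>w. w \<in> {x\<^sub>0 $ k - \<eta>..x\<^sub>0 $ k + \<eta>} \<Longrightarrow> pt w (\<gamma> w) \<in> ball x\<^sub>0 R"
    "\<gamma> (x\<^sub>0 $ k) = x\<^sub>0 $ l"
proof -
  \<comment> \<open>The first bound gives the Picard condition on an interval of length
    \<open>2 * \<eta>\<close>; the second keeps a graph of slope at most \<open>M / c\<close> inside
    the ball.\<close>
  define \<eta> where "\<eta> = min (1 / (8 * (Ls + 1))) (R / (2 * (1 + M / c)))"
  have Ls: "Ls \<ge> 0" using slope_lipschitz by (rule lipschitz_on_nonneg)
  have \<eta>: "\<eta> > 0" using Ls R Mc_nonneg by (auto simp: \<eta>_def intro!: divide_pos_pos add_pos_nonneg)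
  have "\<eta> * (1 + M / c) \<le> R / (2 * (1 + M / c)) * (1 + M / c)"
    using Mc_nonneg by (intro mult_right_mono) (auto simp: \<eta>_def)
  also have "\<dots> = R / 2"
  proof -
    have "R / (2 * S) * S = R / 2" if "S > 0" for S :: real using that by simp
    then show ?thesis using Mc_nonneg by (metis add_pos_nonneg zero_less_one)
  qed
  also have "\<dots> < R" using R by simp
  finally have \<eta>R: "\<eta> * (1 + M / c) < R" .
  have "\<eta> * (8 * (Ls + 1)) \<le> 1 / (8 * (Ls + 1)) * (8 * (Ls + 1))"
    using Ls by (intro mult_right_mono) (auto simp: \<eta>_def)
  also have "\<dots> = 1" using Ls by (simp add: divide_simps)
  finally have \<eta>L: "4 * Ls * (2 * \<eta>) \<le> 1" using \<eta> by (simp add: algebra_simps)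
  let ?P = "closest_point (cball x\<^sub>0 R)"
  let ?a = "x\<^sub>0 $ k - \<eta>" and ?b = "x\<^sub>0 $ k + \<eta>"
  have sl: "Ls-lipschitz_on UNIV (\<lambda>x. slope (?P x))" by (rule proj_lipschitz[OF slope_lipschitz])
  obtain \<gamma> where \<gamma>0: "\<gamma> (x\<^sub>0 $ k) = x\<^sub>0 $ l"
    and \<gamma>: "\<And>w. w \<in> {?a..?b} \<Longrightarrow> (\<gamma> has_vector_derivative slope (?P (pt w (\<gamma> w)))) (at w within {?a..?b})"
  proof (rule picard[of ?a "x\<^sub>0 $ k" ?b "\<lambda>w z. slope (?P (pt w z))" Ls "x\<^sub>0 $ l"])
    show "continuous_on ({?a..?b} \<times> UNIV) (\<lambda>(w, z). slope (?P (pt w z)))"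
    proof -
      have "pt w z = w *\<^sub>R axis k 1 + z *\<^sub>R axis l 1" for w z
        by (simp add: pt_def vec_eq_iff axis_def)
      then show ?thesis
        unfolding split_beta
        by (intro continuous_on_compose2[OF lipschitz_on_continuous_on[OF sl]])
           (auto intro!: continuous_intros)
    qed
    show "Ls-lipschitz_on UNIV (\<lambda>z. slope (?P (pt w z)))" for w
    proof (rule lipschitz_onI)
      fix z z'
      have "dist (pt w z) (pt w z') = dist z z'"
      proof -
        have "pt w z - pt w z' = axis l (z - z')" by (simp add: pt_def vec_eq_iff axis_def)
        then show ?thesis by (simp add: dist_norm norm_axis_real)
      qed
      then show "dist (slope (?P (pt w z))) (slope (?P (pt w z'))) \<le> Ls * dist z z'"
        using lipschitz_onD[OF sl, of "pt w z" "pt w z'"] by simp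
    qed (rule Ls)
  qed (use \<eta> \<eta>L in auto)
  have in_ball: "pt w (\<gamma> w) \<in> ball x\<^sub>0 R" if w: "w \<in> {?a..?b}" for w
  proof -
    have "norm (\<gamma> w - \<gamma> (x\<^sub>0 $ k)) \<le> M / c * norm (w - x\<^sub>0 $ k)"
      by (rule differentiable_bound[OF convex_real_interval(5) \<gamma>[unfolded has_vector_derivative_def] _ w])
         (use \<eta> slope_bound[OF proj_in] in \<open>auto intro: onorm_scaleR_right_le simp del: real_scaleR_def\<close>)
    also have "\<dots> \<le> M / c * \<eta>" using w Mc_nonneg by (intro mult_left_mono) auto
    finally have dist_l: "\<bar>\<gamma> w - x\<^sub>0 $ l\<bar> \<le> M / c * \<eta>" unfolding \<gamma>0 real_norm_def .
    have "norm (pt w (\<gamma> w) - x\<^sub>0) \<le> \<eta> + M / c * \<eta>"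
    proof -
      have "\<bar>w - x\<^sub>0 $ k\<bar> \<le> \<eta>" using w by auto
      with dist_l norm_le_abs_components[OF kl, of "pt w (\<gamma> w) - x\<^sub>0"]
      show ?thesis unfolding vector_minus_component pt_nth by linarith
    qed
    then show ?thesis using \<eta>R by (simp add: dist_norm norm_minus_commute algebra_simps)
  qed
  show ?thesis
  proof (rule that[OF \<eta> _ in_ball \<gamma>0])
    fix w assume w: "w \<in> {?a..?b}"
    have "?P (pt w (\<gamma> w)) = pt w (\<gamma> w)" using in_ball[OF w] by (intro closest_point_self) auto
    then show "(\<gamma> has_vector_derivative slope (pt w (\<gamma> w))) (at w within {?a..?b})"
      using \<gamma>[OF w] by simp
  qed
qed

end

section \<open>The integral curve through \<open>x\<^sub>0\<close> and small-time
  controllability\<close>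

locale planar_curve = planar_control f x\<^sub>0 R M L i\<^sub>0 k l c Ls
  for f :: "'m::finite \<Rightarrow> real ^ 2 \<Rightarrow> real ^ 2" and x\<^sub>0 :: "real ^ 2" and R M L :: real
    and i\<^sub>0 :: 'm and k l :: 2 and c Ls :: real +
  fixes \<eta> :: real and \<gamma> :: "real \<Rightarrow> real"
  assumes \<eta>: "\<eta> > 0"
    and \<gamma>: "\<And>w. w \<in> {x\<^sub>0 $ k - \<eta>..x\<^sub>0 $ k + \<eta>} \<Longrightarrow>
      (\<gamma> has_vector_derivative slope (pt w (\<gamma> w))) (at w within {x\<^sub>0 $ k - \<eta>..x\<^sub>0 $ k + \<eta>})"
    and \<gamma>_ball: "\<And>w. w \<in> {x\<^sub>0 $ k - \<eta>..x\<^sub>0 $ k + \<eta>} \<Longrightarrow> pt w (\<gamma> w) \<in> ball x\<^sub>0 R"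
    and \<gamma>_start: "\<gamma> (x\<^sub>0 $ k) = x\<^sub>0 $ l"
begin

abbreviation base :: "real set" where
  "base \<equiv> {x\<^sub>0 $ k - \<eta>..x\<^sub>0 $ k + \<eta>}"

definition \<phi> :: "real \<Rightarrow> real ^ 2" where
  "\<phi> w = pt w (\<gamma> w)"

lemma \<phi>_nth [simp]: "\<phi> w $ k = w" "\<phi> w $ l = \<gamma> w"
  by (simp_all add: \<phi>_def)

lemma \<phi>_start: "\<phi> (x\<^sub>0 $ k) = x\<^sub>0"
  by (rule vec2_eqI[OF kl]) (simp_all add: \<gamma>_start)

lemma \<phi>_ball: "w \<in> base \<Longrightarrow> \<phi> w \<in> ball x\<^sub>0 R"
  using \<gamma>_ball by (simp add: \<phi>_def)

lemma \<phi>_derivative: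
  assumes "w \<in> base"
  shows "(\<phi> has_vector_derivative (axis k 1 + slope (\<phi> w) *\<^sub>R axis l 1)) (at w within base)"
proof -
  have "\<phi> = (\<lambda>w. w *\<^sub>R axis k 1 + \<gamma> w *\<^sub>R axis l 1)"
    by (rule ext) (simp add: \<phi>_def pt_def vec_eq_iff axis_def)
  then show ?thesis
    using \<gamma>[OF assms] unfolding \<phi>_def[symmetric] has_real_derivative_iff_has_vector_derivative[symmetric]
    by (auto intro!: derivative_eq_intros)
qed

lemma \<gamma>_lipschitz: "(M / c)-lipschitz_on base \<gamma>"
proof (rule lipschitz_onI)
  fix v w assume vw: "v \<in> base" "w \<in> base"
  have "norm (\<gamma> v - \<gamma> w) \<le> M / c * norm (v - w)"
  proof (rule differentiable_bound[OF convex_real_interval(5) \<gamma>[unfolded has_vector_derivative_def] _ vw])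
    fix r assume "r \<in> base"
    then have "\<bar>slope (pt r (\<gamma> r))\<bar> \<le> M / c" using \<gamma>_ball[of r] by (intro slope_bound) auto
    then show "onorm (\<lambda>x. x *\<^sub>R slope (pt r (\<gamma> r))) \<le> M / c"
      by (intro onorm_scaleR_right_le) simp
  qed
  then show "dist (\<gamma> v) (\<gamma> w) \<le> M / c * dist v w" by (simp add: dist_norm)
qed (rule Mc_nonneg)

text \<open>The graph has tangent \<open>T\<close> with coordinates 1 and \<open>slope\<close>, and
  a zero defect means that the field is parallel to \<open>T\<close>. Hoermander's condition
  excludes this for all fields on an interval; \<open>T\<close> is differentiable because
  \<open>f i\<^sub>0\<close> is so along the curve.\<close>

lemma nonzero_defect_on_curve:
  assumes "a < b" "{a<..<b} \<subseteq> base"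
  shows "\<exists>w\<in>{a<..<b}. \<exists>j. defect j (\<phi> w) \<noteq> 0"
proof -
  define T where "T w = axis k (1::real) + slope (\<phi> w) *\<^sub>R axis l 1" for w
  have \<phi>d: "(\<phi> has_vector_derivative T w) (at w)" if w: "w \<in> {a<..<b}" for w
  proof -
    have "(\<phi> has_vector_derivative T w) (at w within {a<..<b})"
      unfolding T_def using assms w by (intro has_vector_derivative_within_subset[OF \<phi>_derivative]) auto
    then show ?thesis using at_within_open[OF w] by simp
  qed
  have "T differentiable (at w)" if w: "w \<in> {a<..<b}" for w
  proof -
    have "((\<lambda>w. f i\<^sub>0 (\<phi> w)) has_vector_derivative frechet_derivative (f i\<^sub>0) (at (\<phi> w)) (T w)) (at w)"
      by (rule has_vector_derivative_field_along_curve[OF smooth \<phi>d[OF w]])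
    then have d: "(\<lambda>w. f i\<^sub>0 (\<phi> w) $ r) differentiable (at w)" for r
      using bounded_linear.has_vector_derivative[OF bounded_linear_vec_nth] differentiableI_vector by blast
    have "f i\<^sub>0 (\<phi> w) $ k \<noteq> 0" using c(1) c(2)[of "\<phi> w"] \<phi>_ball[of w] assms(2) w by force
    then show ?thesis unfolding T_def slope_def using d
      by (intro derivative_intros) auto
  qed
  then have Td: "(T has_vector_derivative vector_derivative T (at w)) (at w)" if "w \<in> {a<..<b}" for w
    using that vector_derivative_works by blast
  have "\<exists>w\<in>{a<..<b}. \<exists>i. f i (\<phi> w) \<noteq> f i (\<phi> w) $ k *\<^sub>R T w"
    by (rule hoermander_not_parallel_along_curve[OF hoermander smooth _ _ kl \<phi>d Td])
       (use assms kl in \<open>auto simp: T_def axis_def\<close>)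
  then obtain w i where w: "w \<in> {a<..<b}" "f i (\<phi> w) \<noteq> f i (\<phi> w) $ k *\<^sub>R T w" by blast
  have "defect i (\<phi> w) \<noteq> 0"
  proof
    assume "defect i (\<phi> w) = 0"
    then have "f i (\<phi> w) = f i (\<phi> w) $ k *\<^sub>R T w"
      using kl by (intro vec2_eqI[OF kl]) (auto simp: T_def axis_def defect_def mult.commute)
    then show False using w by simp
  qed
  then show ?thesis using w by blast
qed

text \<open>The field \<open>f i\<^sub>0\<close> is rescaled so that the \<open>k\<close> coordinate
  moves at the constant speed \<open>c\<close>; since \<open>c\<close> bounds its \<open>k\<close>
  component from below, the factor has modulus at most 1.\<close>

lemma reach_along_curve:
  assumes "w \<in> base" "x\<^sub>0 $ k \<le> w"
  shows "reach f ((w - x\<^sub>0 $ k) / c) x\<^sub>0 (\<phi> w)"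
proof -
  define T where "T = (w - x\<^sub>0 $ k) / c"
  have T: "T \<ge> 0" "x\<^sub>0 $ k + c * T = w" using assms c by (auto simp: T_def)
  have arg: "x\<^sub>0 $ k + c * s \<in> base" if "s \<in> {0..T}" for s
  proof -
    have "0 \<le> c * s" "c * s \<le> c * T" using that c by auto
    then show ?thesis using T assms \<eta> by auto
  qed
  define y where "y s = \<phi> (x\<^sub>0 $ k + c * s)" for s
  define u where "u s = (c / f i\<^sub>0 (y s) $ k) *\<^sub>R axis i\<^sub>0 (1::real)" for s
  have yC: "y s \<in> cball x\<^sub>0 R" if "s \<in> {0..T}" for s
    using \<phi>_ball[OF arg[OF that]] by (auto simp: y_def)
  have nz: "f i\<^sub>0 (y s) $ k \<noteq> 0" if "s \<in> {0..T}" for s using c(1) c(2)[OF yC[OF that]] by auto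
  have der: "(y has_vector_derivative velocity f (u s) (y s)) (at s within {0..T})" if s: "s \<in> {0..T}" for s
  proof -
    have "((\<lambda>s. x\<^sub>0 $ k + c * s) has_vector_derivative c) (at s within {0..T})"
      by (auto intro!: derivative_eq_intros)
    moreover have "(\<phi> has_vector_derivative (axis k 1 + slope (y s) *\<^sub>R axis l 1))
        (at (x\<^sub>0 $ k + c * s) within (\<lambda>s. x\<^sub>0 $ k + c * s) ` {0..T})"
      using \<phi>_derivative[OF arg[OF s]] arg unfolding y_def
      by (intro has_vector_derivative_within_subset[where T = "(\<lambda>s. x\<^sub>0 $ k + c * s) ` {0..T}"]) auto
    ultimately have "(y has_vector_derivative c *\<^sub>R (axis k 1 + slope (y s) *\<^sub>R axis l 1)) (at s within {0..T})"
      using vector_diff_chain_within unfolding y_def o_def[symmetric] by (fastforce simp: o_def)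
    moreover have "velocity f (u s) (y s) = c *\<^sub>R (axis k 1 + slope (y s) *\<^sub>R axis l 1)"
    proof -
      have "u s = axis i\<^sub>0 (c / f i\<^sub>0 (y s) $ k)" by (simp add: u_def vec_eq_iff axis_def)
      then have "velocity f (u s) (y s) = (c / f i\<^sub>0 (y s) $ k) *\<^sub>R f i\<^sub>0 (y s)"
        by (simp only: velocity_axis)
      then show ?thesis using nz[OF s] kl
        by (intro vec2_eqI[OF kl]) (auto simp: axis_def slope_def)
    qed
    ultimately show ?thesis by simp
  qed
  have cy: "continuous_on {0..T} y"
    using der unfolding has_vector_derivative_def by (rule has_derivative_continuous_on)
  have "continuous_on {0..T} u"
    unfolding u_def using nz by (intro continuous_intros continuous_on_compose2[OF f cy]) auto
  moreover have "norm (u s) \<le> 1" if "s \<in> {0..T}" for s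
    using c(1) c(2)[OF yC[OF that]] nz[OF that] by (simp add: u_def norm_axis_1 divide_simps)
  ultimately have "reach f T (y 0) (y T)" using reach_C1[OF f T(1) der] by blast
  then show ?thesis using T by (simp add: y_def \<phi>_start T_def)
qed

text \<open>Both \<open>p\<close> and \<open>q\<close> track the piece of curve from
  \<open>x\<^sub>0\<close> to a nearby point \<open>\<phi> w\<close> of full rank. The route is the
  track of \<open>p\<close>, a steered segment near \<open>\<phi> w\<close>, and the track of
  \<open>q\<close> backwards.\<close>

lemma small_time_controllable:
  assumes \<tau>: "\<tau> > 0"
  obtains r where "r > 0" "\<And>p q. p \<in> ball x\<^sub>0 r \<Longrightarrow> q \<in> ball x\<^sub>0 r \<Longrightarrow> \<exists>t<\<tau>. reach f t p q"
proof -
  let ?N = "real CARD('m)"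
  have NL: "?N * L \<ge> 0" and NM: "?N * M \<ge> 0" using L_nonneg M_nonneg by auto
  \<comment> \<open>Each of the two tracking legs gets a quarter of \<tau>; the next two bounds are
    the hypotheses of \<open>tracking\<close>, and \<open>\<eta> / c\<close> keeps the point within
    the domain of the curve.\<close>
  define s where "s = Min {\<tau> / 4, 1 / (4 * (?N * L + 1)), R / (4 * (?N * M + 1)), \<eta> / c}"
  have s: "s > 0" "s \<le> \<tau> / 4" "s \<le> 1 / (4 * (?N * L + 1))" "s \<le> R / (4 * (?N * M + 1))" "s \<le> \<eta> / c"
  proof -
    show "s > 0" using \<tau> NL NM R \<eta> c
      by (auto simp: s_def intro!: divide_pos_pos add_nonneg_pos)
  qed (unfold s_def, (rule Min_le; simp)+)
  have cs: "c * s > 0" "c * s \<le> \<eta>" using s c by (auto simp: field_simps)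
  obtain w j where w: "w \<in> {x\<^sub>0 $ k<..<x\<^sub>0 $ k + c * s}" "defect j (\<phi> w) \<noteq> 0"
    using nonzero_defect_on_curve[of "x\<^sub>0 $ k" "x\<^sub>0 $ k + c * s"] cs by fastforce
  have wb: "w \<in> base" using w cs \<eta> by auto
  define T where "T = (w - x\<^sub>0 $ k) / c"
  have T: "T > 0" "T < s" using w c by (auto simp: T_def field_simps)
  have T2: "4 * (?N * L) * T \<le> 1"
  proof -
    have "4 * (?N * L) * T \<le> 4 * (?N * L + 1) * (1 / (4 * (?N * L + 1)))"
      using T s NL by (intro mult_mono) auto
    also have "\<dots> = 1" using NL by (simp add: divide_simps)
    finally show ?thesis .
  qed
  have T3: "?N * M * T < R / 2"
  proof -
    have "?N * M * T \<le> (?N * M + 1) * (R / (4 * (?N * M + 1)))"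
      using T s NM by (intro mult_mono) auto
    also have "\<dots> = R / 4" using NM by (simp add: divide_simps)
    finally show ?thesis using R by simp
  qed
  define \<epsilon> where "\<epsilon> = \<bar>defect j (\<phi> w)\<bar> / 2"
  have \<epsilon>: "\<epsilon> > 0" using w by (simp add: \<epsilon>_def)
  have "\<exists>\<rho>>0. \<forall>z\<in>ball (\<phi> w) \<rho>. z \<in> cball x\<^sub>0 R \<and> \<epsilon> \<le> \<bar>defect j z\<bar>"
  proof -
    obtain \<rho>1 where \<rho>1: "\<rho>1 > 0" "ball (\<phi> w) \<rho>1 \<subseteq> ball x\<^sub>0 R"
      using \<phi>_ball[OF wb] open_contains_ball open_ball by blast
    obtain \<rho>2 where \<rho>2: "\<rho>2 > 0"
      "\<And>z. z \<in> cball x\<^sub>0 R \<Longrightarrow> dist z (\<phi> w) < \<rho>2 \<Longrightarrow> dist (defect j z) (defect j (\<phi> w)) < \<epsilon>"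
      using continuous_defect[of j] \<epsilon> \<phi>_ball[OF wb] unfolding continuous_on_iff
      by (metis ball_subset_cball subsetD)
    have "z \<in> cball x\<^sub>0 R \<and> \<epsilon> \<le> \<bar>defect j z\<bar>" if z: "z \<in> ball (\<phi> w) (min \<rho>1 \<rho>2)" for z
    proof
      show zC: "z \<in> cball x\<^sub>0 R" using z \<rho>1 by auto
      have "dist (defect j z) (defect j (\<phi> w)) < \<epsilon>" using \<rho>2(2)[OF zC] z by (auto simp: dist_commute)
      then show "\<epsilon> \<le> \<bar>defect j z\<bar>" unfolding \<epsilon>_def dist_real_def by linarith
    qed
    then show ?thesis using \<rho>1(1) \<rho>2(1) by (intro exI[of _ "min \<rho>1 \<rho>2"]) auto
  qed
  then obtain \<rho>' where \<rho>': "\<rho>' > 0" "\<And>z. z \<in> ball (\<phi> w) \<rho>' \<Longrightarrow> z \<in> cball x\<^sub>0 R \<and> \<epsilon> \<le> \<bar>defect j z\<bar>"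
    by blast
  let ?C = "steer_const \<epsilon>"
  have C: "?C > 0" using steer_const_pos[OF \<epsilon>] .
  \<comment> \<open>Two points of this ball are less than \<open>2 * \<rho>\<close> apart, so
    steering between them costs at most \<open>\<tau> / 4\<close>.\<close>
  define \<rho> where "\<rho> = min \<rho>' (\<tau> / (8 * ?C))"
  have \<rho>: "\<rho> > 0" "\<rho> \<le> \<rho>'" "?C * (2 * \<rho>) \<le> \<tau> / 4"
    using \<rho>' \<tau> C by (auto simp: \<rho>_def min_def field_simps)
  \<comment> \<open>With tracking error \<open>\<rho> / 2\<close>, the bound
    \<open>\<rho> / 8\<close> brings the tracks within \<open>\<rho> * 3 / 4\<close> of
    \<open>\<phi> w\<close>.\<close>
  define r where "r = min (R / 2) (\<rho> / 8)"
  have r: "r > 0" "r \<le> R / 2" "r \<le> \<rho> / 8" using R \<rho> by (auto simp: r_def)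
  obtain u y where u: "is_control u" and y: "solution_on f u x\<^sub>0 T y" "y T = \<phi> w"
    using reach_along_curve[OF wb] w unfolding reach_def T_def by auto
  have track: "\<exists>z. reach f T p z \<and> reach f T z p \<and> z \<in> ball (\<phi> w) \<rho>" if p: "p \<in> ball x\<^sub>0 r" for p
  proof -
    obtain z where z: "reach f T p z" "reach f T z p" "dist z (y T) \<le> 2 * dist x\<^sub>0 p + \<rho> / 2"
      using tracking[of x\<^sub>0 p T u y "\<rho> / 2"] R p r T T2 T3 u y \<rho> by auto
    then have "dist (\<phi> w) z < \<rho>" using p r \<rho>(1) y(2) by (simp add: dist_commute)
    then show ?thesis using z by auto
  qed
  show ?thesis
  proof (rule that[OF r(1)])
    fix p q assume pq: "p \<in> ball x\<^sub>0 r" "q \<in> ball x\<^sub>0 r"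
    obtain p' where p': "reach f T p p'" "p' \<in> ball (\<phi> w) \<rho>" using track[OF pq(1)] by blast
    obtain q' where q': "reach f T q' q" "q' \<in> ball (\<phi> w) \<rho>" using track[OF pq(2)] by blast
    have seg: "closed_segment p' q' \<subseteq> ball (\<phi> w) \<rho>'"
      using p' q' \<rho>(2) by (intro closed_segment_subset) auto
    have "reach f (?C * dist p' q') p' q'"
      using seg \<rho>'(2) by (intro steering[OF \<epsilon>]) blast+
    then have "reach f (T + ?C * dist p' q' + T) p q"
      using reach_trans[of f, OF f] p' q' by blast
    moreover have "?C * dist p' q' \<le> ?C * (2 * \<rho>)"
      using p' q' C dist_triangle[of p' q' "\<phi> w"] by (intro mult_left_mono) (auto simp: dist_commute)
    then have "T + ?C * dist p' q' + T < \<tau>" using T s \<rho> \<tau> by linarith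
    ultimately show "\<exists>t<\<tau>. reach f t p q" by blast
  qed
qed

end

section \<open>Trajectories that stay near the degenerate set\<close>

lemma lipschitz_on_mult_interval:
  fixes g h :: "real \<Rightarrow> real"
  assumes g: "A-lipschitz_on {a..b} g" and h: "B-lipschitz_on {a..b} h"
  shows "\<exists>C. C-lipschitz_on {a..b} (\<lambda>t. g t * h t)"
proof -
  have "\<exists>m. \<forall>t\<in>{a..b}. \<bar>k t\<bar> \<le> m" if "D-lipschitz_on {a..b} k" for D and k :: "real \<Rightarrow> real"
  proof -
    have "compact (k ` {a..b})"
      by (intro compact_continuous_image lipschitz_on_continuous_on[OF that] compact_Icc)
    from compact_imp_bounded[OF this] show ?thesis by (auto simp: bounded_iff)
  qed
  then obtain m m' where m: "\<And>t. t \<in> {a..b} \<Longrightarrow> \<bar>g t\<bar> \<le> m" "\<And>t. t \<in> {a..b} \<Longrightarrow> \<bar>h t\<bar> \<le> m'"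
    using g h by meson
  have "(\<bar>m\<bar> * B + \<bar>m'\<bar> * A)-lipschitz_on {a..b} (\<lambda>t. g t * h t)"
  proof (rule lipschitz_onI)
    fix s t assume st: "s \<in> {a..b}" "t \<in> {a..b}"
    have "\<bar>g s * h s - g t * h t\<bar> = \<bar>g s * (h s - h t) + h t * (g s - g t)\<bar>"
      by (simp add: algebra_simps)
    also have "\<dots> \<le> \<bar>g s\<bar> * \<bar>h s - h t\<bar> + \<bar>h t\<bar> * \<bar>g s - g t\<bar>"
      by (metis abs_mult abs_triangle_ineq)
    also have "\<dots> \<le> \<bar>m\<bar> * (B * dist s t) + \<bar>m'\<bar> * (A * dist s t)"
      using m[OF st(1)] m[OF st(2)] lipschitz_onD[OF g st] lipschitz_onD[OF h st]
      by (intro add_mono mult_mono) (auto simp: dist_real_def)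
    finally show "dist (g s * h s) (g t * h t) \<le> (\<bar>m\<bar> * B + \<bar>m'\<bar> * A) * dist s t"
      by (simp add: dist_real_def algebra_simps)
  qed (use lipschitz_on_nonneg[OF g] lipschitz_on_nonneg[OF h] in simp)
  then show ?thesis by blast
qed

text \<open>A sign of the derivative almost everywhere suffices because a Lipschitz function is the
  integral of its derivative.\<close>

lemma lipschitz_nonincreasing:
  fixes h :: "real \<Rightarrow> real"
  assumes h: "B-lipschitz_on {a..b} h" and N: "negligible N" and ab: "a \<le> b"
    and der: "\<And>t. a < t \<Longrightarrow> t < b \<Longrightarrow> t \<notin> N \<Longrightarrow> \<exists>d\<le>0. (h has_real_derivative d) (at t)"
  shows "h b \<le> h a"
proof -
  obtain d where d: "\<And>t. a < t \<Longrightarrow> t < b \<Longrightarrow> t \<notin> N \<Longrightarrow> d t \<le> 0 \<and> (h has_real_derivative d t) (at t)"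
    using der by metis
  let ?N = "N \<union> {a, b}"
  define g where "g t = (if t \<in> {a..b} - ?N then d t else 0)" for t
  have "(g has_integral h b - h a) {a..b}"
  proof (rule abs_continuous_has_integral[OF ab lipschitz_imp_abs_continuous_on[OF h]])
    show "negligible ?N" using N by (intro negligible_Un) auto
    fix t assume t: "t \<in> {a..b} - ?N"
    then have "(h has_vector_derivative d t) (at t within {a..b})"
      using d[of t] by (auto simp: has_real_derivative_iff_has_vector_derivative intro: has_vector_derivative_at_within)
    then show "(h has_vector_derivative g t) (at t within {a..b})" using t by (simp add: g_def)
  qed
  from has_integral_neg[OF this] have "0 \<le> - (h b - h a)"
    by (rule has_integral_nonneg) (use d in \<open>auto simp: g_def\<close>)
  then show ?thesis by simp
qed

text \<open>Squaring avoids differentiating the absolute value. As \<open>2 * a * (a + \<epsilon>)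
  \<le> 4 * (a\<^sup>2 + \<epsilon>\<^sup>2)\<close>, the quantity
  \<open>d\<^sup>2 + \<epsilon>\<^sup>2\<close> grows at most at rate \<open>4 * K\<close>, and the
  exponential weight makes it nonincreasing.\<close>

lemma gronwall_square:
  fixes d :: "real \<Rightarrow> real"
  assumes d: "B-lipschitz_on {0..T} d" and N: "negligible N" and T: "0 \<le> T" and K: "0 \<le> K"
    and der: "\<And>t. 0 < t \<Longrightarrow> t < T \<Longrightarrow> t \<notin> N \<Longrightarrow>
      \<exists>d'. (d has_real_derivative d') (at t) \<and> \<bar>d'\<bar> \<le> K * (\<bar>d t\<bar> + \<epsilon>)"
  shows "(d T)\<^sup>2 \<le> ((d 0)\<^sup>2 + \<epsilon>\<^sup>2) * exp (4 * K * T)"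
proof -
  define H where "H t = ((d t)\<^sup>2 + \<epsilon>\<^sup>2) * exp (- 4 * K * t)" for t
  obtain C1 where C1: "C1-lipschitz_on {0..T} (\<lambda>t. d t * d t)"
    using lipschitz_on_mult_interval[OF d d] by blast
  then have C2: "C1-lipschitz_on {0..T} (\<lambda>t. (d t)\<^sup>2 + \<epsilon>\<^sup>2)"
    unfolding lipschitz_on_def by (simp add: dist_real_def power2_eq_square)
  have "(4 * K)-lipschitz_on {0..T} (\<lambda>t. exp (- 4 * K * t))"
  proof (rule lipschitz_onI)
    fix s t assume st: "s \<in> {0..T}" "t \<in> {0..T}"
    have "norm (exp (- 4 * K * s) - exp (- 4 * K * t)) \<le> (4 * K) * norm (s - t)"
    proof (rule field_differentiable_bound[OF convex_real_interval(5) _ _ st])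
      fix r assume "r \<in> {0..T}"
      then show "norm (- (4 * K) * exp (- 4 * K * r)) \<le> 4 * K"
        using K by (simp add: abs_mult mult_left_le)
      show "((\<lambda>r. exp (- 4 * K * r)) has_field_derivative - (4 * K) * exp (- 4 * K * r)) (at r within {0..T})"
        by (auto intro!: derivative_eq_intros)
    qed
    then show "dist (exp (- 4 * K * s)) (exp (- 4 * K * t)) \<le> 4 * K * dist s t" by (simp add: dist_norm)
  qed (use K in simp)
  from lipschitz_on_mult_interval[OF C2 this] obtain C where C: "C-lipschitz_on {0..T} H"
    unfolding H_def by blast
  have "H T \<le> H 0"
  proof (rule lipschitz_nonincreasing[OF C N T])
    fix t assume t: "0 < t" "t < T" "t \<notin> N"
    obtain d' where d': "(d has_real_derivative d') (at t)" "\<bar>d'\<bar> \<le> K * (\<bar>d t\<bar> + \<epsilon>)"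
      using der[OF t] by blast
    have "2 * (d t * d') \<le> 2 * (\<bar>d t\<bar> * \<bar>d'\<bar>)" by (metis abs_ge_self abs_mult mult_left_mono zero_le_numeral)
    also have "\<dots> \<le> 2 * (\<bar>d t\<bar> * (K * (\<bar>d t\<bar> + \<epsilon>)))" using d'(2) by (intro mult_left_mono) auto
    also have "\<dots> = K * (2 * \<bar>d t\<bar> * (\<bar>d t\<bar> + \<epsilon>))" by simp
    also have "\<dots> \<le> K * (4 * ((d t)\<^sup>2 + \<epsilon>\<^sup>2))"
    proof (rule mult_left_mono[OF _ K])
      have "2 * a * (a + \<epsilon>) \<le> 4 * (a\<^sup>2 + \<epsilon>\<^sup>2)" for a :: real
      proof -
        have "0 \<le> (a - \<epsilon>)\<^sup>2" "0 \<le> a\<^sup>2" "0 \<le> \<epsilon>\<^sup>2" by auto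
        moreover have "4 * (a\<^sup>2 + \<epsilon>\<^sup>2) - 2 * a * (a + \<epsilon>) = (a - \<epsilon>)\<^sup>2 + a\<^sup>2 + 3 * \<epsilon>\<^sup>2"
          by (simp add: power2_eq_square algebra_simps)
        ultimately show ?thesis by linarith
      qed
      from this[of "\<bar>d t\<bar>"] show "2 * \<bar>d t\<bar> * (\<bar>d t\<bar> + \<epsilon>) \<le> 4 * ((d t)\<^sup>2 + \<epsilon>\<^sup>2)" by simp
    qed
    also have "\<dots> = 4 * K * ((d t)\<^sup>2 + \<epsilon>\<^sup>2)" by simp
    finally have *: "2 * (d t * d') - 4 * K * ((d t)\<^sup>2 + \<epsilon>\<^sup>2) \<le> 0" by (simp only: diff_le_0_iff_le)
    have "(H has_real_derivative (2 * (d t * d') - 4 * K * ((d t)\<^sup>2 + \<epsilon>\<^sup>2)) * exp (- 4 * K * t)) (at t)"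
      unfolding H_def
      by (auto intro!: derivative_eq_intros d'(1) simp: algebra_simps power2_eq_square)
    moreover have "(2 * (d t * d') - 4 * K * ((d t)\<^sup>2 + \<epsilon>\<^sup>2)) * exp (- 4 * K * t) \<le> 0"
      using * by (intro mult_nonpos_nonneg) auto
    ultimately show "\<exists>d\<le>0. (H has_real_derivative d) (at t)" by blast
  qed
  then have "(d T)\<^sup>2 + \<epsilon>\<^sup>2 \<le> ((d 0)\<^sup>2 + \<epsilon>\<^sup>2) * exp (4 * K * T)"
    by (simp add: H_def exp_minus field_simps)
  then show ?thesis by (smt (verit) zero_le_power2)
qed

lemma solution_on_restrict:
  assumes "solution_on f u x T y" "s \<le> T"
  shows "solution_on f u x s y"
proof -
  obtain N where N: "y 0 = x" "abs_continuous_on 0 T y" "negligible N"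
    "\<And>t. t \<in> {0..T} - N \<Longrightarrow> (y has_vector_derivative velocity f (u t) (y t)) (at t within {0..T})"
    using assms(1) unfolding solution_on_iff_negligible by blast
  have "abs_continuous_on 0 s y" using abs_continuous_on_subset[OF N(2) order_refl assms(2)] .
  moreover have "(y has_vector_derivative velocity f (u t) (y t)) (at t within {0..s})" if "t \<in> {0..s} - N" for t
    using that assms(2) by (intro has_vector_derivative_within_subset[OF N(4)]) auto
  ultimately show ?thesis unfolding solution_on_iff_negligible using N by blast
qed

context planar_curve
begin

text \<open>The end point of the curve has \<open>k\<close> displacement exactly \<eta> and lies in
  the open ball.\<close>

lemma \<eta>_less_R: "\<eta> < R"
proof -
  have "\<phi> (x\<^sub>0 $ k + \<eta>) \<in> ball x\<^sub>0 R" using \<phi>_ball[of "x\<^sub>0 $ k + \<eta>"] \<eta> by auto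
  then have "norm (\<phi> (x\<^sub>0 $ k + \<eta>) - x\<^sub>0) < R" by (simp add: dist_norm norm_minus_commute)
  then show ?thesis
    using component_le_norm_cart[of "\<phi> (x\<^sub>0 $ k + \<eta>) - x\<^sub>0" k] by simp
qed

text \<open>
  The vertical distance \<open>d\<close> from a trajectory to the integral curve obeys a linear differential
  inequality whose inhomogeneity is the defect, since \<open>y\<^sub>l' - slope(y) y\<^sub>k'\<close> only sees the
  component of the velocity transversal to \<open>f i\<^sub>0\<close>.
\<close>

lemma distance_to_curve:
  assumes u: "is_control u" and y: "solution_on f u x T y" and T: "0 \<le> T"
    and yb: "\<And>t. t \<in> {0..T} \<Longrightarrow> y t \<in> ball x\<^sub>0 \<eta>"
    and small: "\<And>t j. t \<in> {0..T} \<Longrightarrow> \<bar>defect j (y t)\<bar> \<le> \<epsilon>"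
  shows "(y T $ l - \<gamma> (y T $ k))\<^sup>2 \<le>
    ((x $ l - \<gamma> (x $ k))\<^sup>2 + \<epsilon>\<^sup>2) * exp (4 * (CARD('m) * (1 + Ls * M)) * T)"
proof -
  let ?N = "real CARD('m)"
  have Ls: "Ls \<ge> 0" using slope_lipschitz by (rule lipschitz_on_nonneg)
  have \<epsilon>: "\<epsilon> \<ge> 0" using small[of 0 undefined] T by fastforce
  define d where "d t = y t $ l - \<gamma> (y t $ k)" for t
  have yk: "\<bar>y t $ k - x\<^sub>0 $ k\<bar> < \<eta>" if "t \<in> {0..T}" for t
    using yb[OF that] component_le_norm_cart[of "y t - x\<^sub>0" k]
    by (simp add: dist_norm norm_minus_commute)
  have ybase: "y t $ k \<in> base" if "t \<in> {0..T}" for t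
    using yk[OF that] by (simp add: abs_less_iff)
  have yC: "y t \<in> cball x\<^sub>0 R" if "t \<in> {0..T}" for t
    using yb[OF that] \<eta>_less_R by auto
  obtain B where B: "B-lipschitz_on {0..T} y" using solution_on_lipschitz[OF f u y] by blast
  have comp: "B-lipschitz_on {0..T} (\<lambda>t. y t $ i)" for i
    using lipschitz_onD[OF B] lipschitz_on_nonneg[OF B]
    by (intro lipschitz_onI) (auto intro: order_trans[OF dist_vec_nth_le])
  have dl: "(B + M / c * B)-lipschitz_on {0..T} d"
    unfolding d_def
  proof (intro lipschitz_on_diff comp lipschitz_on_compose2[of B "{0..T}" "\<lambda>t. y t $ k" "M / c"])
    show "(M / c)-lipschitz_on ((\<lambda>t. y t $ k) ` {0..T}) \<gamma>"
      using \<gamma>_lipschitz by (rule lipschitz_on_subset) (use ybase in auto)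
  qed
  obtain N where N: "negligible N"
    "\<And>t. 0 < t \<Longrightarrow> t < T \<Longrightarrow> t \<notin> N \<Longrightarrow> (y has_vector_derivative velocity f (u t) (y t)) (at t)"
    using solution_onD[OF y] by blast
  have "(d T)\<^sup>2 \<le> ((d 0)\<^sup>2 + \<epsilon>\<^sup>2) * exp (4 * (?N * (1 + Ls * M)) * T)"
  proof (rule gronwall_square[OF dl N(1) T])
    show "0 \<le> ?N * (1 + Ls * M)" using Ls M_nonneg by (intro mult_nonneg_nonneg add_nonneg_nonneg) auto
    fix t assume t: "0 < t" "t < T" "t \<notin> N"
    then have tT: "t \<in> {0..T}" by auto
    define v where "v = velocity f (u t) (y t)"
    have u1: "norm (u t) \<le> 1" using is_control_norm[OF u] t by simp
    have yd: "((\<lambda>t. y t $ i) has_real_derivative v $ i) (at t)" for i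
      unfolding v_def has_real_derivative_iff_has_vector_derivative
      by (rule bounded_linear.has_vector_derivative[OF bounded_linear_vec_nth N(2)[OF t]])
    have "(\<gamma> has_real_derivative slope (\<phi> (y t $ k))) (at (y t $ k))"
    proof -
      have "x\<^sub>0 $ k - \<eta> < y t $ k" "y t $ k < x\<^sub>0 $ k + \<eta>" using yk[OF tT] by (auto simp: abs_less_iff)
      then show ?thesis
        using \<gamma>[OF ybase[OF tT]] unfolding \<phi>_def has_real_derivative_iff_has_vector_derivative
        by (simp add: at_within_Icc_at)
    qed
    from DERIV_diff[OF yd[of l] DERIV_chain2[OF this yd]]
    have "(d has_real_derivative v $ l - slope (\<phi> (y t $ k)) * v $ k) (at t)"
      unfolding d_def .
    moreover have "\<bar>v $ l - slope (\<phi> (y t $ k)) * v $ k\<bar> \<le> ?N * (1 + Ls * M) * (\<bar>d t\<bar> + \<epsilon>)"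
    proof -
      have "v $ l - slope (y t) * v $ k = (\<Sum>j\<in>UNIV. u t $ j * defect j (y t))"
        unfolding v_def velocity_def defect_def
        by (simp add: sum_distrib_left sum_subtractf right_diff_distrib mult_ac)
      also have "\<bar>\<dots>\<bar> \<le> (\<Sum>j\<in>(UNIV :: 'm set). \<epsilon>)"
      proof (intro order_trans[OF sum_abs] sum_mono)
        fix j
        have "\<bar>u t $ j\<bar> \<le> 1" using component_le_norm_cart[of "u t" j] u1 by linarith
        then have "\<bar>u t $ j\<bar> * \<bar>defect j (y t)\<bar> \<le> 1 * \<epsilon>"
          using small[OF tT] by (intro mult_mono) auto
        then show "\<bar>u t $ j * defect j (y t)\<bar> \<le> \<epsilon>" by (simp add: abs_mult)
      qed
      finally have 1: "\<bar>v $ l - slope (y t) * v $ k\<bar> \<le> ?N * \<epsilon>" by simp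
      \<comment> \<open>The comparison point shares the \<open>k\<close> coordinate of
        \<open>y t\<close>, so only the vertical distance remains.\<close>
      have "dist (y t) (\<phi> (y t $ k)) \<le> \<bar>d t\<bar>"
        using norm_le_abs_components[OF kl, of "y t - \<phi> (y t $ k)"] by (simp add: dist_norm d_def)
      then have "\<bar>slope (y t) - slope (\<phi> (y t $ k))\<bar> \<le> Ls * \<bar>d t\<bar>"
        using lipschitz_onD[OF slope_lipschitz yC[OF tT], of "\<phi> (y t $ k)"] \<phi>_ball[OF ybase[OF tT]] Ls
        by (auto simp: dist_real_def intro: order_trans mult_left_mono)
      moreover have "\<bar>v $ k\<bar> \<le> ?N * M"
        using norm_velocity_ball[OF yC[OF tT] u1] component_le_norm_cart[of v k] by (simp add: v_def)
      ultimately have "\<bar>(slope (y t) - slope (\<phi> (y t $ k))) * v $ k\<bar> \<le> Ls * \<bar>d t\<bar> * (?N * M)"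
        unfolding abs_mult using Ls by (intro mult_mono) auto
      with 1 have "\<bar>v $ l - slope (\<phi> (y t $ k)) * v $ k\<bar> \<le> ?N * \<epsilon> + Ls * \<bar>d t\<bar> * (?N * M)"
        unfolding left_diff_distrib by linarith
      also have "\<dots> \<le> ?N * (1 + Ls * M) * (\<bar>d t\<bar> + \<epsilon>)"
      proof -
        have "0 \<le> ?N * (Ls * M) * \<epsilon>" "0 \<le> ?N * \<bar>d t\<bar>" using Ls M_nonneg \<epsilon> by simp_all
        then show ?thesis by (simp add: algebra_simps)
      qed
      finally show ?thesis .
    qed
    ultimately show "\<exists>d'. (d has_real_derivative d') (at t) \<and> \<bar>d'\<bar> \<le> ?N * (1 + Ls * M) * (\<bar>d t\<bar> + \<epsilon>)"
      by blast
  qed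
  moreover have "y 0 = x" using y by (simp add: solution_on_def)
  ultimately show ?thesis by (simp add: d_def)
qed

lemma nonzero_defect_near_curve:
  assumes "w \<in> base" "defect j (\<phi> w) \<noteq> 0"
  obtains \<kappa> \<epsilon> where "\<kappa> > 0" "\<epsilon> > 0" "\<And>z. z \<in> cball x\<^sub>0 R \<Longrightarrow> dist z (\<phi> w) < \<kappa> \<Longrightarrow> \<epsilon> < \<bar>defect j z\<bar>"
proof -
  define \<epsilon> where "\<epsilon> = \<bar>defect j (\<phi> w)\<bar> / 2"
  have \<epsilon>: "\<epsilon> > 0" using assms by (simp add: \<epsilon>_def)
  have "\<phi> w \<in> cball x\<^sub>0 R" using \<phi>_ball[OF assms(1)] by simp
  then obtain \<kappa> where \<kappa>: "\<kappa> > 0"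
    "\<And>z. z \<in> cball x\<^sub>0 R \<Longrightarrow> dist z (\<phi> w) < \<kappa> \<Longrightarrow> dist (defect j z) (defect j (\<phi> w)) < \<epsilon>"
    using continuous_defect[of j] \<epsilon> unfolding continuous_on_iff by metis
  have "\<epsilon> < \<bar>defect j z\<bar>" if "z \<in> cball x\<^sub>0 R" "dist z (\<phi> w) < \<kappa>" for z
    using \<kappa>(2)[OF that] unfolding \<epsilon>_def dist_real_def by linarith
  then show ?thesis using that \<kappa>(1) \<epsilon> by blast
qed

text \<open>
  A trajectory along which all defects stay small follows the integral curve, on both sides of
  \<open>x\<^sub>0\<close> is blocked by a point of nonzero defect, and hence makes no progress.
\<close>

lemma trapped:
  assumes \<tau>: "\<tau> > 0" "CARD('m) * M * \<tau> < \<eta> / 2" and r1: "r1 > 0"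
  obtains r \<epsilon> where "r > 0" "\<epsilon> > 0"
    "\<And>x u y. x \<in> ball x\<^sub>0 r \<Longrightarrow> is_control u \<Longrightarrow> solution_on f u x \<tau> y \<Longrightarrow>
      (\<And>t j. t \<in> {0..\<tau>} \<Longrightarrow> \<bar>defect j (y t)\<bar> \<le> \<epsilon>) \<Longrightarrow> y \<tau> \<in> ball x\<^sub>0 r1"
proof -
  let ?a = "x\<^sub>0 $ k"
  define S where "S = 1 + M / c"
  have S: "S \<ge> 1" using Mc_nonneg by (simp add: S_def)
  \<comment> \<open>The barriers are placed so close to \<open>x\<^sub>0\<close> that the curve
    between them stays within \<open>r1 / 2\<close> of it; the remaining room is for
    \<kappa>.\<close>
  define \<eta>' where "\<eta>' = min \<eta> (r1 / (2 * S))"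
  have \<eta>': "\<eta>' > 0" "\<eta>' \<le> \<eta>" "S * \<eta>' \<le> r1 / 2"
  proof -
    show "\<eta>' > 0" "\<eta>' \<le> \<eta>" using \<eta> r1 S by (auto simp: \<eta>'_def)
    have "S * \<eta>' \<le> S * (r1 / (2 * S))" using S by (intro mult_left_mono) (auto simp: \<eta>'_def)
    also have "\<dots> = r1 / 2" using S by simp
    finally show "S * \<eta>' \<le> r1 / 2" .
  qed
  obtain w1 j1 where w1: "w1 \<in> {?a<..<?a + \<eta>'}" "defect j1 (\<phi> w1) \<noteq> 0"
    using nonzero_defect_on_curve[of ?a "?a + \<eta>'"] \<eta>' by fastforce
  obtain w2 j2 where w2: "w2 \<in> {?a - \<eta>'<..<?a}" "defect j2 (\<phi> w2) \<noteq> 0"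
    using nonzero_defect_on_curve[of "?a - \<eta>'" ?a] \<eta>' by fastforce
  have wb: "w1 \<in> base" "w2 \<in> base" using w1 w2 \<eta>' by auto
  obtain \<kappa>1 \<epsilon>1 where 1: "\<kappa>1 > 0" "\<epsilon>1 > 0"
    "\<And>z. z \<in> cball x\<^sub>0 R \<Longrightarrow> dist z (\<phi> w1) < \<kappa>1 \<Longrightarrow> \<epsilon>1 < \<bar>defect j1 z\<bar>"
    using nonzero_defect_near_curve[OF wb(1) w1(2)] by metis
  obtain \<kappa>2 \<epsilon>2 where 2: "\<kappa>2 > 0" "\<epsilon>2 > 0"
    "\<And>z. z \<in> cball x\<^sub>0 R \<Longrightarrow> dist z (\<phi> w2) < \<kappa>2 \<Longrightarrow> \<epsilon>2 < \<bar>defect j2 z\<bar>"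
    using nonzero_defect_near_curve[OF wb(2) w2(2)] by metis
  define \<kappa> where "\<kappa> = Min {\<kappa>1, \<kappa>2, r1 / 4}"
  have \<kappa>: "\<kappa> > 0" "\<kappa> \<le> \<kappa>1" "\<kappa> \<le> \<kappa>2" "\<kappa> \<le> r1 / 4" using 1 2 r1 by (auto simp: \<kappa>_def)
  define G where "G = exp (4 * (CARD('m) * (1 + Ls * M)) * \<tau>)"
  have Ls: "Ls \<ge> 0" using slope_lipschitz by (rule lipschitz_on_nonneg)
  have K: "0 \<le> 4 * (CARD('m) * (1 + Ls * M))"
    using Ls M_nonneg by (intro mult_nonneg_nonneg add_nonneg_nonneg) auto
  have G: "G \<ge> 1" unfolding G_def using K \<tau> by (simp only: one_le_exp_iff) (rule mult_nonneg_nonneg, auto)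
  \<comment> \<open>Starting at vertical distance at most \<epsilon>, Gronwall bounds the square by
    \<open>2 * \<epsilon>\<^sup>2 * G\<close>, which is then at most
    \<open>\<kappa>\<^sup>2 / (2 * G)\<close>.\<close>
  define \<epsilon> where "\<epsilon> = Min {\<epsilon>1, \<epsilon>2, \<kappa> / (2 * G)}"
  have \<epsilon>: "\<epsilon> > 0" "\<epsilon> \<le> \<epsilon>1" "\<epsilon> \<le> \<epsilon>2" "\<epsilon> \<le> \<kappa> / (2 * G)"
    using 1 2 \<kappa> G by (auto simp: \<epsilon>_def)
  have \<epsilon>G: "(\<epsilon>\<^sup>2 + \<epsilon>\<^sup>2) * G < \<kappa>\<^sup>2"
  proof -
    have "(\<epsilon>\<^sup>2 + \<epsilon>\<^sup>2) * G \<le> 2 * (\<kappa> / (2 * G))\<^sup>2 * G"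
      using \<epsilon> G power_mono[OF \<epsilon>(4), of 2] by (intro mult_right_mono) auto
    also have "\<dots> = \<kappa>\<^sup>2 / 2 * (1 / G)" using G by (simp add: power2_eq_square field_simps)
    also have "\<dots> \<le> \<kappa>\<^sup>2 / 2 * 1" using G by (intro mult_left_mono) auto
    also have "\<dots> < \<kappa>\<^sup>2" using \<kappa> by simp
    finally show ?thesis .
  qed
  \<comment> \<open>The first bound makes the initial vertical distance at most \<epsilon>, the
    second confines the trajectory to the ball of radius \<eta>, and the last two start it between
    the barriers.\<close>
  define r where "r = Min {\<epsilon> / S, \<eta> / 2, w1 - ?a, ?a - w2}"
  have r: "r > 0" "r \<le> \<epsilon> / S" "r \<le> \<eta> / 2" "r \<le> w1 - ?a" "r \<le> ?a - w2"
  proof -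
    show "r > 0" using \<epsilon> S \<eta> w1 w2 by (auto simp: r_def)
  qed (unfold r_def, (rule Min_le; simp)+)
  have rS: "S * r \<le> \<epsilon>" using r S by (simp add: field_simps)
  show ?thesis
  proof (rule that[OF r(1) \<epsilon>(1)])
    fix x u y
    assume x: "x \<in> ball x\<^sub>0 r" and u: "is_control u" and y: "solution_on f u x \<tau> y"
      and small: "\<And>t j. t \<in> {0..\<tau>} \<Longrightarrow> \<bar>defect j (y t)\<bar> \<le> \<epsilon>"
    have y0: "y 0 = x" and cy: "continuous_on {0..\<tau>} y"
      using y unfolding solution_on_def by (auto intro: abs_continuous_on_imp_continuous)
    have yb: "y t \<in> ball x\<^sub>0 \<eta>" if "t \<in> {0..\<tau>}" for t
      using solution_confined[OF u y _ _ that, of \<eta>] \<eta>_less_R \<tau> x r by (auto simp: dist_commute)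
    have ybase: "y t $ k \<in> base" if "t \<in> {0..\<tau>}" for t
      using yb[OF that] component_le_norm_cart[of "y t - x\<^sub>0" k]
      by (auto simp: dist_norm norm_minus_commute)
    have yC: "y t \<in> cball x\<^sub>0 R" if "t \<in> {0..\<tau>}" for t using yb[OF that] \<eta>_less_R by auto
    have xc: "\<bar>x $ i - x\<^sub>0 $ i\<bar> < r" for i
      using x component_le_norm_cart[of "x - x\<^sub>0" i] by (simp add: dist_norm norm_minus_commute)
    have xbase: "x $ k \<in> base" using ybase[of 0] y0 \<tau> by auto
    have d0: "\<bar>x $ l - \<gamma> (x $ k)\<bar> \<le> \<epsilon>"
    proof -
      have "\<bar>\<gamma> (x $ k) - x\<^sub>0 $ l\<bar> \<le> M / c * \<bar>x $ k - ?a\<bar>"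
        using lipschitz_onD[OF \<gamma>_lipschitz xbase, of ?a] \<eta> by (simp add: \<gamma>_start dist_real_def)
      also have "\<dots> \<le> M / c * r" using xc[of k] Mc_nonneg by (intro mult_left_mono) auto
      finally have "\<bar>x $ l - \<gamma> (x $ k)\<bar> \<le> r + M / c * r" using xc[of l] by linarith
      also have "\<dots> = S * r" by (simp only: S_def distrib_right mult_1_left)
      finally show ?thesis using rS by linarith
    qed
    have d: "\<bar>y t $ l - \<gamma> (y t $ k)\<bar> < \<kappa>" if t: "t \<in> {0..\<tau>}" for t
    proof -
      have "(y t $ l - \<gamma> (y t $ k))\<^sup>2 \<le>
          ((x $ l - \<gamma> (x $ k))\<^sup>2 + \<epsilon>\<^sup>2) * exp (4 * (CARD('m) * (1 + Ls * M)) * t)"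
        using t yb small by (intro distance_to_curve[OF u solution_on_restrict[OF y]]) auto
      also have "\<dots> \<le> (\<epsilon>\<^sup>2 + \<epsilon>\<^sup>2) * G"
        unfolding G_def using power_mono[OF d0, of 2] t mult_left_mono[OF _ K, of t \<tau>]
        by (intro mult_mono add_mono) auto
      also have "\<dots> < \<kappa>\<^sup>2" by (rule \<epsilon>G)
      finally have "\<bar>y t $ l - \<gamma> (y t $ k)\<bar>\<^sup>2 < \<kappa>\<^sup>2" by simp
      then show ?thesis using \<kappa>(1) by (rule power2_less_imp_less[OF _ less_imp_le])
    qed
    have near: "dist (y t) (\<phi> (y t $ k)) < \<kappa>" if t: "t \<in> {0..\<tau>}" for t
      using d[OF t] norm_le_abs_components[OF kl, of "y t - \<phi> (y t $ k)"] by (simp add: dist_norm)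
    \<comment> \<open>At the abscissa \<open>w1\<close> the trajectory would be within \<kappa> of
      \<open>\<phi> w1\<close>, where the defect exceeds
      \<open>\<epsilon>1 \<ge> \<epsilon>\<close>.\<close>
    have nw1: "y t $ k \<noteq> w1" if t: "t \<in> {0..\<tau>}" for t
      using near[OF t] 1(3)[OF yC[OF t]] \<kappa>(2) small[OF t, of j1] \<epsilon>(2) by force
    have nw2: "y t $ k \<noteq> w2" if t: "t \<in> {0..\<tau>}" for t
      using near[OF t] 2(3)[OF yC[OF t]] \<kappa>(3) small[OF t, of j2] \<epsilon>(3) by force
    have cyk: "continuous_on {0..\<tau>} (\<lambda>t. y t $ k)" by (intro continuous_intros cy)
    have x12: "w2 \<le> y 0 $ k" "y 0 $ k \<le> w1" using xc[of k] r y0 by (auto simp: abs_less_iff)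
    \<comment> \<open>By the intermediate value theorem a barrier can only be passed by hitting its
      abscissa.\<close>
    have "y \<tau> $ k < w1"
      using IVT'[OF x12(2) _ _ cyk] nw1 \<tau> by force
    moreover have "w2 < y \<tau> $ k"
      using IVT2'[OF _ x12(1) _ cyk] nw2 \<tau> by force
    ultimately have k: "\<bar>y \<tau> $ k - ?a\<bar> < \<eta>'" using w1 w2 by auto
    have \<tau>': "\<tau> \<in> {0..\<tau>}" using \<tau> by simp
    have "\<bar>\<gamma> (y \<tau> $ k) - x\<^sub>0 $ l\<bar> \<le> M / c * \<bar>y \<tau> $ k - ?a\<bar>"
      using lipschitz_onD[OF \<gamma>_lipschitz ybase[OF \<tau>'], of ?a] \<eta> by (simp add: \<gamma>_start dist_real_def)
    also have "\<dots> \<le> M / c * \<eta>'" using k Mc_nonneg by (intro mult_left_mono) auto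
    finally have "\<bar>y \<tau> $ l - x\<^sub>0 $ l\<bar> < \<kappa> + M / c * \<eta>'" using d[OF \<tau>'] by linarith
    then have "norm (y \<tau> - x\<^sub>0) < \<eta>' + (\<kappa> + M / c * \<eta>')"
      using norm_le_abs_components[OF kl, of "y \<tau> - x\<^sub>0"] k
      unfolding vector_minus_component by linarith
    also have "\<dots> = S * \<eta>' + \<kappa>" by (simp add: S_def distrib_right)
    also have "\<dots> < r1" using \<eta>'(3) \<kappa>(4) r1 by linarith
    finally show "y \<tau> \<in> ball x\<^sub>0 r1" by (simp add: dist_norm norm_minus_commute)
  qed
qed

lemma defect_uniform:
  assumes "\<epsilon> > 0"
  obtains \<rho> where "\<rho> > 0"
    "\<And>j z z'. z \<in> cball x\<^sub>0 R \<Longrightarrow> z' \<in> cball x\<^sub>0 R \<Longrightarrow> dist z z' < \<rho> \<Longrightarrow> \<bar>defect j z - defect j z'\<bar> < \<epsilon>"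
proof -
  have "\<exists>\<rho>>0. \<forall>z\<in>cball x\<^sub>0 R. \<forall>z'\<in>cball x\<^sub>0 R. dist z z' < \<rho> \<longrightarrow> \<bar>defect j z - defect j z'\<bar> < \<epsilon>" for j
    using compact_uniformly_continuous[OF continuous_defect[of j]] assms
    unfolding uniformly_continuous_on_def dist_real_def by (metis compact_cball dist_commute)
  then obtain \<rho> where \<rho>: "\<And>j. \<rho> j > 0"
    "\<And>j z z'. z \<in> cball x\<^sub>0 R \<Longrightarrow> z' \<in> cball x\<^sub>0 R \<Longrightarrow> dist z z' < \<rho> j \<Longrightarrow> \<bar>defect j z - defect j z'\<bar> < \<epsilon>"
    by metis
  show ?thesis
  proof (rule that[of "Min (range \<rho>)"])
    show "Min (range \<rho>) > 0" using \<rho>(1) by simp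
    fix j z z' assume "z \<in> cball x\<^sub>0 R" "z' \<in> cball x\<^sub>0 R" "dist z z' < Min (range \<rho>)"
    then show "\<bar>defect j z - defect j z'\<bar> < \<epsilon>" by (intro \<rho>(2)) auto
  qed
qed

text \<open>
  A trajectory leaving the ball either meets a point where the fields span the plane, where
  trajectories from nearby points can catch up with it, or it wastes a fixed amount of time.
\<close>

lemma compare_trajectories:
  obtains r \<Lambda> \<delta> where "r > 0" "\<Lambda> \<ge> 0" "\<delta> > 0"
    "\<And>x x' t z. x \<in> ball x\<^sub>0 r \<Longrightarrow> x' \<in> ball x\<^sub>0 r \<Longrightarrow> x \<noteq> x' \<Longrightarrow> z \<notin> cball x\<^sub>0 R \<Longrightarrow> reach f t x z \<Longrightarrow>
      (\<exists>s\<le>t + \<Lambda> * dist x x'. reach f s x' z) \<or> (\<exists>s\<le>t - \<delta>. reach f s x z)"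
proof -
  let ?N = "real CARD('m)"
  have NL: "?N * L \<ge> 0" and NM: "?N * M \<ge> 0" using L_nonneg M_nonneg by auto
  \<comment> \<open>Short enough for \<open>tracking\<close> to apply and for trajectories to travel
    at most \<open>\<eta> / 4\<close>.\<close>
  define \<tau> where "\<tau> = min (1 / (4 * (?N * L + 1))) (\<eta> / (4 * (?N * M + 1)))"
  have \<tau>: "\<tau> > 0" using NL NM \<eta> by (auto simp: \<tau>_def intro!: divide_pos_pos add_nonneg_pos)
  have \<tau>L: "4 * (?N * L) * \<tau> \<le> 1"
  proof -
    have "4 * (?N * L) * \<tau> \<le> 4 * (?N * L + 1) * (1 / (4 * (?N * L + 1)))"
      using \<tau> NL by (intro mult_mono) (auto simp: \<tau>_def)
    also have "\<dots> = 1" using NL by (simp add: divide_simps)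
    finally show ?thesis .
  qed
  have \<tau>M: "?N * M * \<tau> \<le> \<eta> / 4"
  proof -
    have "?N * M * \<tau> \<le> (?N * M + 1) * (\<eta> / (4 * (?N * M + 1)))"
      using \<tau> NM by (intro mult_mono) (auto simp: \<tau>_def)
    also have "\<dots> = \<eta> / 4" using NM by (simp add: divide_simps)
    finally show ?thesis .
  qed
  obtain r1 where r1: "r1 > 0"
    "\<And>p q. p \<in> ball x\<^sub>0 r1 \<Longrightarrow> q \<in> ball x\<^sub>0 r1 \<Longrightarrow> \<exists>t<\<tau> / 2. reach f t p q"
    using small_time_controllable[of "\<tau> / 2"] \<tau> by (metis half_gt_zero)
  obtain r2 \<epsilon> where r2: "r2 > 0" and \<epsilon>: "\<epsilon> > 0"
    and trap: "\<And>x u y. x \<in> ball x\<^sub>0 r2 \<Longrightarrow> is_control u \<Longrightarrow> solution_on f u x \<tau> y \<Longrightarrow>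
      (\<And>t j. t \<in> {0..\<tau>} \<Longrightarrow> \<bar>defect j (y t)\<bar> \<le> \<epsilon>) \<Longrightarrow> y \<tau> \<in> ball x\<^sub>0 r1"
  proof (rule trapped[OF \<tau> _ r1(1)])
    show "?N * M * \<tau> < \<eta> / 2" using \<tau>M \<eta> by linarith
  qed blast
  obtain \<rho> where \<rho>: "\<rho> > 0"
    "\<And>j z z'. z \<in> cball x\<^sub>0 R \<Longrightarrow> z' \<in> cball x\<^sub>0 R \<Longrightarrow> dist z z' < \<rho> \<Longrightarrow> \<bar>defect j z - defect j z'\<bar> < \<epsilon> / 2"
    using defect_uniform[of "\<epsilon> / 2"] \<epsilon> by (metis half_gt_zero)
  let ?C = "steer_const (\<epsilon> / 2)"
  have C: "?C > 0" using steer_const_pos \<epsilon> by simp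
  \<comment> \<open>The end of the tracking curve is less than \<open>6 * r\<close> away from the
    trajectory: \<open>R / 12\<close> keeps it in the ball, and \<open>\<rho> / 6\<close> keeps the
    defect above \<open>\<epsilon> / 2\<close> on the joining segment.\<close>
  define r where "r = Min {r1, r2, R / 12, \<rho> / 6}"
  have r: "r > 0" "r \<le> r1" "r \<le> r2" "r \<le> R / 12" "r \<le> \<rho> / 6"
    using r1 r2 R \<rho> by (auto simp: r_def)
  have \<tau>R: "?N * M * \<tau> < R / 4" using \<tau>M \<eta>_less_R by simp
  show ?thesis
  proof (rule that[of r "3 * ?C" "\<tau> / 2"])
    fix x x' t z
    assume x: "x \<in> ball x\<^sub>0 r" "x' \<in> ball x\<^sub>0 r" "x \<noteq> x'" and z: "z \<notin> cball x\<^sub>0 R" and "reach f t x z"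
    then obtain u y where u: "is_control u" and y: "solution_on f u x t y" "y t = z" and t: "t \<ge> 0"
      unfolding reach_def by blast
    have half: "y s \<in> ball x\<^sub>0 (R / 2)" if "s \<le> t" "s \<in> {0..\<tau>}" for s
    proof (rule solution_confined[OF u solution_on_restrict[OF y(1) that(1)]])
      have "?N * M * s \<le> ?N * M * \<tau>" using that NM by (intro mult_left_mono) auto
      moreover have "dist x x\<^sub>0 < r" using x(1) by (simp add: dist_commute)
      ultimately show "?N * M * s < R / 2 - dist x x\<^sub>0" using \<tau>R r by linarith
    qed (use that R in auto)
    \<comment> \<open>Up to time \<tau> the trajectory is within \<open>R / 2\<close> of
      \<open>x\<^sub>0\<close>, but it ends outside the ball.\<close>
    have t\<tau>: "\<tau> < t"
      using half[of t] z y(2) t R by (cases "t \<le> \<tau>") auto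
    show "(\<exists>s\<le>t + 3 * ?C * dist x x'. reach f s x' z) \<or> (\<exists>s\<le>t - \<tau> / 2. reach f s x z)"
    proof (cases "\<exists>s\<in>{0..\<tau>}. \<exists>j. \<epsilon> < \<bar>defect j (y s)\<bar>")
      case True
      then obtain s j where s: "s \<in> {0..\<tau>}" and j: "\<epsilon> < \<bar>defect j (y s)\<bar>" by blast
      have st: "s \<le> t" "0 \<le> s" using s t\<tau> by auto
      have "x \<in> ball x\<^sub>0 (R / 2)" "x' \<in> ball x\<^sub>0 (R / 2)" using x r R by auto
      moreover have "4 * (?N * L) * s \<le> 1"
        using s NL by (intro order_trans[OF mult_left_mono[of s \<tau>] \<tau>L]) auto
      moreover have "?N * M * s < R / 2"
      proof -
        have "?N * M * s \<le> ?N * M * \<tau>" using s NM by (intro mult_left_mono) auto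
        then show ?thesis using \<tau>R R by linarith
      qed
      \<comment> \<open>The approximation error is chosen as \<open>dist x x'\<close>, which is
        positive since the points differ, so the total error is still linear in it.\<close>
      ultimately obtain z' where z': "reach f s x' z'" "dist z' (y s) \<le> 2 * dist x x' + dist x x'"
        using tracking[of x x' s u y "dist x x'"] st u solution_on_restrict[OF y(1) st(1)] x(3) by auto
      have "dist x x' < 2 * r" using x dist_triangle[of x x' x\<^sub>0] by (simp add: dist_commute)
      then have zy: "dist z' (y s) < 6 * r" using z'(2) by linarith
      have ys: "y s \<in> ball x\<^sub>0 (R / 2)" by (rule half[OF st(1) s])
      have z'R: "z' \<in> ball x\<^sub>0 R"
        using zy ys r dist_triangle[of x\<^sub>0 z' "y s"] by (simp add: dist_commute)
      have seg: "closed_segment z' (y s) \<subseteq> cball x\<^sub>0 R"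
        using z'R ys R by (intro closed_segment_subset) auto
      have "reach f (?C * dist z' (y s)) z' (y s)"
      proof (rule steering[OF _ seg, of _ j])
        fix q assume q: "q \<in> closed_segment z' (y s)"
        have "dist q (y s) \<le> dist z' (y s)"
          using dist_in_closed_segment[OF q] by (simp add: dist_commute)
        then have "dist q (y s) < \<rho>" using zy r by linarith
        then have "\<bar>defect j q - defect j (y s)\<bar> < \<epsilon> / 2"
          using q seg by (intro \<rho>(2)) auto
        then show "\<epsilon> / 2 \<le> \<bar>defect j q\<bar>" using j by linarith
      qed (use \<epsilon> in simp)
      moreover have "reach f (t - s) (y s) (y t)"
        by (rule reach_segment[of f, OF f u y(1)]) (use st in auto)
      ultimately have reach1: "reach f (s + ?C * dist z' (y s) + (t - s)) x' z"
        using reach_trans[of f, OF f] z'(1) y(2) by blast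
      have "?C * dist z' (y s) \<le> ?C * (3 * dist x x')" using z'(2) C by (intro mult_left_mono) auto
      then have "s + ?C * dist z' (y s) + (t - s) \<le> t + 3 * ?C * dist x x'" by simp
      with reach1 show ?thesis by blast
    next
      case False
      then have "y \<tau> \<in> ball x\<^sub>0 r1"
        using x(1) r u solution_on_restrict[OF y(1), of \<tau>] t\<tau> by (intro trap[of x u y]) (auto simp: not_less)
      moreover have "x \<in> ball x\<^sub>0 r1" using x r by auto
      \<comment> \<open>A shortcut: the displacement that took time \<tau> is redone in less than
        \<open>\<tau> / 2\<close>, starting from the same point \<open>x\<close>.\<close>
      ultimately obtain s where "s < \<tau> / 2" "reach f s x (y \<tau>)" using r1(2) by blast
      moreover have "reach f (t - \<tau>) (y \<tau>) (y t)"
        by (rule reach_segment[of f, OF f u y(1)]) (use \<tau> t\<tau> in auto)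
      ultimately have "reach f (s + (t - \<tau>)) x z" "s + (t - \<tau>) \<le> t - \<tau> / 2"
        using reach_trans[of f, OF f] y(2) by auto
      then show ?thesis by blast
    qed
  qed (use r C \<tau> in auto)
qed

end

section \<open>Local data around a given point\<close>

lemma smooth_field_continuous: "smooth_field V \<Longrightarrow> continuous_on S V"
  by (meson continuous_at_imp_continuous_on has_derivative_continuous smooth_field_derivative)

lemma smooth_field_lipschitz:
  assumes "smooth_field V"
  shows "\<exists>L\<ge>0. L-lipschitz_on (cball x R) V"
proof -
  have "\<forall>i. \<exists>L\<ge>0. L-lipschitz_on (cball x R) (\<lambda>x. V x $ i)"
    using assms smooth_fun_lipschitz unfolding smooth_field_def by blast
  then obtain L where L: "\<And>i. L i \<ge> 0" "\<And>i. (L i)-lipschitz_on (cball x R) (\<lambda>x. V x $ i)" by metis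
  have "(\<Sum>i\<in>UNIV. L i)-lipschitz_on (cball x R) V"
  proof (rule lipschitz_onI)
    fix a b assume ab: "a \<in> cball x R" "b \<in> cball x R"
    have "dist (V a) (V b) \<le> (\<Sum>i\<in>UNIV. \<bar>(V a - V b) $ i\<bar>)"
      unfolding dist_norm by (rule norm_le_l1_cart)
    also have "\<dots> \<le> (\<Sum>i\<in>UNIV. L i * dist a b)"
      using lipschitz_onD[OF L(2) ab] by (intro sum_mono) (simp add: dist_real_def)
    finally show "dist (V a) (V b) \<le> (\<Sum>i\<in>UNIV. L i) * dist a b" by (simp add: sum_distrib_right)
  qed (use L in \<open>auto intro: sum_nonneg\<close>)
  then show ?thesis using L by (intro exI[of _ "\<Sum>i\<in>UNIV. L i"]) (auto intro: sum_nonneg)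
qed

lemma lipschitz_on_divide:
  fixes g h :: "'a::metric_space \<Rightarrow> real"
  assumes g: "A-lipschitz_on S g" and h: "B-lipschitz_on S h" and c: "c > 0"
    and gM: "\<And>x. x \<in> S \<Longrightarrow> \<bar>g x\<bar> \<le> M" and hc: "\<And>x. x \<in> S \<Longrightarrow> c \<le> \<bar>h x\<bar>"
  shows "(A / c + \<bar>M\<bar> * B / c\<^sup>2)-lipschitz_on S (\<lambda>x. g x / h x)"
proof (rule lipschitz_onI)
  have AB: "A \<ge> 0" "B \<ge> 0" using g h lipschitz_on_nonneg by auto
  then show "0 \<le> A / c + \<bar>M\<bar> * B / c\<^sup>2" using c by simp
  fix x y assume xy: "x \<in> S" "y \<in> S"
  have nz: "h x \<noteq> 0" "h y \<noteq> 0" using hc[OF xy(1)] hc[OF xy(2)] c by auto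
  have "g x / h x - g y / h y = (g x - g y) / h x + g y * (h y - h x) / (h x * h y)"
    using nz by (simp add: field_simps)
  also have "\<bar>\<dots>\<bar> \<le> \<bar>g x - g y\<bar> / \<bar>h x\<bar> + \<bar>g y\<bar> * \<bar>h y - h x\<bar> / (\<bar>h x\<bar> * \<bar>h y\<bar>)"
    by (rule order_trans[OF abs_triangle_ineq]) (simp add: abs_mult)
  also have "\<dots> \<le> A * dist x y / c + \<bar>M\<bar> * (B * dist x y) / (c * c)"
    using lipschitz_onD[OF g xy] lipschitz_onD[OF h xy(2,1)] gM[OF xy(2)] hc[OF xy(1)] hc[OF xy(2)] c AB
    by (intro add_mono frac_le mult_mono mult_nonneg_nonneg mult_pos_pos)
       (auto simp: dist_real_def dist_commute)
  also have "\<dots> = (A / c + \<bar>M\<bar> * B / c\<^sup>2) * dist x y"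
    by (simp add: power2_eq_square distrib_right)
  finally show "dist (g x / h x) (g y / h y) \<le> (A / c + \<bar>M\<bar> * B / c\<^sup>2) * dist x y"
    by (simp add: dist_real_def)
qed

text \<open>Some component of some field is nonzero at \<open>x\<^sub>0\<close>, hence bounded away
  from 0 on a small ball; compactness supplies the other constants. The bound \<open>R0\<close>
  allows the ball to be kept away from the target.\<close>

lemma planar_curve_exists:
  fixes f :: "'m::finite \<Rightarrow> real ^ 2 \<Rightarrow> real ^ 2"
  assumes smooth: "\<And>i. smooth_field (f i)" and hoer: "hoermander f" and R0: "R0 > 0"
  obtains R M L i k l c Ls \<eta> \<gamma> where "R \<le> R0" "planar_curve f x\<^sub>0 R M L i k l c Ls \<eta> \<gamma>"
proof -
  obtain i k where ik: "f i x\<^sub>0 $ k \<noteq> 0" using hoermander_nonvanishing[OF hoer smooth] by blast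
  obtain l :: 2 where kl: "k \<noteq> l" by (metis exhaust_2 zero_neq_one one_neq_zero num1_eq1)
  define c where "c = \<bar>f i x\<^sub>0 $ k\<bar> / 2"
  have c: "c > 0" using ik by (simp add: c_def)
  have comp: "smooth_fun (\<lambda>x. f j x $ r)" for j r using smooth unfolding smooth_field_def by blast
  have "continuous (at x\<^sub>0) (\<lambda>x. f i x $ k)"
    using smooth_fun_continuous[OF comp, of UNIV] continuous_on_eq_continuous_at open_UNIV by blast
  then obtain d where d: "d > 0" "\<And>x. dist x x\<^sub>0 < d \<Longrightarrow> dist (f i x $ k) (f i x\<^sub>0 $ k) < c"
    using c unfolding continuous_at_eps_delta by (auto simp: dist_real_def)
  define R where "R = min R0 (d / 2)"
  have RR0: "R \<le> R0" by (simp add: R_def)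
  have R: "R > 0" "R < d" using R0 d by (auto simp: R_def)
  have fk: "c \<le> \<bar>f i x $ k\<bar>" if "x \<in> cball x\<^sub>0 R" for x
  proof -
    have "dist x x\<^sub>0 < d" using that R by (simp add: dist_commute)
    from d(2)[OF this] show ?thesis unfolding c_def dist_real_def by linarith
  qed
  have "\<forall>j. \<exists>L\<ge>0. L-lipschitz_on (cball x\<^sub>0 R) (f j)"
    using smooth_field_lipschitz[OF smooth] by blast
  then obtain L where L: "\<And>j. L j \<ge> 0" "\<And>j. (L j)-lipschitz_on (cball x\<^sub>0 R) (f j)" by metis
  define L' where "L' = (\<Sum>j\<in>UNIV. L j)"
  have L': "L'-lipschitz_on (cball x\<^sub>0 R) (f j)" for j
    using member_le_sum[of j UNIV L] L(1) by (intro lipschitz_on_le[OF L(2)[of j]]) (simp add: L'_def)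
  have cf: "continuous_on UNIV (f j)" for j
    by (rule smooth_field_continuous[OF smooth])
  have "\<exists>M\<ge>0. \<forall>x\<in>cball x\<^sub>0 R. norm (f j x) \<le> M" for j
  proof -
    have "bounded (f j ` cball x\<^sub>0 R)"
      by (intro compact_imp_bounded compact_continuous_image compact_cball continuous_on_subset[OF cf]) auto
    then show ?thesis unfolding bounded_pos by (auto intro: less_imp_le)
  qed
  then obtain M where M: "\<And>j. M j \<ge> 0" "\<And>j x. x \<in> cball x\<^sub>0 R \<Longrightarrow> norm (f j x) \<le> M j" by metis
  define M' where "M' = (\<Sum>j\<in>UNIV. M j)"
  have M': "norm (f j x) \<le> M'" if "x \<in> cball x\<^sub>0 R" for j x
    using M(2)[OF that, of j] member_le_sum[of j UNIV M] M(1) by (simp add: M'_def)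
  obtain A B where "A-lipschitz_on (cball x\<^sub>0 R) (\<lambda>x. f i x $ l)" "B-lipschitz_on (cball x\<^sub>0 R) (\<lambda>x. f i x $ k)"
    using smooth_fun_lipschitz[OF comp] by meson
  then have slope: "(A / c + \<bar>M'\<bar> * B / c\<^sup>2)-lipschitz_on (cball x\<^sub>0 R) (\<lambda>x. f i x $ l / f i x $ k)"
    by (rule lipschitz_on_divide[OF _ _ c]) (use fk M' component_le_norm_cart order_trans in blast)+
  interpret planar_control f x\<^sub>0 R M' L' i k l c "A / c + \<bar>M'\<bar> * B / c\<^sup>2"
    by unfold_locales (use cf R M' L' kl smooth hoer c fk slope in auto)
  obtain \<eta> \<gamma> where "planar_curve f x\<^sub>0 R M' L' i k l c (A / c + \<bar>M'\<bar> * B / c\<^sup>2) \<eta> \<gamma>"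
  proof (rule integral_curve)
    fix \<eta> \<gamma> assume *: "0 < \<eta>"
      "\<And>w. w \<in> {x\<^sub>0 $ k - \<eta>..x\<^sub>0 $ k + \<eta>} \<Longrightarrow>
        (\<gamma> has_vector_derivative slope (pt w (\<gamma> w))) (at w within {x\<^sub>0 $ k - \<eta>..x\<^sub>0 $ k + \<eta>})"
      "\<And>w. w \<in> {x\<^sub>0 $ k - \<eta>..x\<^sub>0 $ k + \<eta>} \<Longrightarrow> pt w (\<gamma> w) \<in> ball x\<^sub>0 R"
      "\<gamma> (x\<^sub>0 $ k) = x\<^sub>0 $ l"
    have "planar_curve f x\<^sub>0 R M' L' i k l c (A / c + \<bar>M'\<bar> * B / c\<^sup>2) \<eta> \<gamma>"
      by unfold_locales (fact *)+
    then show thesis by (rule that)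
  qed
  then show ?thesis using that RR0 by blast
qed

section \<open>The minimum time function\<close>

lemma min_time_eq_reach:
  "min_time f K x = Inf {ereal t | t. \<exists>z\<in>K. reach f t x z}"
proof -
  have "{ereal t | t. t \<ge> 0 \<and> (\<exists>u y. is_control u \<and> solution_on f u x t y \<and> y t \<in> K)}
      = {ereal t | t. \<exists>z\<in>K. reach f t x z}"
    unfolding reach_def by blast
  then show ?thesis unfolding min_time_def by simp
qed

lemma min_time_le: "reach f t x z \<Longrightarrow> z \<in> K \<Longrightarrow> min_time f K x \<le> ereal t"
  unfolding min_time_eq_reach by (intro Inf_lower) blast

lemma min_time_nonneg: "0 \<le> min_time f K x"
  unfolding min_time_eq_reach by (intro Inf_greatest) (auto simp: reach_def)

lemma min_time_less_obtains:
  assumes "min_time f K x < ereal s"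
  obtains t z where "t < s" "z \<in> K" "reach f t x z"
  using assms unfolding min_time_eq_reach Inf_less_iff by auto

text \<open>By local controllability in both directions, the set of points from which
  \<open>z\<close> can be reached is open and closed; the plane is connected.\<close>

lemma reachable_everywhere:
  fixes f :: "'m::finite \<Rightarrow> real ^ 2 \<Rightarrow> real ^ 2"
  assumes smooth: "\<And>i. smooth_field (f i)" and hoer: "hoermander f"
  shows "\<exists>t. reach f t x z"
proof -
  have cf: "continuous_on UNIV (f j)" for j
    by (rule smooth_field_continuous[OF smooth])
  have loc: "\<exists>r>0. \<forall>p\<in>ball a r. \<forall>q\<in>ball a r. \<exists>t. reach f t p q" for a
  proof -
    obtain R M L i k l c Ls \<eta> \<gamma> where "planar_curve f a R M L i k l c Ls \<eta> \<gamma>"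
      using planar_curve_exists[OF smooth hoer zero_less_one] by metis
    then interpret planar_curve f a R M L i k l c Ls \<eta> \<gamma> .
    show ?thesis using small_time_controllable[OF zero_less_one] by metis
  qed
  define S where "S = {x. \<exists>t. reach f t x z}"
  have "\<exists>r>0. ball a r \<subseteq> S" if "a \<in> S" for a
  proof -
    obtain r where r: "r > 0" "\<forall>p\<in>ball a r. \<forall>q\<in>ball a r. \<exists>t. reach f t p q" using loc by blast
    have "p \<in> S" if p: "p \<in> ball a r" for p
    proof -
      obtain t where "reach f t p a" using r p by (meson centre_in_ball)
      moreover obtain s where "reach f s a z" using \<open>a \<in> S\<close> by (auto simp: S_def)
      ultimately show ?thesis using reach_trans[of f, OF cf] unfolding S_def by blast
    qed
    then show ?thesis using r by blast
  qed
  then have "open S" by (simp add: open_contains_ball)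
  moreover have "\<exists>r>0. ball a r \<subseteq> - S" if "a \<notin> S" for a
  proof -
    obtain r where r: "r > 0" "\<forall>p\<in>ball a r. \<forall>q\<in>ball a r. \<exists>t. reach f t p q" using loc by blast
    have "p \<notin> S" if p: "p \<in> ball a r" for p
    proof
      assume "p \<in> S"
      then obtain s where "reach f s p z" by (auto simp: S_def)
      moreover obtain t where "reach f t a p" using r p by (meson centre_in_ball)
      ultimately show False using reach_trans[of f, OF cf] \<open>a \<notin> S\<close> unfolding S_def by blast
    qed
    then show ?thesis using r by blast
  qed
  then have "closed S" by (simp add: closed_def open_contains_ball)
  moreover have "z \<in> S" unfolding S_def using reach_refl by blast
  ultimately have "S = UNIV" using connected_clopen[of "UNIV :: (real ^ 2) set"] by (auto simp: connected_UNIV)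
  then show ?thesis by (auto simp: S_def)
qed

theorem theorem8:
  fixes f :: "'m::finite \<Rightarrow> real ^ 2 \<Rightarrow> real ^ 2"
    and K :: "(real ^ 2) set"
  assumes "\<And>i. real_analytic (f i)"
    and "hoermander f"
    and "K \<noteq> {}"
    and "closed K"
  shows "(\<forall>x\<in>- K. \<bar>min_time f K x\<bar> \<noteq> \<infinity>) \<and>
    locally_lipschitz_on (- K) (\<lambda>x. real_of_ereal (min_time f K x))"
proof
  have smooth: "smooth_field (f i)" for i
    unfolding smooth_field_def
    using smooth_fun_real_analytic real_analytic_component assms(1) by blast
  define T where "T x = real_of_ereal (min_time f K x)" for x
  have finite: "\<bar>min_time f K x\<bar> \<noteq> \<infinity>" for x
  proof -
    obtain z where "z \<in> K" using assms(3) by blast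
    moreover obtain t where "reach f t x z" using reachable_everywhere[OF smooth assms(2)] by blast
    ultimately have "min_time f K x \<le> ereal t" by (rule min_time_le[rotated])
    then show ?thesis using min_time_nonneg[of f K x] by auto
  qed
  then show "\<forall>x\<in>- K. \<bar>min_time f K x\<bar> \<noteq> \<infinity>" by (intro ballI)
  have T: "min_time f K x = ereal (T x)" for x
    using finite[of x] by (simp add: T_def ereal_real')
  show "locally_lipschitz_on (- K) T"
    unfolding locally_lipschitz_on_def
  proof
    fix x\<^sub>0 assume "x\<^sub>0 \<in> - K"
    then obtain R0 where R0: "R0 > 0" "cball x\<^sub>0 R0 \<subseteq> - K"
      using assms(4) open_contains_cball[of "- K"] by (auto simp: open_Compl)
    obtain R M L i k l c Ls \<eta> \<gamma> where RR0: "R \<le> R0" and "planar_curve f x\<^sub>0 R M L i k l c Ls \<eta> \<gamma>"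
      using planar_curve_exists[OF smooth assms(2) R0(1)] by metis
    then interpret planar_curve f x\<^sub>0 R M L i k l c Ls \<eta> \<gamma> by simp
    obtain r \<Lambda> \<delta> where r: "r > 0" "\<Lambda> \<ge> 0" "\<delta> > 0"
      and cmp: "\<And>x x' t z. x \<in> ball x\<^sub>0 r \<Longrightarrow> x' \<in> ball x\<^sub>0 r \<Longrightarrow> x \<noteq> x' \<Longrightarrow> z \<notin> cball x\<^sub>0 R \<Longrightarrow> reach f t x z \<Longrightarrow>
        (\<exists>s\<le>t + \<Lambda> * dist x x'. reach f s x' z) \<or> (\<exists>s\<le>t - \<delta>. reach f s x z)"
      by (rule compare_trajectories) blast
    have le: "T x' \<le> T x + \<Lambda> * dist x x'" if x: "x \<in> ball x\<^sub>0 r" "x' \<in> ball x\<^sub>0 r" "x \<noteq> x'" for x x'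
    proof (rule field_le_epsilon)
      fix e :: real assume e: "e > 0"
      \<comment> \<open>The tolerance is also at most \<delta>, so that a trajectory to the target
        that is \<delta> faster would beat the infimum.\<close>
      have "min_time f K x < ereal (T x + min e \<delta>)" using e r by (simp add: T)
      then obtain t z where tz: "t < T x + min e \<delta>" "z \<in> K" "reach f t x z"
        by (rule min_time_less_obtains)
      \<comment> \<open>The ball of radius \<open>R\<close> misses the target, so the trajectory has
        to leave it.\<close>
      have "z \<notin> cball x\<^sub>0 R" using subset_cball[OF RR0, of x\<^sub>0] R0 tz(2) by blast
      from cmp[OF x this tz(3)] show "T x' \<le> T x + \<Lambda> * dist x x' + e"
      proof
        assume "\<exists>s\<le>t + \<Lambda> * dist x x'. reach f s x' z"
        then obtain s where s: "s \<le> t + \<Lambda> * dist x x'" "reach f s x' z" by blast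
        have "T x' \<le> s" using min_time_le[OF s(2) tz(2)] by (simp add: T)
        then show ?thesis using s(1) tz(1) by linarith
      next
        \<comment> \<open>Impossible: \<open>T x \<le> s \<le> t - \<delta> < T x\<close>.\<close>
        assume "\<exists>s\<le>t - \<delta>. reach f s x z"
        then obtain s where s: "s \<le> t - \<delta>" "reach f s x z" by blast
        have "T x \<le> s" using min_time_le[OF s(2) tz(2)] by (simp add: T)
        then show ?thesis using s(1) tz(1) by linarith
      qed
    qed
    have "\<Lambda>-lipschitz_on (ball x\<^sub>0 r \<inter> - K) T"
    proof (rule lipschitz_onI[OF _ r(2)])
      fix x x' assume "x \<in> ball x\<^sub>0 r \<inter> - K" "x' \<in> ball x\<^sub>0 r \<inter> - K"
      then show "dist (T x) (T x') \<le> \<Lambda> * dist x x'"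
        using le[of x x'] le[of x' x] by (cases "x = x'") (auto simp: dist_real_def abs_le_iff dist_commute)
    qed
    then show "\<exists>r>0. \<exists>L. L-lipschitz_on (ball x\<^sub>0 r \<inter> - K) T" using r(1) by blast
  qed
qed

end
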